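(* For every integer $k\ge 1$ there exists a constant $C_k\ge 1$, depending only on $k$, such that for every integer $n\ge 1$ the following holds. Let $G$ be the $n\times n$ random matrix with i.i.d. standard real Gaussian entries. Then $$ C_k^{-1}\,\frac1t\;\le\;\mathbb{P}\big\{\|G^{-k}\|_{HS}\ge t^k\sqrt{n}\big\}\;\le\; C_k\,\frac1t\qquad\text{for all } t\in[1,\infty), $$ and $$ C_k^{-1}\,t\;\le\;\mathbb{P}\big\{s_{\min}(G^{k})\le t^k\,n^{-1/2}\big\}\;\le\; C_k\,t\qquad\text{for all } t\in(0,1]. $$
   Context: $\|\cdot\|_{HS}$ denotes the Hilbert--Schmidt (Frobenius) norm of a matrix, $s_{\min}(A)$ denotes the smallest singular value of a square matrix $A$, and $G^{-k}=(G^{-1})^k$, which is well defined almost surely since $G$ is almost surely invertible. *)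

theory Defs
  imports "HOL-Probability.Probability" "Jordan_Normal_Form.Char_Poly"
    "Jordan_Normal_Form.Gauss_Jordan_Elimination"
begin

definition std_gaussian :: "real measure" where
  "std_gaussian = density lborel (\<lambda>x. ennreal (std_normal_density x))"

text \<open>
  The canonical sample space of the Gaussian matrix: its points are the arrays of entries, the
  entries are independent by the product construction, and the random matrix is
  \<^term>\<open>\<lambda>\<omega>. Matrix.mat n n \<omega>\<close>. The dimension is a number and not a type, so
  that constants can be quantified before it.
\<close>

definition gaussian_entries :: "nat \<Rightarrow> (nat \<times> nat \<Rightarrow> real) measure" where
  "gaussian_entries n = Pi\<^sub>M ({0..<n} \<times> {0..<n}) (\<lambda>_. std_gaussian)"

definition hs_norm :: "real Matrix.mat \<Rightarrow> real" where
  "hs_norm A = sqrt (\<Sum>i<dim_row A. \<Sum>j<dim_col A. (A $$ (i, j))\<^sup>2)"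

definition singular_values :: "real Matrix.mat \<Rightarrow> real set" where
  "singular_values A = {sqrt l | l. eigenvalue (A\<^sup>T * A) l}"

definition s_min :: "real Matrix.mat \<Rightarrow> real" where
  "s_min A = Min (singular_values A)"

text \<open>\<open>mat_inverse\<close> returns \<open>None\<close> exactly at singular square matrices; the zero
  matrix there is a dummy value on a null set of Gaussian matrices.\<close>

definition inv_mat :: "real Matrix.mat \<Rightarrow> real Matrix.mat" where
  "inv_mat A = (case mat_inverse A of Some B \<Rightarrow> B | None \<Rightarrow> 0\<^sub>m (dim_row A) (dim_row A))"

end

theory Submission
  imports Defs
begin

text \<open>
  Let \<open>G\<close> be the Gaussian matrix and \<open>A\<close> its inverse; the law of \<open>G\<close> is invariant under rotations of the rows
  and of the columns.

  For the upper bounds, \<open>\<parallel>A e\<^sub>0\<parallel>\<close> is the reciprocal of the modulus of a standard Gaussian variable. Applying \<open>A\<close> to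
  random sign vectors transfers this to \<open>P(\<parallel>A\<parallel> \<ge> s sqrt n) \<le> C / s\<close> for the Hilbert--Schmidt norm, and to bounds of order
  \<open>t ^ (2k - 1) / n ^ k\<close> for the moments of order \<open>2k\<close> of the entries of \<open>A\<close> on the event \<open>\<parallel>A\<parallel> \<le> t sqrt n\<close>. Expanding
  the entries of \<open>A ^ k\<close> over paths and flipping the signs of the rows at random, the cross terms cancel and on this event
  \<open>\<parallel>A ^ k\<parallel>\<^sup>2\<close> has mean at most \<open>C t ^ (2k - 1) n\<close>; Markov's inequality finishes.

  For the lower bounds, let \<open>w\<close> be the unit vector orthogonal to all rows but the first, and \<open>\<gamma>\<close> its inner product with
  the first row. Then \<open>\<gamma> ^ k w\<^sup>T A ^ k z\<close>, with a vector \<open>z\<close> independent of \<open>\<gamma>\<close>, is a polynomial of degree at most \<open>k\<close> in the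
  Gaussian variable \<open>\<gamma>\<close> with value \<open>(z \<bullet> w) ^ (k - 1) \<parallel>z\<parallel>\<^sup>2\<close> at 0. Since finite differences of order \<open>k + 1\<close> vanish, it keeps this
  order of magnitude on a fixed proportion of \<open>0 < \<gamma> \<le> 1 / t\<close>. With probability bounded below, \<open>\<parallel>z\<parallel>\<close> is of order \<open>sqrt n\<close>
  and \<open>z \<bullet> w\<close> of order 1, so the operator norm of \<open>A ^ k\<close> exceeds \<open>c t ^ k sqrt n\<close> with probability of order \<open>1 / t\<close>.
\<close>

section \<open>Rotation invariance of Gaussian product measures\<close>

text \<open>Only two of the four inequalities are proved directly: the upper bound for the
  Hilbert--Schmidt norm and the lower bound for \<open>s_min\<close>. The smallest singular value of
  \<open>G ^ k\<close> is the reciprocal of the operator norm of \<open>A ^ k\<close>, so up to a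
  null set the event for \<open>s_min\<close> at \<open>t\<close> lies in the event for the norm at
  \<open>1 / t\<close>; this gives the other two. A tail of order \<open>1 / s\<close> does not even
  give a first moment, hence the truncation. Cutting at \<open>t\<close> costs a probability of the
  order \<open>1 / t\<close> that is aimed at, and the moments of order \<open>2k\<close> of such a
  variable cut at \<open>t\<close> are of order \<open>t ^ (2k - 1)\<close>, one factor
  \<open>t\<close> below the level in Markov's inequality. The powers of \<open>n\<close> balance
  too: \<open>n ^ 2\<close> endpoints, \<open>n ^ (k - 1)\<close> for the pairs of paths that
  survive the sign average, \<open>1 / n ^ k\<close> from the moments. In the lower bound a
  coordinate of \<open>z\<close> other than the first is, given all rows but the first, a Gaussian
  variable divided by a length of bounded second moment, so it is rarely small. Column rotations fix
  \<open>z\<close> and rotate \<open>w\<close>, which makes \<open>z \<bullet> w\<close> a random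
  sign sum.\<close>

lemma space_std_gaussian [simp]: "space std_gaussian = UNIV"
  by (simp add: std_gaussian_def)

lemma sets_std_gaussian [simp, measurable_cong]: "sets std_gaussian = sets borel"
  by (simp add: std_gaussian_def)

lemma prob_space_std_gaussian: "prob_space std_gaussian"
  unfolding std_gaussian_def by (rule prob_space_normal_density) simp

interpretation std_gaussian: prob_space std_gaussian
  by (rule prob_space_std_gaussian)

interpretation gauss_prod: product_prob_space "\<lambda>_. std_gaussian" UNIV
  by unfold_locales

lemma nn_integral_std_gaussian:
  assumes "f \<in> borel_measurable borel"
  shows "(\<integral>\<^sup>+ x. f x \<partial>std_gaussian) = (\<integral>\<^sup>+ x. ennreal (std_normal_density x) * f x \<partial>lborel)"
  unfolding std_gaussian_def using assms by (subst nn_integral_density) auto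

lemma nn_integral_std_gaussian2:
  fixes F :: "real \<times> real \<Rightarrow> ennreal"
  assumes [measurable]: "F \<in> borel_measurable (borel \<Otimes>\<^sub>M borel)"
  shows "(\<integral>\<^sup>+ v. \<integral>\<^sup>+ u. F (u, v) \<partial>std_gaussian \<partial>std_gaussian)
    = (\<integral>\<^sup>+ v. \<integral>\<^sup>+ u. ennreal (std_normal_density u * std_normal_density v) * F (u, v) \<partial>lborel \<partial>lborel)"
proof -
  have "(\<integral>\<^sup>+ v. \<integral>\<^sup>+ u. F (u, v) \<partial>std_gaussian \<partial>std_gaussian)
      = (\<integral>\<^sup>+ v. (\<integral>\<^sup>+ u. ennreal (std_normal_density u) * F (u, v) \<partial>lborel) \<partial>std_gaussian)"
    by (intro nn_integral_cong nn_integral_std_gaussian) measurable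
  also have "\<dots> = (\<integral>\<^sup>+ v. ennreal (std_normal_density v) *
      (\<integral>\<^sup>+ u. ennreal (std_normal_density u) * F (u, v) \<partial>lborel) \<partial>lborel)"
    by (intro nn_integral_std_gaussian) measurable
  also have "\<dots> = (\<integral>\<^sup>+ v. \<integral>\<^sup>+ u. ennreal (std_normal_density u * std_normal_density v) * F (u, v) \<partial>lborel \<partial>lborel)"
    by (intro nn_integral_cong) (simp add: nn_integral_cmult[symmetric] ennreal_mult' mult_ac)
  finally show ?thesis .
qed

lemma std_normal_density_rotate:
  assumes "c\<^sup>2 + s\<^sup>2 = (1::real)"
  shows "std_normal_density (c * u - s * v) * std_normal_density (s * u + c * v)
    = std_normal_density u * std_normal_density v"
proof -
  have e: "(c * u - s * v)\<^sup>2 + (s * u + c * v)\<^sup>2 = (c\<^sup>2 + s\<^sup>2) * (u\<^sup>2 + v\<^sup>2)"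
    by (simp add: power2_eq_square algebra_simps)
  have "std_normal_density x * std_normal_density y = (1 / (2 * pi)) * exp (- (x\<^sup>2 + y\<^sup>2) / 2)" for x y
    by (simp add: std_normal_density_def exp_add[symmetric] diff_divide_distrib add_divide_distrib)
  then show ?thesis using e assms by simp
qed

text \<open>Two one-dimensional substitutions with Fubini in between: at fixed \<open>v\<close> the
  first rotated coordinate becomes the variable, then at fixed first coordinate the second one does.
  The factors \<open>1 / \<bar>c\<bar>\<close> and \<open>\<bar>c\<bar>\<close> cancel. For
  \<open>c = 0\<close> the first substitution breaks down, but the rotation merely exchanges the
  coordinates up to sign.\<close>

lemma lborel_rotate:
  fixes H :: "real \<times> real \<Rightarrow> ennreal"
  assumes [measurable]: "H \<in> borel_measurable (borel \<Otimes>\<^sub>M borel)" and cs: "c\<^sup>2 + s\<^sup>2 = 1"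
  shows "(\<integral>\<^sup>+ v. \<integral>\<^sup>+ u. H (c * u - s * v, s * u + c * v) \<partial>lborel \<partial>lborel)
    = (\<integral>\<^sup>+ v. \<integral>\<^sup>+ u. H (u, v) \<partial>lborel \<partial>lborel)"
proof (cases "c = 0")
  case True
  then have "s\<^sup>2 = 1" using cs by simp
  then have s: "\<bar>s\<bar> = 1" "s \<noteq> 0" by (auto simp: power2_eq_1_iff)
  have "(\<integral>\<^sup>+ v. \<integral>\<^sup>+ u. H (c * u - s * v, s * u + c * v) \<partial>lborel \<partial>lborel)
      = (\<integral>\<^sup>+ v. (\<integral>\<^sup>+ y. H (0 + (- s) * v, y) \<partial>lborel) \<partial>lborel)"
  proof (rule nn_integral_cong)
    fix v
    show "(\<integral>\<^sup>+ u. H (c * u - s * v, s * u + c * v) \<partial>lborel) = (\<integral>\<^sup>+ y. H (0 + (- s) * v, y) \<partial>lborel)"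
      using s True by (subst (2) nn_integral_real_affine[where c=s and t=0]) simp_all
  qed
  also have "\<dots> = (\<integral>\<^sup>+ x. (\<integral>\<^sup>+ y. H (x, y) \<partial>lborel) \<partial>lborel)"
    using s by (subst (2) nn_integral_real_affine[where c="-s" and t=0]) simp_all
  also have "\<dots> = (\<integral>\<^sup>+ v. \<integral>\<^sup>+ u. H (u, v) \<partial>lborel \<partial>lborel)"
    by (rule lborel_pair.Fubini') simp
  finally show ?thesis .
next
  case False
  \<comment> \<open>The second rotated coordinate as a function of the first one and
    \<open>v\<close>.\<close>
  have e: "(s / c) * (c * u - s * v) + v / c = s * u + c * v" for u v
  proof -
    have "(s / c) * (c * u - s * v) + v / c = s * u + v * (1 - s\<^sup>2) / c"
      using False by (simp add: field_simps power2_eq_square)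
    also have "1 - s\<^sup>2 = c\<^sup>2" using cs by simp
    finally show ?thesis using False by (simp add: power2_eq_square)
  qed
  have "(\<integral>\<^sup>+ v. \<integral>\<^sup>+ u. H (c * u - s * v, s * u + c * v) \<partial>lborel \<partial>lborel)
      = (\<integral>\<^sup>+ v. ennreal (1 / \<bar>c\<bar>) * (\<integral>\<^sup>+ x. H (x, (s / c) * x + v / c) \<partial>lborel) \<partial>lborel)"
  proof (rule nn_integral_cong)
    fix v
    have "(\<integral>\<^sup>+ x. H (x, (s / c) * x + v / c) \<partial>lborel)
        = ennreal \<bar>c\<bar> * (\<integral>\<^sup>+ u. H (- s * v + c * u, (s / c) * (- s * v + c * u) + v / c) \<partial>lborel)"
      using False by (subst nn_integral_real_affine[where c=c and t="- s * v"]) auto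
    also have "(\<integral>\<^sup>+ u. H (- s * v + c * u, (s / c) * (- s * v + c * u) + v / c) \<partial>lborel)
        = (\<integral>\<^sup>+ u. H (c * u - s * v, s * u + c * v) \<partial>lborel)"
      by (intro nn_integral_cong arg_cong[where f=H]) (use e in \<open>simp add: add.commute\<close>)
    finally show "(\<integral>\<^sup>+ u. H (c * u - s * v, s * u + c * v) \<partial>lborel)
        = ennreal (1 / \<bar>c\<bar>) * (\<integral>\<^sup>+ x. H (x, (s / c) * x + v / c) \<partial>lborel)"
      using False by (simp add: mult.assoc[symmetric] ennreal_mult'[symmetric])
  qed
  also have "\<dots> = (\<integral>\<^sup>+ v. \<integral>\<^sup>+ x. ennreal (1 / \<bar>c\<bar>) * H (x, (s / c) * x + v / c) \<partial>lborel \<partial>lborel)"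
    by (simp add: nn_integral_cmult)
  also have "\<dots> = (\<integral>\<^sup>+ x. \<integral>\<^sup>+ v. ennreal (1 / \<bar>c\<bar>) * H (x, (s / c) * x + v / c) \<partial>lborel \<partial>lborel)"
    by (rule lborel_pair.Fubini') simp
  also have "\<dots> = (\<integral>\<^sup>+ x. \<integral>\<^sup>+ y. H (x, y) \<partial>lborel \<partial>lborel)"
  proof (rule nn_integral_cong)
    fix x
    show "(\<integral>\<^sup>+ v. ennreal (1 / \<bar>c\<bar>) * H (x, (s / c) * x + v / c) \<partial>lborel) = (\<integral>\<^sup>+ y. H (x, y) \<partial>lborel)"
      using False
      by (subst (2) nn_integral_real_affine[where c="1/c" and t="(s / c) * x"]) (auto simp: nn_integral_cmult)
  qed
  also have "\<dots> = (\<integral>\<^sup>+ v. \<integral>\<^sup>+ u. H (u, v) \<partial>lborel \<partial>lborel)"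
    by (rule lborel_pair.Fubini') simp
  finally show ?thesis .
qed

lemma std_gaussian_rotate:
  fixes F :: "real \<times> real \<Rightarrow> ennreal"
  assumes [measurable]: "F \<in> borel_measurable (borel \<Otimes>\<^sub>M borel)" and cs: "c\<^sup>2 + s\<^sup>2 = 1"
  shows "(\<integral>\<^sup>+ v. \<integral>\<^sup>+ u. F (c * u - s * v, s * u + c * v) \<partial>std_gaussian \<partial>std_gaussian)
    = (\<integral>\<^sup>+ v. \<integral>\<^sup>+ u. F (u, v) \<partial>std_gaussian \<partial>std_gaussian)"
proof -
  define H where "H = (\<lambda>(u, v). ennreal (std_normal_density u * std_normal_density v) * F (u, v))"
  have [measurable]: "H \<in> borel_measurable (borel \<Otimes>\<^sub>M borel)" unfolding H_def by measurable
  have "(\<integral>\<^sup>+ v. \<integral>\<^sup>+ u. F (c * u - s * v, s * u + c * v) \<partial>std_gaussian \<partial>std_gaussian)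
      = (\<integral>\<^sup>+ v. \<integral>\<^sup>+ u. H (c * u - s * v, s * u + c * v) \<partial>lborel \<partial>lborel)"
    by (subst nn_integral_std_gaussian2[where F="\<lambda>(u, v). F (c * u - s * v, s * u + c * v)", simplified])
       (auto simp: H_def std_normal_density_rotate[OF cs])
  also have "\<dots> = (\<integral>\<^sup>+ v. \<integral>\<^sup>+ u. H (u, v) \<partial>lborel \<partial>lborel)"
    by (rule lborel_rotate[OF _ cs]) simp
  also have "\<dots> = (\<integral>\<^sup>+ v. \<integral>\<^sup>+ u. F (u, v) \<partial>std_gaussian \<partial>std_gaussian)"
    by (subst nn_integral_std_gaussian2) (auto simp: H_def)
  finally show ?thesis .
qed

lemma std_gaussian_uminus:
  fixes F :: "real \<Rightarrow> ennreal"
  assumes [measurable]: "F \<in> borel_measurable borel"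
  shows "(\<integral>\<^sup>+ u. F (- u) \<partial>std_gaussian) = (\<integral>\<^sup>+ u. F u \<partial>std_gaussian)"
proof -
  have "(\<integral>\<^sup>+ u. F u \<partial>std_gaussian) = (\<integral>\<^sup>+ u. ennreal (std_normal_density u) * F u \<partial>lborel)"
    by (rule nn_integral_std_gaussian) simp
  also have "\<dots> = (\<integral>\<^sup>+ u. ennreal (std_normal_density (- u)) * F (- u) \<partial>lborel)"
    by (subst nn_integral_real_affine[where c="-1" and t=0]) auto
  also have "\<dots> = (\<integral>\<^sup>+ u. F (- u) \<partial>std_gaussian)"
    by (subst nn_integral_std_gaussian) (auto simp: std_normal_density_def)
  finally show ?thesis by simp
qed

section \<open>Measure-preserving maps of Gaussian product measures\<close>

definition preserves :: "'a measure \<Rightarrow> ('a \<Rightarrow> 'a) \<Rightarrow> bool" where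
  "preserves M T \<longleftrightarrow> T \<in> measurable M M \<and> distr M M T = M"

lemma preservesI:
  assumes "T \<in> measurable M M"
    and "\<And>f :: 'a \<Rightarrow> ennreal. f \<in> borel_measurable M \<Longrightarrow> (\<integral>\<^sup>+ x. f (T x) \<partial>M) = (\<integral>\<^sup>+ x. f x \<partial>M)"
  shows "preserves M T"
  unfolding preserves_def
proof (intro conjI measure_eqI)
  fix A assume A: "A \<in> sets (distr M M T)"
  then have A': "A \<in> sets M" by simp
  have "emeasure (distr M M T) A = (\<integral>\<^sup>+ x. indicator A x \<partial>distr M M T)"
    using A by (subst nn_integral_indicator) auto
  also have "\<dots> = (\<integral>\<^sup>+ x. indicator A (T x) \<partial>M)"
    using assms(1) A by (subst nn_integral_distr) auto
  also have "\<dots> = (\<integral>\<^sup>+ x. indicator A x \<partial>M)"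
    by (rule assms(2)) (use A' in simp)
  also have "\<dots> = emeasure M A" using A' by simp
  finally show "emeasure (distr M M T) A = emeasure M A" .
qed (use assms in auto)

lemma preserves_nn_integral:
  assumes "preserves M T" "f \<in> borel_measurable M"
  shows "(\<integral>\<^sup>+ x. f (T x) \<partial>M) = (\<integral>\<^sup>+ x. f x \<partial>M)"
  using assms nn_integral_distr[of T M M f] by (simp add: preserves_def)

lemma preserves_integral:
  fixes f :: "'a \<Rightarrow> real"
  assumes "preserves M T" "f \<in> borel_measurable M"
  shows "(\<integral> x. f (T x) \<partial>M) = (\<integral> x. f x \<partial>M)"
  using assms integral_distr[of T M M f] by (simp add: preserves_def)

lemma preserves_measure:
  assumes "preserves M T" "{x\<in>space M. P x} \<in> sets M"
  shows "measure M {x\<in>space M. P (T x)} = measure M {x\<in>space M. P x}"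
proof -
  have T: "T \<in> measurable M M" using assms by (simp add: preserves_def)
  have "measure M {x\<in>space M. P x} = measure (distr M M T) {x\<in>space M. P x}"
    using assms by (simp add: preserves_def)
  also have "\<dots> = measure M (T -` {x\<in>space M. P x} \<inter> space M)"
    by (rule measure_distr[OF T assms(2)])
  also have "T -` {x\<in>space M. P x} \<inter> space M = {x\<in>space M. P (T x)}"
    using measurable_space[OF T] by auto
  finally show ?thesis by simp
qed

lemma preserves_comp:
  assumes "preserves M S" "preserves M T"
  shows "preserves M (\<lambda>x. S (T x))"
proof (rule preservesI)
  show "(\<lambda>x. S (T x)) \<in> measurable M M" using assms unfolding preserves_def by (auto intro: measurable_compose)
  fix f :: "'a \<Rightarrow> ennreal" assume f: "f \<in> borel_measurable M"
  have "(\<lambda>x. f (S x)) \<in> borel_measurable M" using assms f unfolding preserves_def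
    by (auto intro: measurable_compose)
  then show "(\<integral>\<^sup>+ x. f (S (T x)) \<partial>M) = (\<integral>\<^sup>+ x. f x \<partial>M)"
    using preserves_nn_integral[OF assms(2), of "\<lambda>x. f (S x)"] preserves_nn_integral[OF assms(1) f] by simp
qed

lemma preserves_id: "preserves M (\<lambda>x. x)"
  by (rule preservesI) auto

lemma preserves_cong:
  assumes "preserves M S" "\<And>x. x \<in> space M \<Longrightarrow> S x = T x"
  shows "preserves M T"
  using assms unfolding preserves_def by (auto cong: measurable_cong distr_cong)

abbreviation gauss :: "'i set \<Rightarrow> ('i \<Rightarrow> real) measure" where
  "gauss K \<equiv> Pi\<^sub>M K (\<lambda>_. std_gaussian)"

lemma measurable_entry:
  assumes "p \<in> K"
  shows "(\<lambda>x. x p) \<in> borel_measurable (gauss K)"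
  using measurable_component_singleton[OF assms, of "\<lambda>_. std_gaussian"]
  by (simp add: measurable_cong_sets[OF refl sets_std_gaussian])

text \<open>Splitting off the coordinates \<open>p\<close> and \<open>q\<close> by Fubini leaves the
  planar statement for each fixed value of the others.\<close>

lemma preserves_rotate_pair:
  assumes K: "finite K" "p \<in> K" "q \<in> K" "p \<noteq> q" and cs: "c\<^sup>2 + s\<^sup>2 = (1::real)"
  shows "preserves (gauss K) (\<lambda>x. x(p := c * x p - s * x q, q := s * x p + c * x q))"
    (is "preserves _ ?T")
proof (rule preservesI)
  note comp = measurable_entry[where K=K]
  show T: "?T \<in> measurable (gauss K) (gauss K)"
  proof (rule measurable_PiM_single')
    fix i assume "i \<in> K"
    then show "(\<lambda>x. (x(p := c * x p - s * x q, q := s * x p + c * x q)) i) \<in> measurable (gauss K) std_gaussian"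
      using K comp[of p] comp[of q] comp[of i]
      by (cases "i = q"; cases "i = p") (auto intro!: borel_measurable_add borel_measurable_diff borel_measurable_times)
  qed (use K in \<open>auto simp: space_PiM PiE_def extensional_def\<close>)
  fix f :: "('a \<Rightarrow> real) \<Rightarrow> ennreal" assume f: "f \<in> borel_measurable (gauss K)"
  define K' where "K' = K - {p, q}"
  have khin: "K = insert p (insert q K')" and fK: "finite K'" "finite (insert q K')"
    and n: "p \<notin> insert q K'" "q \<notin> K'"
    using K by (auto simp: K'_def)
  have split: "(\<integral>\<^sup>+ x. g x \<partial>gauss K)
      = (\<integral>\<^sup>+ x. \<integral>\<^sup>+ v. \<integral>\<^sup>+ u. g (x(q := v, p := u)) \<partial>std_gaussian \<partial>std_gaussian \<partial>gauss K')"
    if g: "g \<in> borel_measurable (gauss K)" for g :: "_ \<Rightarrow> ennreal"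
  proof -
    have [measurable]: "g \<in> borel_measurable (gauss (insert p (insert q K')))" using g khin by simp
    have "(\<integral>\<^sup>+ x. g x \<partial>gauss K) = (\<integral>\<^sup>+ x. \<integral>\<^sup>+ u. g (x(p := u)) \<partial>std_gaussian \<partial>gauss (insert q K'))"
      unfolding khin using fK n by (intro gauss_prod.product_nn_integral_insert) auto
    also have "\<dots> = (\<integral>\<^sup>+ x. \<integral>\<^sup>+ v. \<integral>\<^sup>+ u. g (x(q := v, p := u)) \<partial>std_gaussian \<partial>std_gaussian \<partial>gauss K')"
      using fK n by (intro gauss_prod.product_nn_integral_insert) measurable
    finally show ?thesis .
  qed
  have fT: "(\<lambda>x. f (?T x)) \<in> borel_measurable (gauss K)" using T f by (rule measurable_compose)
  have "(\<integral>\<^sup>+ x. f (?T x) \<partial>gauss K) = (\<integral>\<^sup>+ x. \<integral>\<^sup>+ v. \<integral>\<^sup>+ u.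
      f (x(q := s * u + c * v, p := c * u - s * v)) \<partial>std_gaussian \<partial>std_gaussian \<partial>gauss K')"
    unfolding split[OF fT]
    by (intro nn_integral_cong arg_cong[where f=f]) (use K in \<open>auto simp: fun_eq_iff\<close>)
  also have "\<dots> = (\<integral>\<^sup>+ x. \<integral>\<^sup>+ v. \<integral>\<^sup>+ u. f (x(q := v, p := u)) \<partial>std_gaussian \<partial>std_gaussian \<partial>gauss K')"
  proof (rule nn_integral_cong)
    fix x assume x: "x \<in> space (gauss K')"
    have [measurable]: "f \<in> borel_measurable (gauss (insert p (insert q K')))" using f khin by simp
    have "(\<lambda>(u, v). f (x(q := v, p := u))) \<in> borel_measurable (borel \<Otimes>\<^sub>M borel)"
      using x by measurable
    from std_gaussian_rotate[OF this cs]
    show "(\<integral>\<^sup>+ v. \<integral>\<^sup>+ u. f (x(q := s * u + c * v, p := c * u - s * v)) \<partial>std_gaussian \<partial>std_gaussian)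
      = (\<integral>\<^sup>+ v. \<integral>\<^sup>+ u. f (x(q := v, p := u)) \<partial>std_gaussian \<partial>std_gaussian)"
      by simp
  qed
  also have "\<dots> = (\<integral>\<^sup>+ x. f x \<partial>gauss K)" by (rule split[OF f, symmetric])
  finally show "(\<integral>\<^sup>+ x. f (?T x) \<partial>gauss K) = (\<integral>\<^sup>+ x. f x \<partial>gauss K)" .
qed

lemma preserves_flip:
  assumes K: "finite K" "p \<in> K"
  shows "preserves (gauss K) (\<lambda>x. x(p := - x p))" (is "preserves _ ?T")
proof (rule preservesI)
  note comp = measurable_entry[where K=K]
  show T: "?T \<in> measurable (gauss K) (gauss K)"
  proof (rule measurable_PiM_single')
    fix i assume "i \<in> K"
    then show "(\<lambda>x. (x(p := - x p)) i) \<in> measurable (gauss K) std_gaussian"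
      using K comp[of p] comp[of i] by (cases "i = p") (auto)
  qed (use K in \<open>auto simp: space_PiM PiE_def extensional_def\<close>)
  fix f :: "('a \<Rightarrow> real) \<Rightarrow> ennreal" assume f: "f \<in> borel_measurable (gauss K)"
  define K' where "K' = K - {p}"
  have khin: "K = insert p K'" and fK: "finite K'" and n: "p \<notin> K'"
    using K by (auto simp: K'_def)
  have split: "(\<integral>\<^sup>+ x. g x \<partial>gauss K) = (\<integral>\<^sup>+ x. \<integral>\<^sup>+ u. g (x(p := u)) \<partial>std_gaussian \<partial>gauss K')"
    if g: "g \<in> borel_measurable (gauss K)" for g :: "_ \<Rightarrow> ennreal"
    unfolding khin using fK n g khin by (intro gauss_prod.product_nn_integral_insert) auto
  have fT: "(\<lambda>x. f (?T x)) \<in> borel_measurable (gauss K)" using T f by (rule measurable_compose)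
  have "(\<integral>\<^sup>+ x. f (?T x) \<partial>gauss K) = (\<integral>\<^sup>+ x. \<integral>\<^sup>+ u. f (x(p := - u)) \<partial>std_gaussian \<partial>gauss K')"
    unfolding split[OF fT] by simp
  also have "\<dots> = (\<integral>\<^sup>+ x. \<integral>\<^sup>+ u. f (x(p := u)) \<partial>std_gaussian \<partial>gauss K')"
  proof (rule nn_integral_cong)
    fix x assume x: "x \<in> space (gauss K')"
    have [measurable]: "f \<in> borel_measurable (gauss (insert p K'))" using f khin by simp
    have "(\<lambda>u. f (x(p := u))) \<in> borel_measurable borel"
      using x by measurable
    from std_gaussian_uminus[OF this]
    show "(\<integral>\<^sup>+ u. f (x(p := - u)) \<partial>std_gaussian) = (\<integral>\<^sup>+ u. f (x(p := u)) \<partial>std_gaussian)" .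
  qed
  also have "\<dots> = (\<integral>\<^sup>+ x. f x \<partial>gauss K)" by (rule split[OF f, symmetric])
  finally show "(\<integral>\<^sup>+ x. f (?T x) \<partial>gauss K) = (\<integral>\<^sup>+ x. f x \<partial>gauss K)" .
qed

text \<open>
  The index map \<open>\<sigma>\<close> selects the coordinates on which the matrix acts: a row or a column.
\<close>

definition mat_act :: "nat \<Rightarrow> (nat \<Rightarrow> 'i) \<Rightarrow> real mat \<Rightarrow> ('i \<Rightarrow> real) \<Rightarrow> 'i \<Rightarrow> real" where
  "mat_act n \<sigma> Q x = (\<lambda>k. if k \<in> \<sigma> ` {..<n} then \<Sum>j<n. Q $$ (the_inv_into {..<n} \<sigma> k, j) * x (\<sigma> j) else x k)"

lemma mat_act_apply: "inj_on \<sigma> {..<n} \<Longrightarrow> i < n \<Longrightarrow> mat_act n \<sigma> Q x (\<sigma> i) = (\<Sum>j<n. Q $$ (i, j) * x (\<sigma> j))"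
  by (simp add: mat_act_def the_inv_into_f_f)

lemma mat_act_other: "k \<notin> \<sigma> ` {..<n} \<Longrightarrow> mat_act n \<sigma> Q x k = x k"
  by (simp add: mat_act_def)

lemma mat_mult_entry:
  fixes P Q :: "'a :: semiring_0 mat"
  assumes "P \<in> carrier_mat n m" "Q \<in> carrier_mat m l" "i < n" "k < l"
  shows "(P * Q) $$ (i, k) = (\<Sum>j<m. P $$ (i, j) * Q $$ (j, k))"
  using assms by (auto simp: scalar_prod_def atLeast0LessThan intro!: sum.cong)

lemma mat_act_mult:
  assumes "inj_on \<sigma> {..<n}" "P \<in> carrier_mat n n" "Q \<in> carrier_mat n n"
  shows "mat_act n \<sigma> (P * Q) x = mat_act n \<sigma> P (mat_act n \<sigma> Q x)"
proof
  fix k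
  show "mat_act n \<sigma> (P * Q) x k = mat_act n \<sigma> P (mat_act n \<sigma> Q x) k"
  proof (cases "k \<in> \<sigma> ` {..<n}")
    case True
    then obtain i where i: "i < n" "k = \<sigma> i" by auto
    have "mat_act n \<sigma> (P * Q) x k = (\<Sum>j<n. (\<Sum>l<n. P $$ (i, l) * Q $$ (l, j)) * x (\<sigma> j))"
      using assms i by (simp add: mat_act_apply mat_mult_entry del: index_mult_mat(1))
    also have "\<dots> = (\<Sum>j<n. \<Sum>l<n. P $$ (i, l) * (Q $$ (l, j) * x (\<sigma> j)))"
      by (simp add: sum_distrib_right mult.assoc)
    also have "\<dots> = (\<Sum>l<n. \<Sum>j<n. P $$ (i, l) * (Q $$ (l, j) * x (\<sigma> j)))"
      by (rule sum.swap)
    also have "\<dots> = mat_act n \<sigma> P (mat_act n \<sigma> Q x) k"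
      using assms i by (simp add: mat_act_apply sum_distrib_left)
    finally show ?thesis .
  qed (simp add: mat_act_other)
qed

lemma mat_act_one:
  assumes "inj_on \<sigma> {..<n}"
  shows "mat_act n \<sigma> (1\<^sub>m n) x = x"
proof
  fix k
  show "mat_act n \<sigma> (1\<^sub>m n) x k = x k"
  proof (cases "k \<in> \<sigma> ` {..<n}")
    case True
    then obtain i where i: "i < n" "k = \<sigma> i" by auto
    have "mat_act n \<sigma> (1\<^sub>m n) x k = (\<Sum>j<n. if j = i then x (\<sigma> j) else 0)"
      unfolding i(2) mat_act_apply[OF assms i(1)] using i by (intro sum.cong) auto
    then show ?thesis using i by simp
  qed (simp add: mat_act_other)
qed

text \<open>
  In fact this set is all of $O(n)$. Closure under products, the Givens rotations and transitivity
  on the unit sphere are all that is needed.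
\<close>

definition gauss_rot :: "nat \<Rightarrow> real mat set" where
  "gauss_rot n = {Q \<in> carrier_mat n n. Q * transpose_mat Q = 1\<^sub>m n \<and> transpose_mat Q * Q = 1\<^sub>m n \<and>
    (\<forall>(K :: (nat \<times> nat) set) \<sigma>. finite K \<longrightarrow> inj_on \<sigma> {..<n} \<longrightarrow> \<sigma> ` {..<n} \<subseteq> K \<longrightarrow> preserves (gauss K) (mat_act n \<sigma> Q))}"

lemma gauss_rotD:
  assumes "Q \<in> gauss_rot n"
  shows "Q \<in> carrier_mat n n" "Q * transpose_mat Q = 1\<^sub>m n" "transpose_mat Q * Q = 1\<^sub>m n"
  and "\<And>(K :: (nat \<times> nat) set) \<sigma>. finite K \<Longrightarrow> inj_on \<sigma> {..<n} \<Longrightarrow> \<sigma> ` {..<n} \<subseteq> K \<Longrightarrow> preserves (gauss K) (mat_act n \<sigma> Q)"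
  using assms unfolding gauss_rot_def by blast+

lemma gauss_rot_one: "1\<^sub>m n \<in> gauss_rot n"
proof -
  have "preserves (gauss K) (mat_act n \<sigma> (1\<^sub>m n))" if "inj_on \<sigma> {..<n}" for K :: "(nat \<times> nat) set" and \<sigma>
    using preserves_id[of "gauss K"] mat_act_one[OF that] by presburger
  then show ?thesis by (simp add: gauss_rot_def)
qed

lemma gauss_rot_mult:
  assumes P: "P \<in> gauss_rot n" and Q: "Q \<in> gauss_rot n"
  shows "P * Q \<in> gauss_rot n"
proof -
  note p = gauss_rotD[OF P] and q = gauss_rotD[OF Q]
  have t: "transpose_mat (P * Q) = transpose_mat Q * transpose_mat P"
    by (rule transpose_mult) (use p q in auto)
  have tc: "transpose_mat P \<in> carrier_mat n n" "transpose_mat Q \<in> carrier_mat n n" using p q by auto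
  have "P * Q * (transpose_mat Q * transpose_mat P) = P * (Q * (transpose_mat Q * transpose_mat P))"
    using p q tc by (intro assoc_mult_mat) auto
  also have "Q * (transpose_mat Q * transpose_mat P) = Q * transpose_mat Q * transpose_mat P"
    using p q tc by (intro assoc_mult_mat[symmetric]) auto
  also have "\<dots> = transpose_mat P" using p q tc by simp
  finally have 1: "P * Q * transpose_mat (P * Q) = 1\<^sub>m n" using t p by simp
  have "transpose_mat Q * transpose_mat P * (P * Q) = transpose_mat Q * (transpose_mat P * (P * Q))"
    using p q tc by (intro assoc_mult_mat) auto
  moreover have "transpose_mat P * (P * Q) = transpose_mat P * P * Q"
    using p q tc by (intro assoc_mult_mat[symmetric]) auto
  ultimately have "transpose_mat (P * Q) * (P * Q) = 1\<^sub>m n" using t p q by simp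
  moreover have "preserves (gauss K) (mat_act n \<sigma> (P * Q))"
    if "finite K" "inj_on \<sigma> {..<n}" "\<sigma> ` {..<n} \<subseteq> K" for K :: "(nat \<times> nat) set" and \<sigma>
  proof -
    have "mat_act n \<sigma> (P * Q) = (\<lambda>x. mat_act n \<sigma> P (mat_act n \<sigma> Q x))"
      using mat_act_mult[OF that(2) p(1) q(1)] by blast
    then show ?thesis using preserves_comp[OF p(4)[OF that] q(4)[OF that]] by metis
  qed
  ultimately show ?thesis
    unfolding gauss_rot_def using 1 mult_carrier_mat[OF p(1) q(1)] by blast
qed

lemma gauss_rotI:
  assumes Q: "Q \<in> carrier_mat n n" and o: "\<And>i k. i < n \<Longrightarrow> k < n \<Longrightarrow> (\<Sum>j<n. Q $$ (i, j) * Q $$ (k, j)) = (if i = k then 1 else 0)"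
    and p: "\<And>(K :: (nat \<times> nat) set) \<sigma>. finite K \<Longrightarrow> inj_on \<sigma> {..<n} \<Longrightarrow> \<sigma> ` {..<n} \<subseteq> K \<Longrightarrow> preserves (gauss K) (mat_act n \<sigma> Q)"
  shows "Q \<in> gauss_rot n"
proof -
  have 1: "Q * transpose_mat Q = 1\<^sub>m n"
  proof (rule eq_matI)
    fix i k assume "i < dim_row (1\<^sub>m n :: real mat)" "k < dim_col (1\<^sub>m n :: real mat)"
    then have ik: "i < n" "k < n" by auto
    have "(Q * transpose_mat Q) $$ (i, k) = (\<Sum>j<n. Q $$ (i, j) * transpose_mat Q $$ (j, k))"
      using Q ik by (intro mat_mult_entry[where l=n]) auto
    also have "\<dots> = (\<Sum>j<n. Q $$ (i, j) * Q $$ (k, j))" using Q ik by (intro sum.cong) auto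
    finally show "(Q * transpose_mat Q) $$ (i, k) = (1\<^sub>m n :: real mat) $$ (i, k)"
      using o ik by simp
  qed (use Q in auto)
  have "transpose_mat Q * Q = 1\<^sub>m n"
    by (rule mat_mult_left_right_inverse[OF Q _ 1]) (use Q in simp)
  with 1 Q p show ?thesis unfolding gauss_rot_def by blast
qed

section \<open>Givens rotations, reflections and transitivity on the sphere\<close>

definition givens :: "nat \<Rightarrow> nat \<Rightarrow> nat \<Rightarrow> real \<Rightarrow> real \<Rightarrow> real mat" where
  "givens n a b c s = Matrix.mat n n (\<lambda>(i, j).
     if i = a then (if j = a then c else if j = b then - s else 0)
     else if i = b then (if j = a then s else if j = b then c else 0)
     else if i = j then 1 else 0)"

lemma givens_sum:
  assumes "a < n" "b < n" "a \<noteq> b" "i < n"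
  shows "(\<Sum>j<n. givens n a b c s $$ (i, j) * f j)
    = (if i = a then c * f a - s * f b else if i = b then s * f a + c * f b else f i)"
proof -
  consider "i = a" | "i = b" | "i \<noteq> a" "i \<noteq> b" by auto
  then show ?thesis
  proof cases
    case 1
    have "(\<Sum>j<n. givens n a b c s $$ (i, j) * f j) = (\<Sum>j\<in>{a, b}. givens n a b c s $$ (i, j) * f j)"
      using assms 1 by (intro sum.mono_neutral_right) (auto simp: givens_def)
    then show ?thesis using assms 1 by (auto simp: givens_def)
  next
    case 2
    have "(\<Sum>j<n. givens n a b c s $$ (i, j) * f j) = (\<Sum>j\<in>{a, b}. givens n a b c s $$ (i, j) * f j)"
      using assms 2 by (intro sum.mono_neutral_right) (auto simp: givens_def)
    then show ?thesis using assms 2 by (auto simp: givens_def)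
  next
    case 3
    have "(\<Sum>j<n. givens n a b c s $$ (i, j) * f j) = (\<Sum>j\<in>{i}. givens n a b c s $$ (i, j) * f j)"
      using assms 3 by (intro sum.mono_neutral_right) (auto simp: givens_def)
    then show ?thesis using assms 3 by (auto simp: givens_def)
  qed
qed

lemma givens_gauss_rot:
  assumes ab: "a < n" "b < n" "a \<noteq> b" and cs: "c\<^sup>2 + s\<^sup>2 = 1"
  shows "givens n a b c s \<in> gauss_rot n"
proof (rule gauss_rotI)
  have c1: "c * c + s * s = 1" and c2: "s * s + c * c = 1" using cs by (simp_all add: power2_eq_square add.commute)
  show "givens n a b c s \<in> carrier_mat n n" by (simp add: givens_def)
  fix i k assume "i < n" "k < n"
  then show "(\<Sum>j<n. givens n a b c s $$ (i, j) * givens n a b c s $$ (k, j)) = (if i = k then 1 else 0)"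
    using ab c1 c2 by (subst givens_sum[where f="\<lambda>j. givens n a b c s $$ (k, j)"]) (simp_all add: givens_def)
next
  fix K :: "(nat \<times> nat) set" and \<sigma> assume K: "finite K" "inj_on \<sigma> {..<n}" "\<sigma> ` {..<n} \<subseteq> K"
  have ne: "\<sigma> a \<noteq> \<sigma> b" using K ab by (metis inj_on_contraD lessThan_iff)
  have "mat_act n \<sigma> (givens n a b c s) x
      = x(\<sigma> a := c * x (\<sigma> a) - s * x (\<sigma> b), \<sigma> b := s * x (\<sigma> a) + c * x (\<sigma> b))" for x
  proof
    fix k
    show "mat_act n \<sigma> (givens n a b c s) x k
      = (x(\<sigma> a := c * x (\<sigma> a) - s * x (\<sigma> b), \<sigma> b := s * x (\<sigma> a) + c * x (\<sigma> b))) k"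
    proof (cases "k \<in> \<sigma> ` {..<n}")
      case True
      then obtain i where i: "i < n" "k = \<sigma> i" by auto
      have "\<sigma> i = \<sigma> a \<longleftrightarrow> i = a" "\<sigma> i = \<sigma> b \<longleftrightarrow> i = b"
        using i ab K by (metis inj_onD lessThan_iff)+
      then show ?thesis using i ab ne K(2) by (simp add: mat_act_apply givens_sum)
    next
      case False
      then show ?thesis using ab by (auto simp: mat_act_other)
    qed
  qed
  then have "mat_act n \<sigma> (givens n a b c s)
      = (\<lambda>x. x(\<sigma> a := c * x (\<sigma> a) - s * x (\<sigma> b), \<sigma> b := s * x (\<sigma> a) + c * x (\<sigma> b)))"
    by auto
  then show "preserves (gauss K) (mat_act n \<sigma> (givens n a b c s))"
    using preserves_rotate_pair[OF K(1) _ _ ne cs] K ab by auto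
qed

definition flipm :: "nat \<Rightarrow> nat \<Rightarrow> real mat" where
  "flipm n a = Matrix.mat n n (\<lambda>(i, j). if i = j then (if i = a then -1 else 1) else 0)"

lemma flipm_sum:
  assumes "i < n"
  shows "(\<Sum>j<n. flipm n a $$ (i, j) * f j) = (if i = a then - f i else f i)"
proof -
  have "(\<Sum>j<n. flipm n a $$ (i, j) * f j) = (\<Sum>j\<in>{i}. flipm n a $$ (i, j) * f j)"
    using assms by (intro sum.mono_neutral_right) (auto simp: flipm_def)
  then show ?thesis using assms by (auto simp: flipm_def)
qed

lemma flipm_gauss_rot:
  assumes a: "a < n"
  shows "flipm n a \<in> gauss_rot n"
proof (rule gauss_rotI)
  show "flipm n a \<in> carrier_mat n n" by (simp add: flipm_def)
  fix i k assume "i < n" "k < n"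
  then show "(\<Sum>j<n. flipm n a $$ (i, j) * flipm n a $$ (k, j)) = (if i = k then 1 else 0)"
    using a by (subst flipm_sum) (auto simp: flipm_def)
next
  fix K :: "(nat \<times> nat) set" and \<sigma> assume K: "finite K" "inj_on \<sigma> {..<n}" "\<sigma> ` {..<n} \<subseteq> K"
  have "mat_act n \<sigma> (flipm n a) x = x(\<sigma> a := - x (\<sigma> a))" for x
  proof
    fix k
    show "mat_act n \<sigma> (flipm n a) x k = (x(\<sigma> a := - x (\<sigma> a))) k"
    proof (cases "k \<in> \<sigma> ` {..<n}")
      case True
      then obtain i where i: "i < n" "k = \<sigma> i" by auto
      have "\<sigma> i = \<sigma> a \<longleftrightarrow> i = a" using i a K by (metis inj_onD lessThan_iff)
      then show ?thesis using i a K(2) by (simp add: mat_act_apply flipm_sum)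
    next
      case False
      then show ?thesis using a by (auto simp: mat_act_other)
    qed
  qed
  then have "mat_act n \<sigma> (flipm n a) = (\<lambda>x. x(\<sigma> a := - x (\<sigma> a)))" by auto
  then show "preserves (gauss K) (mat_act n \<sigma> (flipm n a))"
    using preserves_flip[OF K(1), of "\<sigma> a"] K a by auto
qed

lemma gauss_rot_norm:
  assumes "Q \<in> gauss_rot n"
  shows "(\<Sum>i<n. (\<Sum>j<n. Q $$ (i, j) * h j)\<^sup>2) = (\<Sum>j<n. (h j)\<^sup>2)"
proof -
  note q = gauss_rotD[OF assms]
  have o: "(\<Sum>i<n. Q $$ (i, j) * Q $$ (i, l)) = (if j = l then 1 else 0)" if "j < n" "l < n" for j l
  proof -
    have "(\<Sum>i<n. Q $$ (i, j) * Q $$ (i, l)) = (transpose_mat Q * Q) $$ (j, l)"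
      using q(1) that by (subst mat_mult_entry[where n=n and m=n and l=n]) auto
    then show ?thesis using q(3) that by simp
  qed
  have "(\<Sum>i<n. (\<Sum>j<n. Q $$ (i, j) * h j)\<^sup>2)
      = (\<Sum>i<n. \<Sum>j<n. \<Sum>l<n. (Q $$ (i, j) * Q $$ (i, l)) * (h j * h l))"
    by (simp add: power2_eq_square sum_product mult_ac)
  also have "\<dots> = (\<Sum>j<n. \<Sum>i<n. \<Sum>l<n. (Q $$ (i, j) * Q $$ (i, l)) * (h j * h l))"
    by (rule sum.swap)
  also have "\<dots> = (\<Sum>j<n. \<Sum>l<n. \<Sum>i<n. (Q $$ (i, j) * Q $$ (i, l)) * (h j * h l))"
    by (rule sum.cong[OF refl], rule sum.swap)
  also have "\<dots> = (\<Sum>j<n. \<Sum>l<n. (if j = l then 1 else 0) * (h j * h l))"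
    by (intro sum.cong refl) (simp add: sum_distrib_right[symmetric] o)
  also have "\<dots> = (\<Sum>j<n. (h j)\<^sup>2)"
    by (intro sum.cong refl) (simp add: power2_eq_square if_distrib if_distribR sum.delta cong: if_cong)
  finally show ?thesis .
qed

text \<open>Coordinates of \<open>Q h\<close> are cleared one at a time: a Givens rotation in the
  plane of the coordinates 0 and \<open>Suc m\<close> moves the mass of the latter into the former
  and leaves the zeros already produced untouched.\<close>

lemma gauss_rot_exists_pos:
  assumes "m < n"
  shows "\<exists>Q\<in>gauss_rot n. \<forall>i. 0 < i \<longrightarrow> i \<le> m \<longrightarrow> (\<Sum>j<n. Q $$ (i, j) * h j) = 0"
  using assms
proof (induction m)
  case 0
  then show ?case using gauss_rot_one by auto
next
  case (Suc m)
  then obtain Q where Q: "Q \<in> gauss_rot n" and z: "\<forall>i. 0 < i \<longrightarrow> i \<le> m \<longrightarrow> (\<Sum>j<n. Q $$ (i, j) * h j) = 0"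
    by auto
  define y where "y i = (\<Sum>j<n. Q $$ (i, j) * h j)" for i
  define r where "r = sqrt ((y 0)\<^sup>2 + (y (Suc m))\<^sup>2)"
  show ?case
  proof (cases "r = 0")
    case True
    then have "y (Suc m) = 0" by (simp add: r_def sum_power2_eq_zero_iff)
    then show ?thesis using Q z unfolding y_def by (metis le_Suc_eq)
  next
    case False
    define c where "c = y 0 / r"
    define s where "s = - y (Suc m) / r"
    have r2: "r\<^sup>2 = (y 0)\<^sup>2 + (y (Suc m))\<^sup>2" by (simp add: r_def)
    have cs: "c\<^sup>2 + s\<^sup>2 = 1"
    proof -
      have "c\<^sup>2 + s\<^sup>2 = ((y 0)\<^sup>2 + (y (Suc m))\<^sup>2) / r\<^sup>2"
        by (simp add: c_def s_def power_divide add_divide_distrib)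
      also have "\<dots> = r\<^sup>2 / r\<^sup>2" by (simp only: r2)
      also have "\<dots> = 1" using False by (simp)
      finally show ?thesis .
    qed
    have Gr: "givens n 0 (Suc m) c s \<in> gauss_rot n" using Suc.prems cs by (intro givens_gauss_rot) auto
    have "(\<Sum>j<n. (givens n 0 (Suc m) c s * Q) $$ (i, j) * h j) = 0" if "0 < i" "i \<le> Suc m" for i
    proof -
      have i: "i < n" using that Suc.prems by simp
      have "(\<Sum>j<n. (givens n 0 (Suc m) c s * Q) $$ (i, j) * h j)
          = (\<Sum>j<n. \<Sum>l<n. givens n 0 (Suc m) c s $$ (i, l) * (Q $$ (l, j) * h j))"
        using gauss_rotD(1)[OF Gr] gauss_rotD(1)[OF Q] i
        by (intro sum.cong refl) (simp add: mat_mult_entry[where m=n] sum_distrib_right mult.assoc del: index_mult_mat(1))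
      also have "\<dots> = (\<Sum>l<n. givens n 0 (Suc m) c s $$ (i, l) * y l)"
        by (subst sum.swap) (simp add: y_def sum_distrib_left)
      also have "\<dots> = (if i = Suc m then s * y 0 + c * y (Suc m) else y i)"
        using that i Suc.prems by (subst givens_sum) auto
      also have "\<dots> = 0" using that z by (auto simp: c_def s_def y_def)
      finally show ?thesis .
    qed
    then show ?thesis using gauss_rot_mult[OF Gr Q] by blast
  qed
qed

text \<open>After clearing, norm preservation forces the remaining coordinate to be 1 or -1, and a
  reflection corrects the sign. Then \<open>h\<close> is the transpose of \<open>Q\<close> applied
  to the first unit vector, that is, the first row of \<open>Q\<close>. In this way any unit vector
  can be traded for a coordinate direction.\<close>

lemma gauss_rot_exists:
  assumes n: "0 < n" and h: "(\<Sum>j<n. (h j)\<^sup>2) = 1"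
  shows "\<exists>Q\<in>gauss_rot n. (\<forall>i<n. (\<Sum>j<n. Q $$ (i, j) * h j) = (if i = 0 then 1 else 0)) \<and> (\<forall>j<n. Q $$ (0, j) = h j)"
proof -
  have "\<exists>Q\<in>gauss_rot n. \<forall>i<n. (\<Sum>j<n. Q $$ (i, j) * h j) = (if i = 0 then 1 else 0)"
  proof -
    obtain Q where Q: "Q \<in> gauss_rot n" and z: "\<And>i. 0 < i \<Longrightarrow> i < n \<Longrightarrow> (\<Sum>j<n. Q $$ (i, j) * h j) = 0"
      using gauss_rot_exists_pos[of "n - 1" n h] n by auto
    define y where "y i = (\<Sum>j<n. Q $$ (i, j) * h j)" for i
    have "(\<Sum>i<n. (y i)\<^sup>2) = (\<Sum>i\<in>{0}. (y i)\<^sup>2)"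
      using n z by (intro sum.mono_neutral_right) (auto simp: y_def)
    then have "(y 0)\<^sup>2 = 1" using gauss_rot_norm[OF Q, of h] h by (simp add: y_def)
    then consider "y 0 = 1" | "y 0 = -1" by (auto simp: power2_eq_1_iff)
    then show ?thesis
    proof cases
      case 1
      then show ?thesis using Q z unfolding y_def by (intro bexI[of _ Q]) auto
    next
      case 2
      have Gr: "flipm n 0 \<in> gauss_rot n" using n by (rule flipm_gauss_rot)
      have "(\<Sum>j<n. (flipm n 0 * Q) $$ (i, j) * h j) = (if i = 0 then 1 else 0)" if i: "i < n" for i
      proof -
        have "(\<Sum>j<n. (flipm n 0 * Q) $$ (i, j) * h j)
            = (\<Sum>j<n. \<Sum>l<n. flipm n 0 $$ (i, l) * (Q $$ (l, j) * h j))"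
          using gauss_rotD(1)[OF Gr] gauss_rotD(1)[OF Q] i
          by (intro sum.cong refl) (simp add: mat_mult_entry[where m=n] sum_distrib_right mult.assoc del: index_mult_mat(1))
        also have "\<dots> = (\<Sum>l<n. flipm n 0 $$ (i, l) * y l)"
          by (subst sum.swap) (simp add: y_def sum_distrib_left)
        also have "\<dots> = (if i = 0 then - y i else y i)"
          using i by (subst flipm_sum) auto
        finally show ?thesis using 2 z i by (auto simp: y_def)
      qed
      then show ?thesis using gauss_rot_mult[OF Gr Q] by blast
    qed
  qed
  then obtain Q where Q: "Q \<in> gauss_rot n" and e: "\<And>i. i < n \<Longrightarrow> (\<Sum>j<n. Q $$ (i, j) * h j) = (if i = 0 then 1 else 0)"
    by auto
  note q = gauss_rotD[OF Q]
  have "Q $$ (0, j) = h j" if j: "j < n" for j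
  proof -
    have o: "(\<Sum>i<n. Q $$ (i, j) * Q $$ (i, l)) = (if j = l then 1 else 0)" if "l < n" for l
    proof -
      have "(\<Sum>i<n. Q $$ (i, j) * Q $$ (i, l)) = (transpose_mat Q * Q) $$ (j, l)"
        using q(1) that j by (subst mat_mult_entry[where n=n and m=n and l=n]) auto
      then show ?thesis using q(3) that j by simp
    qed
    have "Q $$ (0, j) = (\<Sum>i<n. Q $$ (i, j) * (if i = 0 then 1 else 0))"
      using n by (simp add: if_distrib cong: if_cong)
    also have "\<dots> = (\<Sum>i<n. Q $$ (i, j) * (\<Sum>l<n. Q $$ (i, l) * h l))"
      by (intro sum.cong refl) (simp add: e)
    also have "\<dots> = (\<Sum>l<n. \<Sum>i<n. Q $$ (i, j) * (Q $$ (i, l) * h l))"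
      by (subst sum.swap) (simp add: sum_distrib_left)
    also have "\<dots> = (\<Sum>l<n. (\<Sum>i<n. Q $$ (i, j) * Q $$ (i, l)) * h l)"
      by (simp add: sum_distrib_right mult.assoc)
    also have "\<dots> = (\<Sum>l<n. (if j = l then 1 else 0) * h l)"
      by (intro sum.cong refl) (simp add: o)
    also have "\<dots> = h j" using j by (simp add: if_distrib if_distribR cong: if_cong)
    finally show ?thesis .
  qed
  with Q e show ?thesis by blast
qed

text \<open>The products of \<open>Q\<close> with the matrix from the left, and of the matrix with
  the transpose of \<open>Q\<close> from the right (\<open>rmul\<close>). With this convention the
  rows of \<open>Q\<close> enter both times: the inverse \<open>A\<close> becomes \<open>A\<close>
  times the transpose of \<open>Q\<close>, respectively \<open>Q * A\<close>. The restriction to the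
  index square keeps the image in the sample space.\<close>

definition lmul :: "nat \<Rightarrow> real mat \<Rightarrow> (nat \<times> nat \<Rightarrow> real) \<Rightarrow> nat \<times> nat \<Rightarrow> real" where
  "lmul n Q x = (\<lambda>(i, j)\<in>{0..<n} \<times> {0..<n}. \<Sum>l<n. Q $$ (i, l) * x (l, j))"

definition rmul :: "nat \<Rightarrow> real mat \<Rightarrow> (nat \<times> nat \<Rightarrow> real) \<Rightarrow> nat \<times> nat \<Rightarrow> real" where
  "rmul n Q x = (\<lambda>(i, j)\<in>{0..<n} \<times> {0..<n}. \<Sum>l<n. Q $$ (j, l) * x (i, l))"

text \<open>Here \<open>\<sigma> j\<close> enumerates the \<open>j\<close>-th line, a row or a
  column. The lines are disjoint because the pairing is injective, so acting on one after the other
  composes measure-preserving maps.\<close>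

lemma preserves_mat_act_all:
  fixes \<sigma> :: "nat \<Rightarrow> nat \<Rightarrow> nat \<times> nat"
  assumes Q: "Q \<in> gauss_rot n" and inj: "inj (case_prod \<sigma>)" and K: "finite K" "\<And>j i. j < n \<Longrightarrow> i < n \<Longrightarrow> \<sigma> j i \<in> K"
    and m: "m \<le> n"
  shows "\<exists>T. preserves (gauss K) T \<and> (\<forall>x. (\<forall>j i. i < n \<longrightarrow> T x (\<sigma> j i) = (if j < m then \<Sum>l<n. Q $$ (i, l) * x (\<sigma> j l) else x (\<sigma> j i)))
     \<and> (\<forall>k. k \<notin> K \<longrightarrow> T x k = x k))"
  using m
proof (induction m)
  case 0
  show ?case by (rule exI[of _ "\<lambda>x. x"]) (auto simp: preserves_id)
next
  case (Suc m)
  have i1: "inj_on (\<sigma> m) {..<n}" using inj unfolding inj_on_def by auto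
  have sub: "\<sigma> m ` {..<n} \<subseteq> K" using K Suc.prems by auto
  obtain T where T: "preserves (gauss K) T"
    "\<And>x j i. i < n \<Longrightarrow> T x (\<sigma> j i) = (if j < m then \<Sum>l<n. Q $$ (i, l) * x (\<sigma> j l) else x (\<sigma> j i))"
    "\<And>x k. k \<notin> K \<Longrightarrow> T x k = x k" using Suc by auto
  have p: "preserves (gauss K) (\<lambda>x. mat_act n (\<sigma> m) Q (T x))"
    by (rule preserves_comp[OF gauss_rotD(4)[OF Q K(1) i1 sub] T(1)])
  have out: "mat_act n (\<sigma> m) Q (T x) k = x k" if "k \<notin> K" for x k
    using that sub T(3) by (subst mat_act_other) auto
  have "mat_act n (\<sigma> m) Q (T x) (\<sigma> j i) = (if j < Suc m then \<Sum>l<n. Q $$ (i, l) * x (\<sigma> j l) else x (\<sigma> j i))"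
    if i: "i < n" for x j i
  proof (cases "j = m")
    case True
    then show ?thesis using i i1 T(2) by (simp add: mat_act_apply)
  next
    case False
    then have "\<sigma> j i \<notin> \<sigma> m ` {..<n}" using inj by (auto simp: inj_on_def)
    then show ?thesis using False i T(2) by (auto simp: mat_act_other)
  qed
  then show ?case using p out by (intro exI[of _ "\<lambda>x. mat_act n (\<sigma> m) Q (T x)"]) auto
qed

lemma space_gauss: "space (gauss K) = {x. \<forall>k. k \<notin> K \<longrightarrow> x k = undefined}"
  by (auto simp: space_PiM PiE_def extensional_def)

lemma preserves_lmul:
  assumes Q: "Q \<in> gauss_rot n"
  shows "preserves (gaussian_entries n) (lmul n Q)"
proof -
  let ?K = "{0..<n} \<times> {0..<n}"
  obtain T where T: "preserves (gauss ?K) T"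
    "\<And>x j i. i < n \<Longrightarrow> T x (i, j) = (if j < n then \<Sum>l<n. Q $$ (i, l) * x (l, j) else x (i, j))"
    "\<And>x k. k \<notin> ?K \<Longrightarrow> T x k = x k"
    using preserves_mat_act_all[OF Q, of "\<lambda>j i. (i, j)" ?K n] by (auto simp: inj_on_def)
  show ?thesis unfolding gaussian_entries_def
    by (rule preserves_cong[OF T(1)]) (auto simp: space_gauss lmul_def fun_eq_iff T)
qed

lemma preserves_rmul:
  assumes Q: "Q \<in> gauss_rot n"
  shows "preserves (gaussian_entries n) (rmul n Q)"
proof -
  let ?K = "{0..<n} \<times> {0..<n}"
  obtain T where T: "preserves (gauss ?K) T"
    "\<And>x j i. i < n \<Longrightarrow> T x (j, i) = (if j < n then \<Sum>l<n. Q $$ (i, l) * x (j, l) else x (j, i))"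
    "\<And>x k. k \<notin> ?K \<Longrightarrow> T x k = x k"
    using preserves_mat_act_all[OF Q, of "\<lambda>j i. (j, i)" ?K n] by (auto simp: inj_on_def)
  show ?thesis unfolding gaussian_entries_def
    by (rule preserves_cong[OF T(1)]) (auto simp: space_gauss rmul_def fun_eq_iff T)
qed

lemma mat_lmul:
  assumes "Q \<in> carrier_mat n n"
  shows "Matrix.mat n n (lmul n Q x) = Q * Matrix.mat n n x"
  using assms by (intro eq_matI) (auto simp: lmul_def mat_mult_entry[where n=n and m=n and l=n] simp del: index_mult_mat(1))

lemma mat_rmul:
  assumes "Q \<in> carrier_mat n n"
  shows "Matrix.mat n n (rmul n Q x) = Matrix.mat n n x * transpose_mat Q"
  using assms by (intro eq_matI) (auto simp: rmul_def mat_mult_entry[where n=n and m=n and l=n] mult.commute simp del: index_mult_mat(1))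

text \<open>A rotation with first row \<open>u\<close> turns the inner product into a single
  coordinate.\<close>

lemma distr_inner_gauss:
  fixes i :: nat and u :: "nat \<Rightarrow> real"
  assumes n: "0 < n" and u: "(\<Sum>j<n. (u j)\<^sup>2) = 1"
  shows "distr (gauss ({i} \<times> {0..<n})) borel (\<lambda>a. \<Sum>j<n. a (i, j) * u j) = std_gaussian"
proof -
  let ?K = "{i} \<times> {0..<n}"
  interpret K: product_prob_space "\<lambda>_. std_gaussian" ?K by unfold_locales
  obtain Q where Q: "Q \<in> gauss_rot n" and q0: "\<And>j. j < n \<Longrightarrow> Q $$ (0, j) = u j"
    using gauss_rot_exists[OF n u] by auto
  let ?T = "mat_act n (\<lambda>j. (i, j)) Q"
  have p: "preserves (gauss ?K) ?T" by (rule gauss_rotD(4)[OF Q]) (auto simp: inj_on_def)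
  have T0: "?T a (i, 0) = (\<Sum>j<n. a (i, j) * u j)" for a
    using mat_act_apply[of "\<lambda>j. (i, j)" n 0 Q a] n by (auto simp: inj_on_def q0 mult.commute)
  have c: "distr (gauss ?K) std_gaussian (\<lambda>a. a (i, 0)) = std_gaussian"
    using K.PiM_component[of "(i, 0)"] n by auto
  have "std_gaussian = distr (distr (gauss ?K) (gauss ?K) ?T) std_gaussian (\<lambda>a. a (i, 0))"
    using p c by (simp add: preserves_def)
  also have "\<dots> = distr (gauss ?K) std_gaussian ((\<lambda>a. a (i, 0)) \<circ> ?T)"
    using p n by (intro distr_distr) (auto simp: preserves_def)
  also have "\<dots> = distr (gauss ?K) borel (\<lambda>a. \<Sum>j<n. a (i, j) * u j)"
    by (intro distr_cong) (auto simp: T0)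
  finally show ?thesis by simp
qed

section \<open>The inverse of a Gaussian matrix\<close>

lemma mat_inverse_unique:
  fixes X :: "'a :: field mat"
  assumes X: "X \<in> carrier_mat n n" "B \<in> carrier_mat n n" "C \<in> carrier_mat n n" and "B * X = 1\<^sub>m n" "X * C = 1\<^sub>m n"
  shows "B = C"
proof -
  have "B = B * (X * C)" using assms by simp
  also have "\<dots> = B * X * C" using X by (intro assoc_mult_mat[symmetric]) auto
  also have "\<dots> = C" using assms by simp
  finally show ?thesis .
qed

lemma det_inverse_ne_zero:
  fixes X :: "'a :: field mat"
  assumes "X \<in> carrier_mat n n" "B \<in> carrier_mat n n" "X * B = 1\<^sub>m n"
  shows "det X \<noteq> 0"
proof
  assume "det X = 0"
  then have "det (X * B) = 0" using det_mult[OF assms(1,2)] by simp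
  then show False using assms(3) by simp
qed

lemma inv_mat_unique:
  assumes X: "X \<in> carrier_mat n n" "B \<in> carrier_mat n n" and e: "X * B = 1\<^sub>m n"
  shows "inv_mat X = B"
proof (cases "mat_inverse X")
  case None
  have "det X \<noteq> 0" using det_inverse_ne_zero[OF X e] .
  then have "X \<in> Units (ring_mat TYPE(real) n ())" using X by (intro det_non_zero_imp_unit)
  then show ?thesis using mat_inverse(1)[OF X(1) None, where b="()"] by simp
next
  case (Some C)
  from mat_inverse(2)[OF X(1) Some] have "X * C = 1\<^sub>m n" "C * X = 1\<^sub>m n" "C \<in> carrier_mat n n" by auto
  then have "C = B" using mat_inverse_unique[of X n C B] X e by simp
  then show ?thesis using Some by (simp add: inv_mat_def)
qed

text \<open>A formula without case distinction: it makes the entries measurable and shows on which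
  rows they depend.\<close>

lemma inv_mat_adj:
  assumes X: "X \<in> carrier_mat n n"
  shows "inv_mat X = (1 / det X) \<cdot>\<^sub>m adj_mat X"
proof (cases "det X = 0")
  case True
  have "mat_inverse X = None"
  proof (rule ccontr)
    assume "mat_inverse X \<noteq> None"
    then obtain C where "mat_inverse X = Some C" by auto
    from mat_inverse(2)[OF X this] show False using det_inverse_ne_zero[OF X] True by blast
  qed
  then have "inv_mat X = 0\<^sub>m n n" using X by (simp add: inv_mat_def)
  then show ?thesis using True X adj_mat(1)[OF X] by (intro eq_matI) auto
next
  case False
  have "X * ((1 / det X) \<cdot>\<^sub>m adj_mat X) = (1 / det X) \<cdot>\<^sub>m (X * adj_mat X)"
    using X adj_mat(1)[OF X] by (intro mult_smult_distrib) auto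
  also have "\<dots> = 1\<^sub>m n" using False by (simp add: adj_mat(2)[OF X]) (intro eq_matI, auto)
  finally show ?thesis using X adj_mat(1)[OF X] by (intro inv_mat_unique) auto
qed

definition gmat :: "nat \<Rightarrow> (nat \<times> nat \<Rightarrow> real) \<Rightarrow> real mat" where
  "gmat n x = Matrix.mat n n x"

definition ginv :: "nat \<Rightarrow> (nat \<times> nat \<Rightarrow> real) \<Rightarrow> nat \<Rightarrow> nat \<Rightarrow> real" where
  "ginv n x i j = inv_mat (gmat n x) $$ (i, j)"

lemma gmat_carrier [simp]: "gmat n x \<in> carrier_mat n n" "dim_row (gmat n x) = n" "dim_col (gmat n x) = n"
  by (simp_all add: gmat_def)

lemma gmat_index [simp]: "i < n \<Longrightarrow> j < n \<Longrightarrow> gmat n x $$ (i, j) = x (i, j)"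
  by (simp add: gmat_def)

lemma inv_mat_carrier [simp]: "X \<in> carrier_mat n n \<Longrightarrow> inv_mat X \<in> carrier_mat n n"
  using inv_mat_adj adj_mat(1) by (metis smult_carrier_mat)

text \<open>
  For singular matrices both sides are 0: \<open>inv_mat\<close> has the dummy value 0, and division by 0 gives 0.
\<close>

lemma ginv_cofactor: "i < n \<Longrightarrow> j < n \<Longrightarrow> ginv n x i j = cofactor (gmat n x) j i / det (gmat n x)"
  unfolding ginv_def using inv_mat_adj[OF gmat_carrier(1), of n x] by (simp add: adj_mat_def)

lemma inv_mat_mult:
  assumes X: "X \<in> carrier_mat n n" and d: "det X \<noteq> 0"
  shows "X * inv_mat X = 1\<^sub>m n" "inv_mat X * X = 1\<^sub>m n"
proof -
  have "X \<in> Units (ring_mat TYPE(real) n ())" using X d by (intro det_non_zero_imp_unit)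
  then obtain C where C: "mat_inverse X = Some C" using mat_inverse(1)[OF X, where b="()"] by (cases "mat_inverse X") auto
  then show "X * inv_mat X = 1\<^sub>m n" "inv_mat X * X = 1\<^sub>m n"
    using mat_inverse(2)[OF X C] by (auto simp: inv_mat_def)
qed

lemma ginv_right:
  assumes "det (gmat n x) \<noteq> 0" "i < n" "k < n"
  shows "(\<Sum>j<n. x (i, j) * ginv n x j k) = (if i = k then 1 else 0)"
proof -
  have "(gmat n x * inv_mat (gmat n x)) $$ (i, k) = (\<Sum>j<n. gmat n x $$ (i, j) * inv_mat (gmat n x) $$ (j, k))"
    using assms by (intro mat_mult_entry[where l=n]) auto
  then show ?thesis using inv_mat_mult(1)[OF gmat_carrier(1) assms(1)] assms by (simp add: ginv_def)
qed

lemma ginv_left: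
  assumes "det (gmat n x) \<noteq> 0" "i < n" "k < n"
  shows "(\<Sum>j<n. ginv n x i j * x (j, k)) = (if i = k then 1 else 0)"
proof -
  have "(inv_mat (gmat n x) * gmat n x) $$ (i, k) = (\<Sum>j<n. inv_mat (gmat n x) $$ (i, j) * gmat n x $$ (j, k))"
    using assms by (intro mat_mult_entry[where l=n]) auto
  then show ?thesis using inv_mat_mult(2)[OF gmat_carrier(1) assms(1)] assms by (simp add: ginv_def)
qed

lemma ginv_solve:
  assumes d: "det (gmat n x) \<noteq> 0" and v: "\<And>i. i < n \<Longrightarrow> (\<Sum>j<n. x (i, j) * v j) = w i" and j: "j < n"
  shows "v j = (\<Sum>i<n. ginv n x j i * w i)"
proof -
  have "(\<Sum>i<n. ginv n x j i * w i) = (\<Sum>i<n. \<Sum>l<n. ginv n x j i * (x (i, l) * v l))"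
    by (intro sum.cong refl) (simp add: v[symmetric] sum_distrib_left)
  also have "\<dots> = (\<Sum>l<n. \<Sum>i<n. ginv n x j i * (x (i, l) * v l))" by (rule sum.swap)
  also have "\<dots> = (\<Sum>l<n. (\<Sum>i<n. ginv n x j i * x (i, l)) * v l)"
    by (simp add: sum_distrib_right mult.assoc)
  also have "\<dots> = (\<Sum>l<n. (if j = l then 1 else 0) * v l)"
    by (intro sum.cong refl) (simp add: ginv_left[OF d j])
  also have "\<dots> = v j" using j by (simp add: if_distrib if_distribR cong: if_cong)
  finally show ?thesis by simp
qed

lemma ginv_singular: "det (gmat n x) = 0 \<Longrightarrow> i < n \<Longrightarrow> j < n \<Longrightarrow> ginv n x i j = 0"
  by (simp add: ginv_cofactor)

lemma gauss_rot_det: 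
  assumes "Q \<in> gauss_rot n"
  shows "det Q \<noteq> 0" "det (transpose_mat Q) \<noteq> 0"
proof -
  note q = gauss_rotD[OF assms]
  have "transpose_mat Q \<in> carrier_mat n n" using q(1) by simp
  then show "det Q \<noteq> 0" "det (transpose_mat Q) \<noteq> 0"
    using det_inverse_ne_zero q by blast+
qed

lemma det_lmul:
  assumes "Q \<in> gauss_rot n"
  shows "det (gmat n (lmul n Q x)) = 0 \<longleftrightarrow> det (gmat n x) = 0"
proof -
  have "det (gmat n (lmul n Q x)) = det Q * det (gmat n x)"
    unfolding gmat_def mat_lmul[OF gauss_rotD(1)[OF assms]] using gauss_rotD(1)[OF assms] by (intro det_mult) auto
  then show ?thesis using gauss_rot_det[OF assms] by simp
qed

lemma det_rmul:
  assumes "Q \<in> gauss_rot n"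
  shows "det (gmat n (rmul n Q x)) = 0 \<longleftrightarrow> det (gmat n x) = 0"
proof -
  have "det (gmat n (rmul n Q x)) = det (gmat n x) * det (transpose_mat Q)"
    unfolding gmat_def mat_rmul[OF gauss_rotD(1)[OF assms]] using gauss_rotD(1)[OF assms] by (intro det_mult) auto
  then show ?thesis using gauss_rot_det[OF assms] by simp
qed

lemma ginv_lmul:
  assumes Q: "Q \<in> gauss_rot n" and ij: "i < n" "j < n"
  shows "ginv n (lmul n Q x) i j = (\<Sum>l<n. ginv n x i l * Q $$ (j, l))"
proof (cases "det (gmat n x) = 0")
  case True
  then show ?thesis using det_lmul[OF Q] ij by (simp add: ginv_singular)
next
  case False
  note q = gauss_rotD[OF Q]
  let ?X = "gmat n x" let ?B = "inv_mat (gmat n x)" let ?T = "transpose_mat Q"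
  have c: "?T \<in> carrier_mat n n" "?B \<in> carrier_mat n n" "?B * ?T \<in> carrier_mat n n" "Q * ?X \<in> carrier_mat n n"
    using q(1) by (auto intro!: mult_carrier_mat)
  have "?X * (?B * ?T) = ?X * ?B * ?T" using c by (intro assoc_mult_mat[symmetric]) auto
  also have "\<dots> = ?T" using inv_mat_mult(1)[OF gmat_carrier(1) False] c by simp
  finally have "Q * (?X * (?B * ?T)) = 1\<^sub>m n" using q(2) by simp
  moreover have "Q * ?X * (?B * ?T) = Q * (?X * (?B * ?T))" using c q(1) by (intro assoc_mult_mat) auto
  ultimately have "inv_mat (Q * ?X) = ?B * ?T" using c by (intro inv_mat_unique) auto
  then have "ginv n (lmul n Q x) i j = (?B * ?T) $$ (i, j)"
    by (simp add: ginv_def gmat_def mat_lmul[OF q(1)])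
  also have "\<dots> = (\<Sum>l<n. ?B $$ (i, l) * ?T $$ (l, j))" using c ij by (intro mat_mult_entry[where l=n]) auto
  also have "\<dots> = (\<Sum>l<n. ginv n x i l * Q $$ (j, l))" using q(1) ij by (intro sum.cong) (auto simp: ginv_def)
  finally show ?thesis .
qed

lemma ginv_rmul:
  assumes Q: "Q \<in> gauss_rot n" and ij: "i < n" "j < n"
  shows "ginv n (rmul n Q x) i j = (\<Sum>l<n. Q $$ (i, l) * ginv n x l j)"
proof (cases "det (gmat n x) = 0")
  case True
  then show ?thesis using det_rmul[OF Q] ij by (simp add: ginv_singular)
next
  case False
  note q = gauss_rotD[OF Q]
  let ?X = "gmat n x" let ?B = "inv_mat (gmat n x)" let ?T = "transpose_mat Q"
  have c: "?T \<in> carrier_mat n n" "?B \<in> carrier_mat n n" "Q * ?B \<in> carrier_mat n n" "?X * ?T \<in> carrier_mat n n"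
    using q(1) by (auto intro!: mult_carrier_mat)
  have "?T * (Q * ?B) = ?T * Q * ?B" using c q(1) by (intro assoc_mult_mat[where n\<^sub>4=n, symmetric]) auto
  also have "\<dots> = ?B" using q(3) left_mult_one_mat[OF c(2)] by simp
  finally have "?X * (?T * (Q * ?B)) = 1\<^sub>m n" using inv_mat_mult(1)[OF gmat_carrier(1) False] by simp
  moreover have "?X * ?T * (Q * ?B) = ?X * (?T * (Q * ?B))" using c q(1) by (intro assoc_mult_mat) auto
  ultimately have "inv_mat (?X * ?T) = Q * ?B" using c by (intro inv_mat_unique) auto
  then have "ginv n (rmul n Q x) i j = (Q * ?B) $$ (i, j)"
    by (simp add: ginv_def gmat_def mat_rmul[OF q(1)])
  also have "\<dots> = (\<Sum>l<n. Q $$ (i, l) * ?B $$ (l, j))" using c q(1) ij by (intro mat_mult_entry[where l=n]) auto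
  finally show ?thesis by (simp add: ginv_def)
qed

definition diagm :: "nat \<Rightarrow> (nat \<Rightarrow> real) \<Rightarrow> real mat" where
  "diagm n e = Matrix.mat n n (\<lambda>(i, j). if i = j then e i else 0)"

lemma diagm_sum: "i < n \<Longrightarrow> (\<Sum>j<n. diagm n e $$ (i, j) * f j) = e i * f i"
proof -
  assume i: "i < n"
  have "(\<Sum>j<n. diagm n e $$ (i, j) * f j) = (\<Sum>j\<in>{i}. diagm n e $$ (i, j) * f j)"
    using i by (intro sum.mono_neutral_right) (auto simp: diagm_def)
  then show ?thesis using i by (simp add: diagm_def)
qed

text \<open>A product of the reflections \<open>flipm\<close> at the places with sign -1, built up
  place by place.\<close>

lemma diagm_gauss_rot:
  assumes e: "\<And>i. i < n \<Longrightarrow> e i = 1 \<or> e i = -1"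
  shows "diagm n e \<in> gauss_rot n"
proof -
  have "m \<le> n \<Longrightarrow> diagm n (\<lambda>i. if i < m then e i else 1) \<in> gauss_rot n" for m
  proof (induction m)
    case 0
    have "diagm n (\<lambda>i. if i < 0 then e i else 1) = 1\<^sub>m n" by (intro eq_matI) (auto simp: diagm_def)
    then show ?case using gauss_rot_one by simp
  next
    case (Suc m)
    then have IH: "diagm n (\<lambda>i. if i < m then e i else 1) \<in> gauss_rot n" and m: "m < n" by auto
    show ?case
    proof (cases "e m = 1")
      case True
      then have "(\<lambda>i. if i < Suc m then e i else 1) = (\<lambda>i. if i < m then e i else 1)"
        by (auto simp: fun_eq_iff less_Suc_eq)
      then show ?thesis using IH by simp
    next
      case False
      then have em: "e m = -1" using e[OF m] by simp
      have "diagm n (\<lambda>i. if i < Suc m then e i else 1) = flipm n m * diagm n (\<lambda>i. if i < m then e i else 1)"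
      proof (rule eq_matI)
        fix i j assume "i < dim_row (flipm n m * diagm n (\<lambda>i. if i < m then e i else 1))"
          "j < dim_col (flipm n m * diagm n (\<lambda>i. if i < m then e i else 1))"
        then have ij: "i < n" "j < n" by (auto simp: flipm_def diagm_def)
        have "(flipm n m * diagm n (\<lambda>i. if i < m then e i else 1)) $$ (i, j)
            = (\<Sum>l<n. flipm n m $$ (i, l) * diagm n (\<lambda>i. if i < m then e i else 1) $$ (l, j))"
          using ij by (intro mat_mult_entry[where l=n]) (auto simp: flipm_def diagm_def)
        then show "diagm n (\<lambda>i. if i < Suc m then e i else 1) $$ (i, j)
            = (flipm n m * diagm n (\<lambda>i. if i < m then e i else 1)) $$ (i, j)"
          using ij em by (simp add: flipm_sum) (auto simp: diagm_def)
      qed (auto simp: flipm_def diagm_def)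
      then show ?thesis using gauss_rot_mult[OF flipm_gauss_rot[OF m] IH] by simp
    qed
  qed
  from this[of n] have "diagm n (\<lambda>i. if i < n then e i else 1) \<in> gauss_rot n" by simp
  moreover have "diagm n (\<lambda>i. if i < n then e i else 1) = diagm n e"
    by (intro eq_matI) (auto simp: diagm_def)
  ultimately show ?thesis by simp
qed

section \<open>Measurability and integration over independent blocks\<close>

lemma borel_measurable_det:
  assumes e: "\<And>i j. i < m \<Longrightarrow> j < m \<Longrightarrow> (\<lambda>x. F x $$ (i, j)) \<in> borel_measurable M"
    and c: "\<And>x. F x \<in> carrier_mat m m"
  shows "(\<lambda>x. det (F x) :: real) \<in> borel_measurable M"
proof -
  have "(\<lambda>x. \<Sum>p\<in>{p. p permutes {0..<m}}. signof p * (\<Prod>i = 0..<m. F x $$ (i, p i))) \<in> borel_measurable M"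
    by (intro borel_measurable_sum borel_measurable_times borel_measurable_const borel_measurable_prod e)
       (auto dest: permutes_in_image)
  then show ?thesis using det_def'[OF c] by simp
qed

lemma space_gaussian_entries: "space (gaussian_entries n) = {x. \<forall>k. k \<notin> {0..<n} \<times> {0..<n} \<longrightarrow> x k = undefined}"
  unfolding gaussian_entries_def by (rule space_gauss)

lemma measurable_entry' [measurable]: "i < n \<Longrightarrow> j < n \<Longrightarrow> (\<lambda>x. x (i, j)) \<in> borel_measurable (gaussian_entries n)"
  unfolding gaussian_entries_def by (rule measurable_entry) auto

lemma measurable_det_minor: "m \<le> n \<Longrightarrow> (\<lambda>x. det (gmat m x)) \<in> borel_measurable (gaussian_entries n)"
  by (rule borel_measurable_det[where m=m]) auto

lemma measurable_det [measurable]: "(\<lambda>x. det (gmat n x)) \<in> borel_measurable (gaussian_entries n)"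
  by (rule measurable_det_minor) simp

lemma measurable_cofactor: "i < n \<Longrightarrow> j < n \<Longrightarrow> (\<lambda>x. cofactor (gmat n x) i j) \<in> borel_measurable (gaussian_entries n)"
  unfolding cofactor_def
proof (intro borel_measurable_times borel_measurable_const borel_measurable_det[where m="n - 1"])
  fix a b assume ij: "i < n" "j < n" "a < n - 1" "b < n - 1"
  have "mat_delete (gmat n x) i j $$ (a, b) = x (if a < i then a else Suc a, if b < j then b else Suc b)" for x
    using ij by (auto simp: mat_delete_def)
  then show "(\<lambda>x. mat_delete (gmat n x) i j $$ (a, b)) \<in> borel_measurable (gaussian_entries n)"
    using ij by simp
qed auto

lemma measurable_ginv [measurable]: "i < n \<Longrightarrow> j < n \<Longrightarrow> (\<lambda>x. ginv n x i j) \<in> borel_measurable (gaussian_entries n)"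
  using measurable_cofactor[of j n i] by (simp add: ginv_cofactor)

interpretation gauss_prob: prob_space "gauss K" for K :: "'i set"
  by (rule prob_space_PiM) (rule prob_space_std_gaussian)

lemma prob_space_gaussian_entries: "prob_space (gaussian_entries n)"
  unfolding gaussian_entries_def by (rule gauss_prob.prob_space_axioms)

interpretation ge: prob_space "gaussian_entries n" for n
  by (rule prob_space_gaussian_entries)

lemma nn_integral_merge:
  fixes f :: "('i \<Rightarrow> real) \<Rightarrow> ennreal"
  assumes "finite I" "finite J" "I \<inter> J = {}" "f \<in> borel_measurable (gauss (I \<union> J))"
  shows "(\<integral>\<^sup>+ x. f x \<partial>gauss (I \<union> J)) = (\<integral>\<^sup>+ x. \<integral>\<^sup>+ y. f (merge I J (x, y)) \<partial>gauss J \<partial>gauss I)"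
  using assms by (intro gauss_prod.product_nn_integral_fold) auto

lemma sets_merge_section:
  assumes "{x\<in>space (gauss (I \<union> J)). P x} \<in> sets (gauss (I \<union> J))" "x \<in> space (gauss I)"
  shows "{y\<in>space (gauss J). P (merge I J (x, y))} \<in> sets (gauss J)"
proof -
  have m: "(\<lambda>y. merge I J (x, y)) \<in> measurable (gauss J) (gauss (I \<union> J))"
    using assms(2) by measurable
  have "{y\<in>space (gauss J). P (merge I J (x, y))} = (\<lambda>y. merge I J (x, y)) -` {x\<in>space (gauss (I \<union> J)). P x} \<inter> space (gauss J)"
    using measurable_space[OF m] by auto
  then show ?thesis using measurable_sets[OF m assms(1)] by simp
qed

lemma emeasure_merge:
  assumes "finite I" "finite J" "I \<inter> J = {}" "{x\<in>space (gauss (I \<union> J)). P x} \<in> sets (gauss (I \<union> J))"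
  shows "emeasure (gauss (I \<union> J)) {x\<in>space (gauss (I \<union> J)). P x}
    = (\<integral>\<^sup>+ x. emeasure (gauss J) {y\<in>space (gauss J). P (merge I J (x, y))} \<partial>gauss I)"
proof -
  have "emeasure (gauss (I \<union> J)) {x\<in>space (gauss (I \<union> J)). P x}
      = (\<integral>\<^sup>+ x. indicator {x\<in>space (gauss (I \<union> J)). P x} x \<partial>gauss (I \<union> J))"
    using assms by simp
  also have "\<dots> = (\<integral>\<^sup>+ x. \<integral>\<^sup>+ y. indicator {x\<in>space (gauss (I \<union> J)). P x} (merge I J (x, y)) \<partial>gauss J \<partial>gauss I)"
    using assms by (intro nn_integral_merge) auto
  also have "\<dots> = (\<integral>\<^sup>+ x. emeasure (gauss J) {y\<in>space (gauss J). P (merge I J (x, y))} \<partial>gauss I)"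
  proof (rule nn_integral_cong)
    fix x assume x: "x \<in> space (gauss I)"
    have m: "(\<lambda>y. merge I J (x, y)) \<in> measurable (gauss J) (gauss (I \<union> J))" using x by measurable
    have "(\<integral>\<^sup>+ y. indicator {x\<in>space (gauss (I \<union> J)). P x} (merge I J (x, y)) \<partial>gauss J)
       = (\<integral>\<^sup>+ y. indicator {y\<in>space (gauss J). P (merge I J (x, y))} y \<partial>gauss J)"
      by (rule nn_integral_cong) (use measurable_space[OF m] in \<open>auto simp: indicator_def\<close>)
    then show "(\<integral>\<^sup>+ y. indicator {x\<in>space (gauss (I \<union> J)). P x} (merge I J (x, y)) \<partial>gauss J)
       = emeasure (gauss J) {y\<in>space (gauss J). P (merge I J (x, y))}"
      using sets_merge_section[OF assms(4) x] by simp
  qed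
  finally show ?thesis .
qed

lemma measure_merge_le:
  assumes IJ: "finite I" "finite J" "I \<inter> J = {}" and s: "{x\<in>space (gauss (I \<union> J)). P x} \<in> sets (gauss (I \<union> J))"
    and le: "\<And>x. x \<in> space (gauss I) \<Longrightarrow> measure (gauss J) {y\<in>space (gauss J). P (merge I J (x, y))} \<le> c"
    and c: "0 \<le> c"
  shows "measure (gauss (I \<union> J)) {x\<in>space (gauss (I \<union> J)). P x} \<le> c"
proof -
  have "emeasure (gauss (I \<union> J)) {x\<in>space (gauss (I \<union> J)). P x} \<le> (\<integral>\<^sup>+ x. ennreal c \<partial>gauss I)"
    unfolding emeasure_merge[OF IJ s]
    by (intro nn_integral_mono) (use le in \<open>auto simp: gauss_prob.emeasure_eq_measure intro!: ennreal_leI\<close>)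
  also have "\<dots> = ennreal c" by (simp add: gauss_prob.emeasure_space_1)
  finally show ?thesis using c by (simp add: gauss_prob.emeasure_eq_measure)
qed

text \<open>The interval has length \<open>2 * r\<close> and the density is at most
  \<open>1 / 2\<close>, since \<open>sqrt (2 * pi)\<close> is at least 2.\<close>

lemma std_gaussian_interval:
  assumes "0 \<le> r"
  shows "measure std_gaussian {y. \<bar>y - a\<bar> \<le> r} \<le> r"
proof -
  have *: "std_normal_density x \<le> 1 / 2" for x
  proof -
    have "sqrt (2 * pi) \<ge> sqrt (2\<^sup>2)" using pi_gt3 by (intro real_sqrt_le_mono) (simp add: power2_eq_square)
    then have "1 / sqrt (2 * pi) \<le> 1 / 2" by (intro divide_left_mono) auto
    moreover have "exp (- x\<^sup>2 / 2) \<le> 1" by simp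
    ultimately have "1 / sqrt (2 * pi) * exp (- x\<^sup>2 / 2) \<le> 1 / 2 * 1" by (intro mult_mono) auto
    then show ?thesis by (simp add: std_normal_density_def)
  qed
  have e: "{y. \<bar>y - a\<bar> \<le> r} = {a - r..a + r}" by (auto simp: abs_le_iff)
  have "emeasure std_gaussian {a - r..a + r} = (\<integral>\<^sup>+ x. ennreal (std_normal_density x) * indicator {a - r..a + r} x \<partial>lborel)"
    unfolding std_gaussian_def by (subst emeasure_density) auto
  also have "\<dots> \<le> (\<integral>\<^sup>+ x. ennreal (1 / 2) * indicator {a - r..a + r} x \<partial>lborel)"
    by (intro nn_integral_mono mult_right_mono ennreal_leI *) simp
  also have "\<dots> = ennreal (1 / 2) * ennreal (2 * r)"
    using assms by (subst nn_integral_cmult) auto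
  also have "\<dots> = ennreal r" using assms by (subst ennreal_mult[symmetric]) auto
  finally show ?thesis unfolding e using assms by (simp add: std_gaussian.emeasure_eq_measure)
qed

section \<open>Averages over sign vectors\<close>

definition signs :: "nat \<Rightarrow> (nat \<Rightarrow> real) set" where
  "signs n = PiE {..<n} (\<lambda>_. {-1, 1})"

lemma finite_signs [simp]: "finite (signs n)"
  by (simp add: signs_def finite_PiE)

lemma card_signs [simp]: "card (signs n) = 2 ^ n"
  by (simp add: signs_def card_PiE numeral_2_eq_2)

lemma signsD: "e \<in> signs n \<Longrightarrow> i < n \<Longrightarrow> e i = 1 \<or> e i = -1"
  by (auto simp: signs_def PiE_def Pi_def)

lemma signs_square: "e \<in> signs n \<Longrightarrow> i < n \<Longrightarrow> e i * e i = 1"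
  using signsD by fastforce

lemma sum_signs_prod:
  fixes f :: "nat \<Rightarrow> real \<Rightarrow> real"
  shows "(\<Sum>e\<in>signs n. \<Prod>i<n. f i (e i)) = (\<Prod>i<n. f i (-1) + f i 1)"
  unfolding signs_def using prod_sum_PiE[of "{..<n}" "\<lambda>_. {-1, 1}" f] by simp

lemma prod_list_signs:
  fixes e :: "nat \<Rightarrow> real"
  assumes "set xs \<subseteq> {..<n}"
  shows "prod_list (map e xs) = (\<Prod>i<n. e i ^ count_list xs i)"
  using assms
proof (induction xs)
  case (Cons a xs)
  have "(\<Prod>i<n. e i ^ count_list (a # xs) i) = (\<Prod>i<n. (if i = a then e i else 1) * e i ^ count_list xs i)"
    by (intro prod.cong) auto
  also have "\<dots> = e a * (\<Prod>i<n. e i ^ count_list xs i)"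
    using Cons.prems by (simp add: prod.distrib)
  finally show ?case using Cons by simp
qed simp

text \<open>The sum factors over the indices, and a factor is 2 or 0 according to the parity of the
  number of occurrences of the index.\<close>

lemma sum_signs_prod_list_nonneg:
  assumes "set xs \<subseteq> {..<n}"
  shows "0 \<le> (\<Sum>e\<in>signs n. prod_list (map e xs))"
proof -
  have "(\<Sum>e\<in>signs n. prod_list (map e xs)) = (\<Prod>i<n. (-1) ^ count_list xs i + 1 ^ count_list xs i)"
    by (simp only: prod_list_signs[OF assms] sum_signs_prod[where f="\<lambda>i y. y ^ count_list xs i"])
  also have "\<dots> \<ge> 0" by (intro prod_nonneg) (auto simp: minus_one_power_iff)
  finally show ?thesis .
qed

lemma sum_signs_pair:
  assumes "j < n" "l < n"
  shows "(\<Sum>e\<in>signs n. e j * e l) = (if j = l then 2 ^ n else 0)"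
proof (cases "j = l")
  case True
  then have "(\<Sum>e\<in>signs n. e j * e l) = (\<Sum>e\<in>signs n. 1)"
    using assms by (intro sum.cong) (auto simp: signs_square)
  then show ?thesis using True by simp
next
  case False
  have "(\<Sum>e\<in>signs n. e j * e l) = (\<Sum>e\<in>signs n. prod_list (map e [j, l]))" by simp
  also have "\<dots> = (\<Prod>i<n. (-1) ^ count_list [j, l] i + 1 ^ count_list [j, l] i)"
    using assms prod_list_signs[of "[j, l]" n]
    by (simp only: sum_signs_prod[where f="\<lambda>i y. y ^ count_list [j, l] i", symmetric]) simp
  also have "\<dots> = 0" using assms False by (intro prod_zero) (auto intro!: bexI[of _ j])
  finally show ?thesis using False by simp
qed

lemma sum_signs_square:
  "(\<Sum>e\<in>signs n. (\<Sum>i<n. a i * e i)\<^sup>2) = 2 ^ n * (\<Sum>i<n. (a i)\<^sup>2)"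
proof -
  have "(\<Sum>e\<in>signs n. (\<Sum>i<n. a i * e i)\<^sup>2) = (\<Sum>e\<in>signs n. \<Sum>i<n. \<Sum>j<n. a i * a j * (e i * e j))"
    by (simp add: power2_eq_square sum_product mult_ac)
  also have "\<dots> = (\<Sum>i<n. \<Sum>e\<in>signs n. \<Sum>j<n. a i * a j * (e i * e j))" by (rule sum.swap)
  also have "\<dots> = (\<Sum>i<n. \<Sum>j<n. \<Sum>e\<in>signs n. a i * a j * (e i * e j))"
    by (rule sum.cong[OF refl], rule sum.swap)
  also have "\<dots> = (\<Sum>i<n. \<Sum>j<n. a i * a j * (if i = j then 2 ^ n else 0))"
    by (intro sum.cong refl) (simp add: sum_distrib_left[symmetric] sum_signs_pair)
  also have "\<dots> = 2 ^ n * (\<Sum>i<n. (a i)\<^sup>2)"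
    by (simp add: if_distrib sum_distrib_left power2_eq_square mult_ac cong: if_cong)
  finally show ?thesis .
qed

section \<open>Khinchine's inequality for even moments\<close>

lemma tanh_real_le_self: "0 \<le> x \<Longrightarrow> tanh x \<le> (x :: real)"
proof -
  assume x: "0 \<le> x"
  have "0 - tanh 0 \<le> x - tanh x"
  proof (rule DERIV_nonneg_imp_nondecreasing[OF x])
    fix y :: real assume "0 \<le> y" "y \<le> x"
    have "((\<lambda>y. y - tanh y) has_real_derivative (1 - (1 - tanh y ^ 2))) (at y)"
      by (auto intro!: derivative_eq_intros)
    then show "\<exists>d. ((\<lambda>y. y - tanh y) has_real_derivative d) (at y) \<and> 0 \<le> d" by (intro exI conjI) auto
  qed
  then show ?thesis by simp
qed

text \<open>The logarithm of \<open>cosh\<close> has derivative \<open>tanh\<close>, which is at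
  most the identity on the positive axis. This makes a sign subgaussian.\<close>

lemma cosh_real_le_exp: "cosh x \<le> exp (x\<^sup>2 / 2 :: real)"
proof -
  have *: "cosh x \<le> exp (x\<^sup>2 / 2)" if x: "0 \<le> x" for x :: real
  proof -
    have "0\<^sup>2 / 2 - ln (cosh 0) \<le> x\<^sup>2 / 2 - ln (cosh x)"
    proof (rule DERIV_nonneg_imp_nondecreasing[OF x])
      fix y :: real assume y: "0 \<le> y" "y \<le> x"
      have "((\<lambda>y. y\<^sup>2 / 2 - ln (cosh y)) has_real_derivative (y - tanh y)) (at y)"
        by (auto intro!: derivative_eq_intros simp: tanh_def)
      then show "\<exists>d. ((\<lambda>y. y\<^sup>2 / 2 - ln (cosh y)) has_real_derivative d) (at y) \<and> 0 \<le> d"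
        using tanh_real_le_self[OF y(1)] by (intro exI conjI) auto
    qed
    then have "ln (cosh x) \<le> x\<^sup>2 / 2" by simp
    then show ?thesis by (metis cosh_real_pos exp_le_cancel_iff exp_ln)
  qed
  show ?thesis using *[of x] *[of "- x"] by (cases "0 \<le> x") auto
qed

lemma power_le_fact_exp: "0 \<le> x \<Longrightarrow> x ^ m \<le> fact m * exp (x :: real)"
proof -
  assume x: "0 \<le> x"
  have "x ^ m /\<^sub>R fact m \<le> (\<Sum>j. x ^ j /\<^sub>R fact j)"
    using sum_le_suminf[OF summable_exp_generic[of x], of "{m}"] x by simp
  then have "x ^ m / fact m \<le> exp x" by (simp add: exp_def field_simps)
  then show ?thesis by (simp add: field_simps)
qed

text \<open>A power \<open>y ^ (2 * k)\<close> is at most \<open>fact (2 * k)\<close> times the sum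
  of two exponentials, and each exponential has sign average at most \<open>exp (1 / 2)\<close>,
  hence at most 2.\<close>

definition khin :: "nat \<Rightarrow> real" where "khin k = 4 * fact (2 * k)"

lemma khin_ge: "1 \<le> khin k" "0 < khin k" "0 \<le> khin k"
proof -
  have "(1::real) \<le> fact (2 * k)" by (rule fact_ge_1)
  then show "1 \<le> khin k" "0 < khin k" "0 \<le> khin k" unfolding khin_def by linarith+
qed

text \<open>Even moments are controlled by the exponential moments at 1 and -1. These factor over
  the coordinates into \<open>cosh\<close> terms, and \<open>cosh_real_le_exp\<close> recombines the
  factors into the exponential of half the square norm.\<close>

lemma khinchine_unit:
  assumes a: "(\<Sum>i<n. (a i)\<^sup>2) = 1"
  shows "(\<Sum>e\<in>signs n. (\<Sum>i<n. a i * e i) ^ (2 * k)) \<le> 2 ^ n * khin k"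
proof -
  have E: "(\<Sum>e\<in>signs n. exp (s * (\<Sum>i<n. a i * e i))) \<le> 2 ^ n * exp (1 / 2)" if s: "s\<^sup>2 = 1" for s :: real
  proof -
    have "(\<Sum>e\<in>signs n. exp (s * (\<Sum>i<n. a i * e i))) = (\<Sum>e\<in>signs n. \<Prod>i<n. exp (s * a i * e i))"
      by (simp add: sum_distrib_left exp_sum mult.assoc)
    also have "\<dots> = (\<Prod>i<n. exp (s * a i * (-1)) + exp (s * a i * 1))"
      by (rule sum_signs_prod[where f="\<lambda>i y. exp (s * a i * y)"])
    also have "\<dots> = (\<Prod>i<n. 2 * cosh (s * a i))" by (intro prod.cong) (auto simp: cosh_def)
    also have "\<dots> \<le> (\<Prod>i<n. 2 * exp ((a i)\<^sup>2 / 2))"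
    proof (intro prod_mono conjI)
      fix i
      have "cosh (s * a i) \<le> exp ((s * a i)\<^sup>2 / 2)" by (rule cosh_real_le_exp)
      also have "(s * a i)\<^sup>2 = (a i)\<^sup>2" using s by (simp add: power_mult_distrib)
      finally show "2 * cosh (s * a i) \<le> 2 * exp ((a i)\<^sup>2 / 2)" by simp
    qed (simp add: less_imp_le[OF cosh_real_pos])
    also have "\<dots> = 2 ^ n * exp (\<Sum>i<n. (a i)\<^sup>2 / 2)" by (simp add: prod.distrib exp_sum)
    also have "(\<Sum>i<n. (a i)\<^sup>2 / 2) = 1 / 2" using a by (simp add: sum_divide_distrib[symmetric])
    finally show ?thesis .
  qed
  have p: "(y::real) ^ (2 * k) \<le> fact (2 * k) * (exp (1 * y) + exp ((-1) * y))" for y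
  proof -
    have "y ^ (2 * k) = \<bar>y\<bar> ^ (2 * k)" by (simp add: power_mult)
    also have "\<dots> \<le> fact (2 * k) * exp \<bar>y\<bar>" by (rule power_le_fact_exp) simp
    also have "exp \<bar>y\<bar> \<le> exp (1 * y) + exp ((-1) * y)" by (simp add: abs_if add_increasing add_increasing2)
    finally show ?thesis by simp
  qed
  have e2: "exp (1 / 2 :: real) \<le> 2" 
  proof -
    have "exp (1/2 :: real) ^ 2 = exp 1" by (simp add: exp_double[symmetric] power2_eq_square exp_add[symmetric])
    also have "\<dots> \<le> 2 ^ 2" using exp_le by simp
    finally show ?thesis by (rule power2_le_imp_le) simp
  qed
  have "(\<Sum>e\<in>signs n. (\<Sum>i<n. a i * e i) ^ (2 * k))
      \<le> (\<Sum>e\<in>signs n. fact (2 * k) * (exp (1 * (\<Sum>i<n. a i * e i)) + exp ((-1) * (\<Sum>i<n. a i * e i))))"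
    by (intro sum_mono p)
  also have "\<dots> = fact (2 * k) * ((\<Sum>e\<in>signs n. exp (1 * (\<Sum>i<n. a i * e i))) + (\<Sum>e\<in>signs n. exp ((-1) * (\<Sum>i<n. a i * e i))))"
    by (simp add: sum_distrib_left sum.distrib distrib_left)
  also have "\<dots> \<le> fact (2 * k) * (2 ^ n * exp (1 / 2) + 2 ^ n * exp (1 / 2))"
    by (intro mult_left_mono add_mono E) auto
  also have "\<dots> \<le> fact (2 * k) * (2 ^ n * 2 + 2 ^ n * 2)"
    by (intro mult_left_mono add_mono e2) auto
  finally show ?thesis by (simp add: khin_def mult_ac)
qed

lemma khinchine:
  "(\<Sum>e\<in>signs n. (\<Sum>i<n. a i * e i) ^ (2 * k)) \<le> 2 ^ n * khin k * (\<Sum>i<n. (a i)\<^sup>2) ^ k"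
proof (cases "(\<Sum>i<n. (a i)\<^sup>2) = 0")
  case True
  then have "a i = 0" if "i < n" for i
    using that by (simp add: sum_nonneg_eq_0_iff)
  then have "(\<Sum>i<n. a i * e i) = 0" for e :: "nat \<Rightarrow> real" by simp
  then show ?thesis using True khin_ge[of k] by (cases k) auto
next
  case False
  define r where "r = sqrt (\<Sum>i<n. (a i)\<^sup>2)"
  have p: "0 < (\<Sum>i<n. (a i)\<^sup>2)" using False sum_nonneg[of "{..<n}" "\<lambda>i. (a i)\<^sup>2"] by (simp add: less_le)
  then have r: "0 < r" "r\<^sup>2 = (\<Sum>i<n. (a i)\<^sup>2)" by (auto simp: r_def)
  have u: "(\<Sum>i<n. (a i / r)\<^sup>2) = 1" using r False by (simp add: power_divide sum_divide_distrib[symmetric])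
  have "(\<Sum>e\<in>signs n. (\<Sum>i<n. a i * e i) ^ (2 * k)) = (\<Sum>e\<in>signs n. r ^ (2 * k) * (\<Sum>i<n. a i / r * e i) ^ (2 * k))"
    using r by (intro sum.cong refl) (simp add: power_mult_distrib[symmetric] sum_distrib_left)
  also have "\<dots> = r ^ (2 * k) * (\<Sum>e\<in>signs n. (\<Sum>i<n. a i / r * e i) ^ (2 * k))" by (simp add: sum_distrib_left)
  also have "\<dots> \<le> r ^ (2 * k) * (2 ^ n * khin k)" using r by (intro mult_left_mono khinchine_unit u) auto
  also have "r ^ (2 * k) = (\<Sum>i<n. (a i)\<^sup>2) ^ k" using r by (simp add: power_mult)
  finally show ?thesis by (simp add: mult_ac)
qed

lemma weighted_power_mean:
  fixes w y :: "'a \<Rightarrow> real"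
  assumes "finite I" "\<And>i. i \<in> I \<Longrightarrow> 0 \<le> w i" "\<And>i. i \<in> I \<Longrightarrow> 0 \<le> y i" "0 < (\<Sum>i\<in>I. w i)"
  shows "(\<Sum>i\<in>I. w i * y i) ^ k \<le> (\<Sum>i\<in>I. w i) ^ k * (\<Sum>i\<in>I. w i / (\<Sum>i\<in>I. w i) * y i ^ k)"
proof -
  define W where "W = (\<Sum>i\<in>I. w i)"
  have c: "convex_on {0..} (\<lambda>x::real. x ^ k)"
    using convex_power_odd[of k] convex_on_subset[OF convex_power_even[of k]] by (cases "even k") auto
  have W: "0 < W" using assms by (simp add: W_def)
  have I: "I \<noteq> {}" using assms by auto
  have "(\<Sum>i\<in>I. (w i / W) *\<^sub>R y i) ^ k \<le> (\<Sum>i\<in>I. (w i / W) * y i ^ k)"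
    using assms W I by (intro convex_on_sum[OF _ _ c]) (auto simp: W_def[symmetric] sum_divide_distrib[symmetric])
  moreover have "(\<Sum>i\<in>I. w i * y i) = W * (\<Sum>i\<in>I. (w i / W) *\<^sub>R y i)"
    using W by (simp add: sum_distrib_left)
  ultimately show ?thesis using W unfolding W_def[symmetric]
    by (simp add: power_mult_distrib)
qed

text \<open>The square norm of \<open>A e\<close> is a combination of the squares
  \<open>(A e)\<^sub>i ^ 2 / w i\<close>, where \<open>w i\<close> is the square norm of the row
  \<open>i\<close>. Jensen's inequality with the weights \<open>w i / W\<close> moves the power
  inside, and the scalar inequality applies to each normalised row.\<close>

lemma khinchine_norm:
  fixes A :: "nat \<Rightarrow> nat \<Rightarrow> real"
  assumes k: "0 < k"
  shows "(\<Sum>e\<in>signs n. (\<Sum>i<m. (\<Sum>j<n. A i j * e j)\<^sup>2) ^ k) \<le> 2 ^ n * khin k * (\<Sum>i<m. \<Sum>j<n. (A i j)\<^sup>2) ^ k"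
proof -
  define w where "w i = (\<Sum>j<n. (A i j)\<^sup>2)" for i
  define W where "W = (\<Sum>i<m. w i)"
  have w0: "0 \<le> w i" for i by (simp add: w_def sum_nonneg)
  have wz: "A i j = 0" if "w i = 0" "j < n" for i j
    using that by (simp add: w_def sum_nonneg_eq_0_iff)
  show ?thesis
  proof (cases "W = 0")
    case True
    then have "w i = 0" if "i < m" for i using that w0 sum_nonneg_0[of "{..<m}" w i] by (auto simp: W_def)
    then have "(\<Sum>i<m. (\<Sum>j<n. A i j * e j)\<^sup>2) = 0" for e
      by (intro sum.neutral) (auto simp: wz)
    then show ?thesis using True k khin_ge[of k] by (simp add: W_def w_def zero_power)
  next
    case False
    then have W: "0 < W" using w0 by (metis W_def less_eq_real_def sum_nonneg)
    have "(\<Sum>e\<in>signs n. (\<Sum>i<m. (\<Sum>j<n. A i j * e j)\<^sup>2) ^ k)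
        \<le> (\<Sum>e\<in>signs n. W ^ k * (\<Sum>i<m. w i / W * ((\<Sum>j<n. A i j * e j)\<^sup>2 / w i) ^ k))"
    proof (rule sum_mono)
      fix e
      have "(\<Sum>i<m. (\<Sum>j<n. A i j * e j)\<^sup>2) = (\<Sum>i<m. w i * ((\<Sum>j<n. A i j * e j)\<^sup>2 / w i))"
      proof (intro sum.cong refl)
        fix i
        \<comment> \<open>For \<open>w i = 0\<close> the whole row vanishes, so both sides are 0 in
          spite of the division.\<close>
        show "(\<Sum>j<n. A i j * e j)\<^sup>2 = w i * ((\<Sum>j<n. A i j * e j)\<^sup>2 / w i)"
          by (cases "w i = 0") (auto simp: wz)
      qed
      then show "(\<Sum>i<m. (\<Sum>j<n. A i j * e j)\<^sup>2) ^ k \<le> W ^ k * (\<Sum>i<m. w i / W * ((\<Sum>j<n. A i j * e j)\<^sup>2 / w i) ^ k)"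
        using weighted_power_mean[of "{..<m}" w "\<lambda>i. (\<Sum>j<n. A i j * e j)\<^sup>2 / w i" k] w0 W
        unfolding W_def by simp
    qed
    also have "\<dots> = W ^ k * (\<Sum>i<m. w i / W * (\<Sum>e\<in>signs n. ((\<Sum>j<n. A i j * e j)\<^sup>2 / w i) ^ k))"
      by (subst sum_distrib_left[symmetric], subst sum.swap) (simp add: sum_distrib_left)
    also have "\<dots> \<le> W ^ k * (\<Sum>i<m. w i / W * (2 ^ n * khin k))"
    proof (intro mult_left_mono sum_mono)
      fix i
      have "(\<Sum>e\<in>signs n. ((\<Sum>j<n. A i j * e j)\<^sup>2 / w i) ^ k) = (\<Sum>e\<in>signs n. (\<Sum>j<n. A i j * e j) ^ (2 * k)) / w i ^ k"
        by (simp add: power_divide power_mult[symmetric] sum_divide_distrib)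
      also have "\<dots> \<le> 2 ^ n * khin k"
      proof (cases "w i = 0")
        case True
        then show ?thesis using k khin_ge[of k] by (simp add: zero_power)
      next
        case False
        then have "0 < w i ^ k" using w0[of i] by simp
        then show ?thesis using khinchine[where n=n and a="A i" and k=k] by (simp add: w_def[symmetric] divide_le_eq)
      qed
      finally show "(\<Sum>e\<in>signs n. ((\<Sum>j<n. A i j * e j)\<^sup>2 / w i) ^ k) \<le> 2 ^ n * khin k" .
    qed (use w0 W in auto)
    also have "\<dots> = W ^ k * (2 ^ n * khin k)"
      using W by (simp add: sum_distrib_right[symmetric] sum_divide_distrib[symmetric] W_def[symmetric])
    finally show ?thesis by (simp add: W_def w_def mult_ac)
  qed
qed

text \<open>Scalar version over \<open>d\<close> with \<open>e\<close> fixed, then the vector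
  version over \<open>e\<close>.\<close>

lemma khinchine_bilinear:
  fixes A :: "nat \<Rightarrow> nat \<Rightarrow> real"
  assumes k: "0 < k"
  shows "(\<Sum>d\<in>signs n. \<Sum>e\<in>signs n. (\<Sum>i<n. \<Sum>j<n. d i * A i j * e j) ^ (2 * k))
    \<le> 4 ^ n * (khin k)\<^sup>2 * (\<Sum>i<n. \<Sum>j<n. (A i j)\<^sup>2) ^ k"
proof -
  have "(\<Sum>d\<in>signs n. \<Sum>e\<in>signs n. (\<Sum>i<n. \<Sum>j<n. d i * A i j * e j) ^ (2 * k))
      = (\<Sum>e\<in>signs n. \<Sum>d\<in>signs n. (\<Sum>i<n. (\<Sum>j<n. A i j * e j) * d i) ^ (2 * k))"
    by (subst sum.swap) (simp add: sum_distrib_right sum_distrib_left mult_ac)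
  also have "\<dots> \<le> (\<Sum>e\<in>signs n. 2 ^ n * khin k * (\<Sum>i<n. (\<Sum>j<n. A i j * e j)\<^sup>2) ^ k)"
    by (intro sum_mono khinchine)
  also have "\<dots> = 2 ^ n * khin k * (\<Sum>e\<in>signs n. (\<Sum>i<n. (\<Sum>j<n. A i j * e j)\<^sup>2) ^ k)"
    by (simp add: sum_distrib_left)
  also have "\<dots> \<le> 2 ^ n * khin k * (2 ^ n * khin k * (\<Sum>i<n. \<Sum>j<n. (A i j)\<^sup>2) ^ k)"
    using khin_ge[of k] by (intro mult_left_mono khinchine_norm k) auto
  also have "\<dots> = 4 ^ n * (khin k)\<^sup>2 * (\<Sum>i<n. \<Sum>j<n. (A i j)\<^sup>2) ^ k"
    by (simp add: power2_eq_square power_mult_distrib[symmetric] mult_ac)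
  finally show ?thesis .
qed

text \<open>The places where \<open>f\<close> is below half its mean carry at most half of the sum.
  The other half is carried by the remaining places, and the Cauchy--Schwarz inequality against the
  second moment shows that there must be many of them.\<close>

lemma paley_zygmund:
  fixes f :: "'a \<Rightarrow> real" and m K :: real
  assumes S: "finite S" and f0: "\<And>e. e \<in> S \<Longrightarrow> 0 \<le> f e" and m: "(\<Sum>e\<in>S. f e) = card S * m"
    and q: "(\<Sum>e\<in>S. (f e)\<^sup>2) \<le> card S * K * m\<^sup>2" and m0: "0 < m" and K: "0 < K"
  shows "card S \<le> 4 * K * card {e\<in>S. m / 2 \<le> f e}"
proof (cases "card S = 0")
  case False
  define N where "N = real (card S)"
  have N: "0 < N" using False by (simp add: N_def)
  let ?G = "{e\<in>S. m / 2 \<le> f e}"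
  have "N * m = (\<Sum>e\<in>S - ?G. f e) + (\<Sum>e\<in>?G. f e)"
    using m sum.subset_diff[of ?G S f] S by (simp add: N_def)
  also have "(\<Sum>e\<in>S - ?G. f e) \<le> (\<Sum>e\<in>S - ?G. m / 2)" by (intro sum_mono) auto
  also have "\<dots> \<le> N * (m / 2)"
    using m0 card_mono[of S "S - ?G"] S by (simp add: N_def)
  finally have "N * m / 2 \<le> (\<Sum>e\<in>?G. f e)" by (simp add: field_simps)
  then have "(N * m / 2)\<^sup>2 \<le> (\<Sum>e\<in>?G. f e)\<^sup>2" using N m0 by (intro power_mono) auto
  also have "\<dots> \<le> card ?G * (\<Sum>e\<in>?G. (f e)\<^sup>2)"
    using sum_squared_le_sum_of_squares[of f ?G] S by (simp add: mult.commute)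
  also have "\<dots> \<le> card ?G * (\<Sum>e\<in>S. (f e)\<^sup>2)"
    by (intro mult_left_mono sum_mono2) (use S in auto)
  also have "\<dots> \<le> card ?G * (N * K * m\<^sup>2)" unfolding N_def by (intro mult_left_mono q) auto
  finally have "(N * m\<^sup>2) * N \<le> (N * m\<^sup>2) * (4 * K * card ?G)"
    by (simp add: power2_eq_square field_simps)
  then show ?thesis using N m0 by (simp add: N_def)
qed (use K in simp)

text \<open>The mean of the square norm of \<open>A e\<close> is exactly the Hilbert--Schmidt
  square, and \<open>khinchine_norm\<close> with exponent 2 bounds its second moment.\<close>

lemma card_signs_norm_large:
  fixes A :: "nat \<Rightarrow> nat \<Rightarrow> real"
  assumes W: "0 < (\<Sum>i<m. \<Sum>j<n. (A i j)\<^sup>2)"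
  shows "2 ^ n \<le> 4 * khin 2 * card {e\<in>signs n. (\<Sum>i<m. \<Sum>j<n. (A i j)\<^sup>2) / 2 \<le> (\<Sum>i<m. (\<Sum>j<n. A i j * e j)\<^sup>2)}"
proof -
  have "(\<Sum>e\<in>signs n. \<Sum>i<m. (\<Sum>j<n. A i j * e j)\<^sup>2) = (\<Sum>i<m. \<Sum>e\<in>signs n. (\<Sum>j<n. A i j * e j)\<^sup>2)"
    by (rule sum.swap)
  also have "\<dots> = 2 ^ n * (\<Sum>i<m. \<Sum>j<n. (A i j)\<^sup>2)"
    by (simp add: sum_signs_square sum_distrib_left)
  finally have "(\<Sum>e\<in>signs n. \<Sum>i<m. (\<Sum>j<n. A i j * e j)\<^sup>2) = card (signs n) * (\<Sum>i<m. \<Sum>j<n. (A i j)\<^sup>2)"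
    by simp
  then have "card (signs n) \<le> 4 * khin 2 * card {e\<in>signs n. (\<Sum>i<m. \<Sum>j<n. (A i j)\<^sup>2) / 2 \<le> (\<Sum>i<m. (\<Sum>j<n. A i j * e j)\<^sup>2)}"
    using khinchine_norm[where k=2 and n=n and m=m and A=A] W khin_ge[of 2]
    by (intro paley_zygmund) (auto intro!: sum_nonneg)
  then show ?thesis by simp
qed

section \<open>The Hilbert--Schmidt norm of the inverse\<close>

definition hsq :: "nat \<Rightarrow> (nat \<times> nat \<Rightarrow> real) \<Rightarrow> real" where
  "hsq n x = (\<Sum>i<n. \<Sum>j<n. (ginv n x i j)\<^sup>2)"

lemma hsq_nonneg [simp]: "0 \<le> hsq n x"
  by (simp add: hsq_def sum_nonneg)

lemma measurable_hsq [measurable]: "hsq n \<in> borel_measurable (gaussian_entries n)"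
  unfolding hsq_def
  by (intro borel_measurable_sum borel_measurable_power measurable_ginv) auto

lemma hsq_lmul:
  assumes Q: "Q \<in> gauss_rot n"
  shows "hsq n (lmul n Q x) = hsq n x"
  unfolding hsq_def
proof (rule sum.cong[OF refl])
  fix i assume "i \<in> {..<n}"
  then have "(\<Sum>j<n. (ginv n (lmul n Q x) i j)\<^sup>2) = (\<Sum>j<n. (\<Sum>l<n. Q $$ (j, l) * ginv n x i l)\<^sup>2)"
    by (intro sum.cong refl) (simp add: ginv_lmul[OF Q] mult.commute)
  also have "\<dots> = (\<Sum>j<n. (ginv n x i j)\<^sup>2)" by (rule gauss_rot_norm[OF Q])
  finally show "(\<Sum>j<n. (ginv n (lmul n Q x) i j)\<^sup>2) = (\<Sum>j<n. (ginv n x i j)\<^sup>2)" .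
qed

lemma hsq_rmul:
  assumes Q: "Q \<in> gauss_rot n"
  shows "hsq n (rmul n Q x) = hsq n x"
proof -
  have "hsq n (rmul n Q x) = (\<Sum>j<n. \<Sum>i<n. (ginv n (rmul n Q x) i j)\<^sup>2)"
    unfolding hsq_def by (rule sum.swap)
  also have "\<dots> = (\<Sum>j<n. \<Sum>i<n. (ginv n x i j)\<^sup>2)"
  proof (rule sum.cong[OF refl])
    fix j assume "j \<in> {..<n}"
    then have "(\<Sum>i<n. (ginv n (rmul n Q x) i j)\<^sup>2) = (\<Sum>i<n. (\<Sum>l<n. Q $$ (i, l) * ginv n x l j)\<^sup>2)"
      by (intro sum.cong refl) (simp add: ginv_rmul[OF Q])
    also have "\<dots> = (\<Sum>i<n. (ginv n x i j)\<^sup>2)" by (rule gauss_rot_norm[OF Q])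
    finally show "(\<Sum>i<n. (ginv n (rmul n Q x) i j)\<^sup>2) = (\<Sum>i<n. (ginv n x i j)\<^sup>2)" .
  qed
  also have "\<dots> = hsq n x" unfolding hsq_def by (rule sum.swap)
  finally show ?thesis .
qed

lemma gauss_inner_small:
  fixes i :: nat and u :: "nat \<Rightarrow> real"
  assumes n: "0 < n" and u: "(\<Sum>j<n. (u j)\<^sup>2) = 1" and r: "0 \<le> r"
  shows "measure (gauss ({i} \<times> {0..<n})) {a\<in>space (gauss ({i} \<times> {0..<n})). \<bar>(\<Sum>j<n. a (i, j) * u j) - c\<bar> \<le> r} \<le> r"
proof -
  let ?M = "gauss ({i} \<times> {0..<n})"
  have m: "(\<lambda>a. \<Sum>j<n. a (i, j) * u j) \<in> borel_measurable ?M"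
    by (intro borel_measurable_sum borel_measurable_times measurable_entry) auto
  have "measure std_gaussian {y. \<bar>y - c\<bar> \<le> r} = measure (distr ?M borel (\<lambda>a. \<Sum>j<n. a (i, j) * u j)) {y. \<bar>y - c\<bar> \<le> r}"
    using distr_inner_gauss[OF n u, of i] by simp
  also have "\<dots> = measure ?M ((\<lambda>a. \<Sum>j<n. a (i, j) * u j) -` {y. \<bar>y - c\<bar> \<le> r} \<inter> space ?M)"
    by (rule measure_distr[OF m]) measurable
  also have "(\<lambda>a. \<Sum>j<n. a (i, j) * u j) -` {y. \<bar>y - c\<bar> \<le> r} \<inter> space ?M
      = {a\<in>space ?M. \<bar>(\<Sum>j<n. a (i, j) * u j) - c\<bar> \<le> r}" by auto
  finally show ?thesis using std_gaussian_interval[OF r, of c] by simp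
qed

lemma det_expand_row:
  assumes "i < n"
  shows "det (gmat n x) = (\<Sum>j<n. x (i, j) * cofactor (gmat n x) i j)"
  using laplace_expansion_row[OF gmat_carrier(1) assms, of x] assms by simp

lemma cofactor_row_cong:
  assumes "\<And>a b. a < n \<Longrightarrow> a \<noteq> i \<Longrightarrow> b < n \<Longrightarrow> x (a, b) = y (a, b)" "i < n" "j < n"
  shows "cofactor (gmat n x) i j = cofactor (gmat n y) i j"
proof -
  have "mat_delete (gmat n x) i j = mat_delete (gmat n y) i j"
  proof (rule eq_matI)
    fix a b assume "a < dim_row (mat_delete (gmat n y) i j)" "b < dim_col (mat_delete (gmat n y) i j)"
    then have ab: "a < n - 1" "b < n - 1" by (auto simp: mat_delete_def)
    then show "mat_delete (gmat n x) i j $$ (a, b) = mat_delete (gmat n y) i j $$ (a, b)"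
      using assms by (auto simp: mat_delete_def)
  qed (auto simp: mat_delete_def)
  then show ?thesis by (simp add: cofactor_def)
qed

abbreviation other_rows :: "nat \<Rightarrow> nat \<Rightarrow> (nat \<times> nat) set" where
  "other_rows n i \<equiv> ({0..<n} - {i}) \<times> {0..<n}"

abbreviation rowi :: "nat \<Rightarrow> nat \<Rightarrow> (nat \<times> nat) set" where
  "rowi n i \<equiv> {i} \<times> {0..<n}"

lemma other_rows_un_row: "i < n \<Longrightarrow> other_rows n i \<union> rowi n i = {0..<n} \<times> {0..<n}"
  by auto

lemma gaussian_entries_split: "i < n \<Longrightarrow> gaussian_entries n = gauss (other_rows n i \<union> rowi n i)"
  by (simp only: other_rows_un_row gaussian_entries_def)

lemma prob_row_le:
  assumes i: "i < n" and s: "{x\<in>space (gaussian_entries n). P x} \<in> sets (gaussian_entries n)"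
    and le: "\<And>x. x \<in> space (gauss (other_rows n i)) \<Longrightarrow>
      measure (gauss (rowi n i)) {y\<in>space (gauss (rowi n i)). P (merge (other_rows n i) (rowi n i) (x, y))} \<le> c"
    and c: "0 \<le> c"
  shows "measure (gaussian_entries n) {x\<in>space (gaussian_entries n). P x} \<le> c"
  using s unfolding gaussian_entries_split[OF i]
  by (intro measure_merge_le le c) auto

text \<open>
  The first column of the inverse is the cofactor vector \<open>C\<close> of the first row \<open>a\<close> divided by \<open>a \<bullet> C\<close>, and
  \<open>C\<close> is independent of \<open>a\<close>. Hence its norm is the reciprocal of the modulus of a standard Gaussian variable.
\<close>

lemma col0_tail:
  fixes s :: real
  assumes n: "0 < n" and s: "0 < s"
  shows "measure (gaussian_entries n) {x\<in>space (gaussian_entries n). s\<^sup>2 \<le> (\<Sum>j<n. (ginv n x j 0)\<^sup>2)} \<le> 1 / s"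
proof (rule prob_row_le[OF n])
  have [measurable]: "(\<lambda>x. \<Sum>j<n. (ginv n x j 0)\<^sup>2) \<in> borel_measurable (gaussian_entries n)"
    by (intro borel_measurable_sum borel_measurable_power measurable_ginv) (use n in auto)
  show "{x\<in>space (gaussian_entries n). s\<^sup>2 \<le> (\<Sum>j<n. (ginv n x j 0)\<^sup>2)} \<in> sets (gaussian_entries n)"
    by measurable
  show "0 \<le> 1 / s" using s by simp
  fix x assume "x \<in> space (gauss (other_rows n 0))"
  let ?J = "gauss (rowi n 0)"
  let ?z = "\<lambda>y. merge (other_rows n 0) (rowi n 0) (x, y)"
  define C where "C j = cofactor (gmat n x) 0 j" for j
  define N where "N = (\<Sum>j<n. (C j)\<^sup>2)"
  have N0: "0 \<le> N" by (simp add: N_def sum_nonneg)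
  have cof: "cofactor (gmat n (?z y)) 0 j = C j" if "j < n" for y j
    unfolding C_def using n that by (intro cofactor_row_cong) (auto simp: merge_def)
  have det: "det (gmat n (?z y)) = (\<Sum>j<n. y (0, j) * C j)" for y
  proof -
    have z: "?z y (0, j) = y (0, j)" if "j < n" for j using that by (simp add: merge_def)
    show ?thesis unfolding det_expand_row[OF n] by (intro sum.cong refl) (simp add: cof z)
  qed
  have A: "(\<Sum>j<n. (ginv n (?z y) j 0)\<^sup>2) = N / (\<Sum>j<n. y (0, j) * C j)\<^sup>2" for y
    using n by (simp add: ginv_cofactor cof det N_def power_divide sum_divide_distrib)
  show "measure ?J {y\<in>space ?J. s\<^sup>2 \<le> (\<Sum>j<n. (ginv n (?z y) j 0)\<^sup>2)} \<le> 1 / s"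
  proof (cases "N = 0")
    case True
    then show ?thesis using s by (simp add: A)
  next
    case False
    then have N: "0 < N" using N0 by simp
    define u where "u j = C j / sqrt N" for j
    have u: "(\<Sum>j<n. (u j)\<^sup>2) = 1"
      using N by (simp add: u_def power_divide N_def[symmetric] sum_divide_distrib[symmetric])
    have "measure ?J {y\<in>space ?J. s\<^sup>2 \<le> (\<Sum>j<n. (ginv n (?z y) j 0)\<^sup>2)}
        \<le> measure ?J {y\<in>space ?J. \<bar>(\<Sum>j<n. y (0, j) * u j) - 0\<bar> \<le> 1 / s}"
    proof (rule gauss_prob.finite_measure_mono)
      have [measurable]: "(\<lambda>y. \<Sum>j<n. y (0, j) * u j) \<in> borel_measurable ?J"
        by (intro borel_measurable_sum borel_measurable_times measurable_entry) auto
      show "{y\<in>space ?J. \<bar>(\<Sum>j<n. y (0, j) * u j) - 0\<bar> \<le> 1 / s} \<in> sets ?J" by measurable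
      show "{y\<in>space ?J. s\<^sup>2 \<le> (\<Sum>j<n. (ginv n (?z y) j 0)\<^sup>2)} \<subseteq> {y\<in>space ?J. \<bar>(\<Sum>j<n. y (0, j) * u j) - 0\<bar> \<le> 1 / s}"
      proof clarify
        fix y assume le: "s\<^sup>2 \<le> (\<Sum>j<n. (ginv n (?z y) j 0)\<^sup>2)"
        define d where "d = (\<Sum>j<n. y (0, j) * C j)"
        have d: "s\<^sup>2 \<le> N / d\<^sup>2" using le by (simp add: A d_def)
        have "0 < s\<^sup>2" using s by simp
        \<comment> \<open>A vanishing determinant would make the quotient 0 by convention, below the
          positive \<open>s\<^sup>2\<close>.\<close>
        then have d0: "d \<noteq> 0" using d by (cases "d = 0") simp_all
        have e: "(\<Sum>j<n. y (0, j) * u j) = d / sqrt N"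
          by (simp add: u_def d_def sum_divide_distrib)
        have "s\<^sup>2 * (d / sqrt N)\<^sup>2 \<le> 1" using d d0 N by (simp add: power_divide field_simps)
        moreover have "(s * \<bar>d / sqrt N\<bar>)\<^sup>2 = s\<^sup>2 * (d / sqrt N)\<^sup>2"
          by (simp only: power_mult_distrib power2_abs)
        ultimately have "(s * \<bar>d / sqrt N\<bar>)\<^sup>2 \<le> 1\<^sup>2" by simp
        then have "s * \<bar>d / sqrt N\<bar> \<le> 1" by (rule power2_le_imp_le) simp
        then show "\<bar>(\<Sum>j<n. y (0, j) * u j) - 0\<bar> \<le> 1 / s"
          unfolding e using s by (simp add: pos_le_divide_eq mult.commute)
      qed
    qed
    also have "\<dots> \<le> 1 / s" using s by (intro gauss_inner_small[OF n u]) simp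
    finally show ?thesis .
  qed
qed

lemma sign_rotation:
  assumes n: "0 < n" and e: "e \<in> signs n"
  shows "\<exists>Q\<in>gauss_rot n. \<forall>j<n. Q $$ (0, j) = e j / sqrt n"
proof -
  have "(\<Sum>j<n. (e j / sqrt n)\<^sup>2) = (\<Sum>j<n. 1 / n)"
    using e by (intro sum.cong refl) (simp add: power_divide power2_eq_square signs_square)
  also have "\<dots> = 1" using n by simp
  finally show ?thesis using gauss_rot_exists[OF n, of "\<lambda>j. e j / sqrt n"] by blast
qed

text \<open>The inverse \<open>4 * khin 2\<close> of the proportion of good sign vectors, times the
  factor 2 from applying \<open>col0_tail\<close> at \<open>s / 2\<close>.\<close>

definition hs_const :: real where "hs_const = 8 * khin 2"

lemma hs_const_ge: "1 \<le> hs_const" "0 < hs_const"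
  using khin_ge[of 2] by (auto simp: hs_const_def)

text \<open>
  For a fixed matrix, at least a constant fraction of the sign vectors see half of its Hilbert--Schmidt norm,
  and by rotation invariance the image of a sign vector behaves like \<open>sqrt n\<close> times the first column.
\<close>

lemma hsq_tail:
  fixes s :: real
  assumes n: "0 < n" and s: "0 < s"
  shows "measure (gaussian_entries n) {x\<in>space (gaussian_entries n). s\<^sup>2 * n \<le> hsq n x} \<le> hs_const / s"
proof -
  let ?M = "gaussian_entries n"
  let ?f = "\<lambda>x e. \<Sum>i<n. (\<Sum>j<n. ginv n x i j * e j)\<^sup>2"
  have mf: "(\<lambda>x. ?f x e) \<in> borel_measurable ?M" for e
    by (intro borel_measurable_sum borel_measurable_power borel_measurable_times measurable_ginv) auto
  have E: "measure ?M {x\<in>space ?M. s\<^sup>2 * n / 2 \<le> ?f x e} \<le> 2 / s" if e: "e \<in> signs n" for e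
  proof -
    obtain Q where Q: "Q \<in> gauss_rot n" and q: "\<And>j. j < n \<Longrightarrow> Q $$ (0, j) = e j / sqrt n"
      using sign_rotation[OF n e] by blast
    have eq: "?f x e = n * (\<Sum>i<n. (ginv n (lmul n Q x) i 0)\<^sup>2)" for x
    proof -
      have "ginv n (lmul n Q x) i 0 = (\<Sum>j<n. ginv n x i j * e j) / sqrt n" if "i < n" for i
        using that n by (simp add: ginv_lmul[OF Q] q sum_divide_distrib)
      then show ?thesis using n by (simp add: power_divide sum_divide_distrib[symmetric])
    qed
    have "measure ?M {x\<in>space ?M. s\<^sup>2 * n / 2 \<le> ?f x e}
        = measure ?M {x\<in>space ?M. s\<^sup>2 * n / 2 \<le> n * (\<Sum>i<n. (ginv n (lmul n Q x) i 0)\<^sup>2)}"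
      by (simp only: eq)
    also have "\<dots> = measure ?M {x\<in>space ?M. s\<^sup>2 * n / 2 \<le> n * (\<Sum>i<n. (ginv n x i 0)\<^sup>2)}"
    proof (rule preserves_measure[OF preserves_lmul[OF Q]])
      have [measurable]: "(\<lambda>x. \<Sum>j<n. (ginv n x j 0)\<^sup>2) \<in> borel_measurable (gaussian_entries n)"
        by (intro borel_measurable_sum borel_measurable_power measurable_ginv) (use n in auto)
      show "{x\<in>space ?M. s\<^sup>2 * n / 2 \<le> n * (\<Sum>i<n. (ginv n x i 0)\<^sup>2)} \<in> sets ?M" by measurable
    qed
    also have "\<dots> \<le> measure ?M {x\<in>space ?M. (s / 2)\<^sup>2 \<le> (\<Sum>i<n. (ginv n x i 0)\<^sup>2)}"
    proof (rule ge.finite_measure_mono)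
      have [measurable]: "(\<lambda>x. \<Sum>j<n. (ginv n x j 0)\<^sup>2) \<in> borel_measurable (gaussian_entries n)"
        by (intro borel_measurable_sum borel_measurable_power measurable_ginv) (use n in auto)
      show "{x\<in>space ?M. (s / 2)\<^sup>2 \<le> (\<Sum>i<n. (ginv n x i 0)\<^sup>2)} \<in> sets ?M" by measurable
      show "{x\<in>space ?M. s\<^sup>2 * n / 2 \<le> n * (\<Sum>i<n. (ginv n x i 0)\<^sup>2)} \<subseteq> {x\<in>space ?M. (s / 2)\<^sup>2 \<le> (\<Sum>i<n. (ginv n x i 0)\<^sup>2)}"
      proof clarify
        fix x assume "s\<^sup>2 * n / 2 \<le> n * (\<Sum>i<n. (ginv n x i 0)\<^sup>2)"
        then have "s\<^sup>2 / 2 \<le> (\<Sum>i<n. (ginv n x i 0)\<^sup>2)" using n by (simp add: field_simps)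
        moreover have "(s / 2)\<^sup>2 \<le> s\<^sup>2 / 2" by (simp add: power_divide)
        ultimately show "(s / 2)\<^sup>2 \<le> (\<Sum>i<n. (ginv n x i 0)\<^sup>2)" by linarith
      qed
    qed
    also have "\<dots> \<le> 1 / (s / 2)" using s by (intro col0_tail[OF n]) simp
    finally show ?thesis by simp
  qed
  let ?B = "{x\<in>space ?M. s\<^sup>2 * n \<le> hsq n x}"
  let ?D = "\<lambda>e. {x\<in>space ?M. s\<^sup>2 * n / 2 \<le> ?f x e}"
  have sD: "?D e \<in> sets ?M" for e using mf[of e] by measurable
  have sB: "?B \<in> sets ?M" by measurable
  \<comment> \<open>Integrating this inequality exchanges the averages: the matrix is fixed when the
    good sign vectors are counted, and the sign vector is fixed when the probability
    \<open>E\<close> is used.\<close>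
  have pointwise: "2 ^ n * indicator ?B x \<le> 4 * khin 2 * (\<Sum>e\<in>signs n. indicator (?D e) x :: real)" for x
  proof (cases "x \<in> ?B")
    case True
    then have b: "s\<^sup>2 * n \<le> hsq n x" and xs: "x \<in> space ?M" by auto
    have "0 < s\<^sup>2 * n" using s n by simp
    then have "0 < (\<Sum>i<n. \<Sum>j<n. (ginv n x i j)\<^sup>2)" using b by (simp add: hsq_def)
    from card_signs_norm_large[OF this]
    have "2 ^ n \<le> 4 * khin 2 * card {e\<in>signs n. hsq n x / 2 \<le> ?f x e}" by (simp add: hsq_def)
    also have "\<dots> \<le> 4 * khin 2 * card {e\<in>signs n. x \<in> ?D e}"
      using khin_ge[of 2] b xs by (intro mult_left_mono of_nat_mono card_mono) auto
    also have "real (card {e\<in>signs n. x \<in> ?D e}) = (\<Sum>e\<in>signs n. indicator (?D e) x)"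
      by (simp add: indicator_def sum.If_cases Int_def)
    finally show ?thesis using True by simp
  qed (use khin_ge[of 2] in \<open>auto intro!: mult_nonneg_nonneg sum_nonneg\<close>)
  have "2 ^ n * measure ?M ?B = (\<integral>x. 2 ^ n * indicator ?B x \<partial>?M)" using sB by simp
  also have "\<dots> \<le> (\<integral>x. 4 * khin 2 * (\<Sum>e\<in>signs n. indicator (?D e) x) \<partial>?M)"
    using sB sD by (intro integral_mono pointwise) (auto intro!: integrable_real_indicator simp: ge.emeasure_eq_measure)
  also have "\<dots> = 4 * khin 2 * (\<Sum>e\<in>signs n. measure ?M (?D e))"
    using sD by (subst integral_mult_right_zero, subst Bochner_Integration.integral_sum) (auto intro!: integrable_real_indicator simp: ge.emeasure_eq_measure)
  also have "\<dots> \<le> 4 * khin 2 * (\<Sum>e\<in>signs n. 2 / s)"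
    using khin_ge[of 2] by (intro mult_left_mono sum_mono E) auto
  also have "\<dots> = 2 ^ n * (hs_const / s)" by (simp add: hs_const_def)
  finally show ?thesis by (rule mult_left_le_imp_le) simp
qed

section \<open>Truncated moments of the entries of the inverse\<close>

text \<open>The truncation is imposed on the whole norm and not on single entries, so that it is
  invariant under rotations on both sides.\<close>

definition hs_cut :: "nat \<Rightarrow> real \<Rightarrow> (nat \<times> nat \<Rightarrow> real) \<Rightarrow> real" where
  "hs_cut n t x = of_bool (hsq n x \<le> t\<^sup>2 * n)"

lemma hs_cut_01: "0 \<le> hs_cut n t x" "hs_cut n t x \<le> 1"
  by (simp_all add: hs_cut_def)

lemma measurable_hs_cut [measurable]: "hs_cut n t \<in> borel_measurable (gaussian_entries n)"
proof -
  have "hs_cut n t = (\<lambda>x. if hsq n x \<le> t\<^sup>2 * n then 1 else 0)" by (auto simp: hs_cut_def)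
  then show ?thesis by simp
qed

lemma hs_cut_lmul: "Q \<in> gauss_rot n \<Longrightarrow> hs_cut n t (lmul n Q x) = hs_cut n t x"
  by (simp add: hs_cut_def hsq_lmul)

lemma integrable_hs_cut:
  fixes f :: "_ \<Rightarrow> real" and t :: real
  assumes [measurable]: "f \<in> borel_measurable (gaussian_entries n)" and b: "\<And>x. hsq n x \<le> t\<^sup>2 * n \<Longrightarrow> \<bar>f x\<bar> \<le> B"
  shows "integrable (gaussian_entries n) (\<lambda>x. f x * hs_cut n t x)"
proof (rule ge.integrable_const_bound[where B="\<bar>B\<bar>"])
  show "AE x in gaussian_entries n. norm (f x * hs_cut n t x) \<le> \<bar>B\<bar>"
  proof (rule AE_I2)
    fix x
    show "norm (f x * hs_cut n t x) \<le> \<bar>B\<bar>" using b[of x] by (auto simp: hs_cut_def)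
  qed
qed measurable

lemma ginv_square_le_hsq:
  assumes "i < n" "j < n"
  shows "(ginv n x i j)\<^sup>2 \<le> hsq n x"
proof -
  have "(ginv n x i j)\<^sup>2 \<le> (\<Sum>j<n. (ginv n x i j)\<^sup>2)" using assms by (intro member_le_sum) auto
  also have "\<dots> \<le> hsq n x" unfolding hsq_def
    using assms by (intro member_le_sum[where f="\<lambda>i. \<Sum>j<n. (ginv n x i j)\<^sup>2"]) (auto intro: sum_nonneg)
  finally show ?thesis .
qed

lemma ginv_abs_le:
  fixes t :: real
  assumes "i < n" "j < n" "hsq n x \<le> t\<^sup>2 * n"
  shows "\<bar>ginv n x i j\<bar> \<le> \<bar>t\<bar> * sqrt n"
proof -
  have "\<bar>ginv n x i j\<bar> = sqrt ((ginv n x i j)\<^sup>2)" by simp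
  also have "\<dots> \<le> sqrt (t\<^sup>2 * n)" using ginv_square_le_hsq[OF assms(1,2), of x] assms(3) by (intro real_sqrt_le_mono) simp
  finally show ?thesis by (simp add: real_sqrt_mult)
qed

definition cut_moment :: "nat \<Rightarrow> nat \<Rightarrow> real \<Rightarrow> real" where
  "cut_moment n k t = (\<integral>x. (hsq n x / n) ^ k * hs_cut n t x \<partial>gaussian_entries n)"

lemma integrable_hsq_power:
  fixes t :: real
  assumes n: "0 < n"
  shows "integrable (gaussian_entries n) (\<lambda>x. (hsq n x / n) ^ k * hs_cut n t x)"
proof (rule integrable_hs_cut[where f="\<lambda>x. (hsq n x / n) ^ k" and n=n and t=t and B="(t\<^sup>2) ^ k"])
  fix x assume "hsq n x \<le> t\<^sup>2 * n"
  then have "hsq n x / n \<le> t\<^sup>2" using n by (simp add: field_simps)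
  then show "\<bar>(hsq n x / n) ^ k\<bar> \<le> (t\<^sup>2) ^ k" by (simp add: power_mono)
qed measurable

text \<open>
  Splitting at \<open>t / 2\<close> and iterating replaces the layer cake formula.
\<close>

lemma cut_moment_bound_aux:
  fixes t :: real
  assumes n: "0 < n" and k: "0 < k" and t: "0 < t"
  shows "cut_moment n k t \<le> (t / 2 ^ N) ^ (2 * k) + 4 * hs_const * t ^ (2 * k - 1)"
  using t
proof (induction N arbitrary: t)
  case 0
  have b: "(hsq n x / n) ^ k * hs_cut n t x \<le> t ^ (2 * k)" for x
  proof (cases "hsq n x \<le> t\<^sup>2 * n")
    case True
    then have "hsq n x / n \<le> t\<^sup>2" using n by (simp add: field_simps)
    then have "(hsq n x / n) ^ k \<le> (t\<^sup>2) ^ k" by (intro power_mono) auto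
    then show ?thesis using True by (simp add: hs_cut_def power_mult)
  qed (use 0 in \<open>simp add: hs_cut_def\<close>)
  have "cut_moment n k t \<le> (\<integral>x. t ^ (2 * k) \<partial>gaussian_entries n)"
    unfolding cut_moment_def
  proof (rule integral_mono)
    show "integrable (gaussian_entries n) (\<lambda>x. (hsq n x / real n) ^ k * hs_cut n t x)"
      by (rule integrable_hsq_power[OF n])
  qed (use b in auto)
  also have "\<dots> = t ^ (2 * k)" by (simp add: ge.prob_space)
  also have "\<dots> \<le> t ^ (2 * k) + 4 * hs_const * t ^ (2 * k - 1)" using 0 hs_const_ge by simp
  finally show ?case by simp
next
  case (Suc N)
  let ?M = "gaussian_entries n"
  let ?B = "{x\<in>space ?M. (t / 2)\<^sup>2 * n \<le> hsq n x}"
  note int = integrable_hsq_power[OF n]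
  have sB: "?B \<in> sets ?M" by measurable
  \<comment> \<open>Between \<open>t / 2\<close> and \<open>t\<close> the integrand is at most
    \<open>t ^ (2 * k)\<close>, on an event whose probability is at most
    \<open>2 * hs_const / t\<close>.\<close>
  have pointwise: "(hsq n x / n) ^ k * hs_cut n t x \<le> (hsq n x / n) ^ k * hs_cut n (t / 2) x + t ^ (2 * k) * indicator ?B x"
    if "x \<in> space ?M" for x
  proof (cases "hsq n x \<le> t\<^sup>2 * n")
    case True
    then have "hsq n x / n \<le> t\<^sup>2" using n by (simp add: field_simps)
    then have "(hsq n x / n) ^ k \<le> (t\<^sup>2) ^ k" by (intro power_mono) auto
    then have a: "(hsq n x / n) ^ k \<le> t ^ (2 * k)" by (simp add: power_mult)
    have nn: "0 \<le> (hsq n x / n) ^ k" by simp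
    show ?thesis
    proof (cases "hsq n x \<le> (t / 2)\<^sup>2 * n")
      case T2: True
      then show ?thesis using True Suc.prems by (simp add: hs_cut_def)
    next
      case False
      then show ?thesis using True a that by (simp add: hs_cut_def)
    qed
  next
    case False
    then show ?thesis using Suc.prems by (simp add: hs_cut_def)
  qed
  have "cut_moment n k t \<le> (\<integral>x. (hsq n x / n) ^ k * hs_cut n (t / 2) x + t ^ (2 * k) * indicator ?B x \<partial>?M)"
    unfolding cut_moment_def using sB by (intro integral_mono int pointwise Bochner_Integration.integrable_add) (auto simp: ge.emeasure_eq_measure)
  also have "\<dots> = cut_moment n k (t / 2) + t ^ (2 * k) * measure ?M ?B"
    using sB int[of k "t / 2"] by (subst Bochner_Integration.integral_add) (auto simp: cut_moment_def ge.emeasure_eq_measure)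
  also have "measure ?M ?B \<le> hs_const / (t / 2)" using Suc.prems by (intro hsq_tail n) simp
  also have "t ^ (2 * k) * (hs_const / (t / 2)) = 2 * hs_const * t ^ (2 * k - 1)"
  proof -
    have "t ^ (2 * k) = t * t ^ (2 * k - 1)" using k by (cases k) auto
    then show ?thesis using Suc.prems by simp
  qed
  also have "cut_moment n k (t / 2) \<le> (t / 2 / 2 ^ N) ^ (2 * k) + 4 * hs_const * (t / 2) ^ (2 * k - 1)"
    using Suc.IH[of "t / 2"] Suc.prems by simp
  \<comment> \<open>The exponent is at least 1, so halving \<open>t\<close> at least halves the old
    error; together with the new one it restores the coefficient 4.\<close>
  also have "4 * hs_const * (t / 2) ^ (2 * k - 1) \<le> 2 * hs_const * t ^ (2 * k - 1)"
  proof -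
    have "(2::real) ^ 1 \<le> 2 ^ (2 * k - 1)" using k by (intro power_increasing) auto
    then have "t ^ (2 * k - 1) / 2 ^ (2 * k - 1) \<le> t ^ (2 * k - 1) / 2"
      using Suc.prems by (intro divide_left_mono) auto
    then have "4 * hs_const * (t ^ (2 * k - 1) / 2 ^ (2 * k - 1)) \<le> 4 * hs_const * (t ^ (2 * k - 1) / 2)"
      using hs_const_ge by (intro mult_left_mono) auto
    then show ?thesis by (simp add: power_divide)
  qed
  finally show ?case using Suc.prems by (simp add: field_simps)
qed

lemma cut_moment_bound:
  fixes t :: real
  assumes n: "0 < n" and k: "0 < k" and t: "0 < t"
  shows "cut_moment n k t \<le> 5 * hs_const * t ^ (2 * k - 1)"
proof -
  obtain N where N: "t < 2 ^ N" using real_arch_pow[of 2 t] by auto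
  have "(t / 2 ^ N) ^ (2 * k) \<le> (t / 2 ^ N) * (t / 2 ^ N) ^ (2 * k - 1)"
    using k by (cases k) auto
  also have "\<dots> \<le> 1 * t ^ (2 * k - 1)"
    using N t by (intro mult_mono power_mono) (auto simp: field_simps)
  also have "\<dots> \<le> hs_const * t ^ (2 * k - 1)" using hs_const_ge t by (intro mult_right_mono) auto
  finally show ?thesis using cut_moment_bound_aux[OF n k t, of N] by simp
qed

text \<open>Rotations with first rows \<open>p\<close> and \<open>q\<close> turn the bilinear form
  into the entry at \<open>(0, 0)\<close> and keep \<open>hsq\<close>.\<close>

lemma bilinear_invariant:
  fixes F :: "real \<Rightarrow> real \<Rightarrow> real"
  assumes n: "0 < n" and p: "(\<Sum>i<n. (p i)\<^sup>2) = 1" and q: "(\<Sum>i<n. (q i)\<^sup>2) = 1"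
    and F: "(\<lambda>x. F (ginv n x 0 0) (hsq n x)) \<in> borel_measurable (gaussian_entries n)"
  shows "(\<integral>x. F (\<Sum>i<n. \<Sum>j<n. p i * ginv n x i j * q j) (hsq n x) \<partial>gaussian_entries n)
    = (\<integral>x. F (ginv n x 0 0) (hsq n x) \<partial>gaussian_entries n)"
proof -
  obtain P where P: "P \<in> gauss_rot n" and p0: "\<And>j. j < n \<Longrightarrow> P $$ (0, j) = p j"
    using gauss_rot_exists[OF n p] by blast
  obtain Q where Q: "Q \<in> gauss_rot n" and q0: "\<And>j. j < n \<Longrightarrow> Q $$ (0, j) = q j"
    using gauss_rot_exists[OF n q] by blast
  have pr: "preserves (gaussian_entries n) (\<lambda>x. rmul n P (lmul n Q x))"
    by (rule preserves_comp[OF preserves_rmul[OF P] preserves_lmul[OF Q]])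
  have e: "ginv n (rmul n P (lmul n Q x)) 0 0 = (\<Sum>i<n. \<Sum>j<n. p i * ginv n x i j * q j)" for x
    using n by (simp add: ginv_rmul[OF P] ginv_lmul[OF Q] p0 q0 sum_distrib_left mult.assoc)
  have h: "hsq n (rmul n P (lmul n Q x)) = hsq n x" for x
    by (simp add: hsq_rmul[OF P] hsq_lmul[OF Q])
  show ?thesis using preserves_integral[OF pr F] by (simp add: e h)
qed

text \<open>
  By rotation invariance every entry may be replaced by the bilinear form in two normalised sign vectors,
  whose average over the signs is controlled by the Hilbert--Schmidt norm.
\<close>

lemma entry_moment:
  fixes t :: real
  assumes n: "0 < n" and k: "0 < k" and t: "0 < t" and ij: "i < n" "j < n"
  shows "(\<integral>x. (ginv n x i j) ^ (2 * k) * hs_cut n t x \<partial>gaussian_entries n) \<le> (khin k)\<^sup>2 * (5 * hs_const * t ^ (2 * k - 1)) / n ^ k"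
proof -
  let ?M = "gaussian_entries n"
  define F where "F y h = y ^ (2 * k) * of_bool (h \<le> t\<^sup>2 * n)" for y h :: real
  have gF: "y ^ (2 * k) * hs_cut n t x = F y (hsq n x)" for y x by (simp add: F_def hs_cut_def)
  have F: "(\<lambda>x. F (ginv n x 0 0) (hsq n x)) \<in> borel_measurable ?M"
    unfolding gF[symmetric] using n by measurable
  let ?I = "\<integral>x. F (ginv n x 0 0) (hsq n x) \<partial>?M"
  \<comment> \<open>With unit coordinate vectors the form is a single entry, so all entries have the
    same truncated moment \<open>?I\<close>.\<close>
  have inner: "(\<Sum>i'<n. \<Sum>j'<n. of_bool (i' = i) * ginv n x i' j' * of_bool (j' = j)) = ginv n x i j" for x
  proof -
    have "(\<Sum>i'<n. \<Sum>j'<n. of_bool (i' = i) * ginv n x i' j' * of_bool (j' = j))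
      = (\<Sum>i'<n. if i' = i then (\<Sum>j'<n. if j' = j then ginv n x i' j' else 0) else 0)"
      by (intro sum.cong refl) (auto intro!: sum.cong)
    then show ?thesis using ij by simp
  qed
  have "(\<Sum>l<n. (of_bool (l = m))\<^sup>2) = (1::real)" if "m < n" for m
  proof -
    have "(\<Sum>l<n. (of_bool (l = m))\<^sup>2) = (\<Sum>l<n. if l = m then 1 else (0::real))" by (intro sum.cong) auto
    then show ?thesis using that by simp
  qed
  then have "(\<integral>x. F (ginv n x i j) (hsq n x) \<partial>?M) = ?I"
    using bilinear_invariant[OF n, of "\<lambda>l. of_bool (l = i)" "\<lambda>l. of_bool (l = j)" F] F ij
    unfolding inner by blast
  moreover have "?I \<le> (khin k)\<^sup>2 * (5 * hs_const * t ^ (2 * k - 1)) / n ^ k"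
  proof -
    let ?b = "\<lambda>d e x. \<Sum>i<n. \<Sum>j<n. d i * ginv n x i j * e j"
    have mb: "(\<lambda>x. ?b d e x) \<in> borel_measurable ?M" for d e
      by (intro borel_measurable_sum borel_measurable_times measurable_ginv) auto
    have u: "(\<Sum>i<n. (d i / sqrt n)\<^sup>2) = 1" if d: "d \<in> signs n" for d
    proof -
      have "(\<Sum>j<n. (d j / sqrt n)\<^sup>2) = (\<Sum>j<n. 1 / n)"
        using d by (intro sum.cong refl) (simp add: power_divide power2_eq_square signs_square)
      also have "\<dots> = 1" using n by simp
      finally show ?thesis .
    qed
    \<comment> \<open>Each sign vector is divided by \<open>sqrt n\<close> to become a unit vector,
      which costs \<open>n\<close> in the form and \<open>n ^ (2 * k)\<close> in its moment.\<close>
    have E: "(\<integral>x. (?b d e x) ^ (2 * k) * hs_cut n t x \<partial>?M) = n ^ (2 * k) * ?I"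
      if de: "d \<in> signs n" "e \<in> signs n" for d e
    proof -
      have "(\<Sum>i<n. \<Sum>j<n. d i / sqrt n * ginv n x i j * (e j / sqrt n)) = ?b d e x / n" for x
        using n by (simp add: sum_divide_distrib field_simps)
      then have "(\<integral>x. F (?b d e x / n) (hsq n x) \<partial>?M) = ?I"
        using bilinear_invariant[OF n u[OF de(1)] u[OF de(2)] F] by simp
      moreover have "(?b d e x) ^ (2 * k) * hs_cut n t x = n ^ (2 * k) * F (?b d e x / n) (hsq n x)" for x
        unfolding gF[symmetric] using n by (simp add: power_divide)
      ultimately show ?thesis by simp
    qed
    have bb: "\<bar>(?b d e x) ^ (2 * k)\<bar> \<le> (n * n * (\<bar>t\<bar> * sqrt n)) ^ (2 * k)" if de: "d \<in> signs n" "e \<in> signs n" and h: "hsq n x \<le> t\<^sup>2 * n" for d e x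
    proof -
      have "\<bar>?b d e x\<bar> \<le> (\<Sum>i<n. \<bar>\<Sum>j<n. d i * ginv n x i j * e j\<bar>)" by (rule sum_abs)
      also have "\<dots> \<le> (\<Sum>i<n. \<Sum>j<n. \<bar>d i * ginv n x i j * e j\<bar>)" by (intro sum_mono sum_abs)
      also have "\<dots> \<le> (\<Sum>i<n. \<Sum>j<n. \<bar>t\<bar> * sqrt n)"
      proof (intro sum_mono)
        fix i j assume "i \<in> {..<n}" "j \<in> {..<n}"
        then have "\<bar>d i\<bar> = 1" "\<bar>e j\<bar> = 1" "\<bar>ginv n x i j\<bar> \<le> \<bar>t\<bar> * sqrt n"
          using signsD[OF de(1)] signsD[OF de(2)] ginv_abs_le[OF _ _ h] by fastforce+
        then show "\<bar>d i * ginv n x i j * e j\<bar> \<le> \<bar>t\<bar> * sqrt n" by (simp add: abs_mult)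
      qed
      finally have "\<bar>?b d e x\<bar> \<le> n * n * (\<bar>t\<bar> * sqrt n)" by (simp add: mult.assoc)
      then show ?thesis by (simp add: power_abs power_mono)
    qed
    have int: "integrable ?M (\<lambda>x. (?b d e x) ^ (2 * k) * hs_cut n t x)" if de: "d \<in> signs n" "e \<in> signs n" for d e
      by (rule integrable_hs_cut[OF _ bb[OF de]]) (intro borel_measurable_power mb)
    have "4 ^ n * (n ^ (2 * k) * ?I) = (\<Sum>d\<in>signs n. \<Sum>e\<in>signs n. \<integral>x. (?b d e x) ^ (2 * k) * hs_cut n t x \<partial>?M)"
      by (simp add: E power_mult_distrib[symmetric] mult.assoc[symmetric] del: power_mult_distrib) 
    also have "\<dots> = (\<integral>x. (\<Sum>d\<in>signs n. \<Sum>e\<in>signs n. (?b d e x) ^ (2 * k) * hs_cut n t x) \<partial>?M)"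
      using int by (subst Bochner_Integration.integral_sum; simp)+
    also have "\<dots> \<le> (\<integral>x. 4 ^ n * (khin k)\<^sup>2 * n ^ k * ((hsq n x / n) ^ k * hs_cut n t x) \<partial>?M)"
    proof (rule integral_mono)
      show "integrable ?M (\<lambda>x. \<Sum>d\<in>signs n. \<Sum>e\<in>signs n. (?b d e x) ^ (2 * k) * hs_cut n t x)"
        using int by (intro Bochner_Integration.integrable_sum) auto
      have "integrable ?M (\<lambda>x. (hsq n x / n) ^ k * hs_cut n t x)"
        by (rule integrable_hsq_power[OF n])
      then show "integrable ?M (\<lambda>x. 4 ^ n * (khin k)\<^sup>2 * n ^ k * ((hsq n x / n) ^ k * hs_cut n t x))"
        by (rule integrable_mult_right)
      fix x
      have "(\<Sum>d\<in>signs n. \<Sum>e\<in>signs n. (?b d e x) ^ (2 * k) * hs_cut n t x)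
          = (\<Sum>d\<in>signs n. \<Sum>e\<in>signs n. (?b d e x) ^ (2 * k)) * hs_cut n t x"
        by (simp add: sum_distrib_right)
      also have "\<dots> \<le> (4 ^ n * (khin k)\<^sup>2 * (hsq n x) ^ k) * hs_cut n t x"
        using khinchine_bilinear[OF k, where n=n and A="ginv n x"] hs_cut_01 unfolding hsq_def by (intro mult_right_mono) auto
      also have "\<dots> = 4 ^ n * (khin k)\<^sup>2 * n ^ k * ((hsq n x / n) ^ k * hs_cut n t x)"
        using n by (simp add: power_divide)
      finally show "(\<Sum>d\<in>signs n. \<Sum>e\<in>signs n. (?b d e x) ^ (2 * k) * hs_cut n t x)
        \<le> 4 ^ n * (khin k)\<^sup>2 * n ^ k * ((hsq n x / n) ^ k * hs_cut n t x)" .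
    qed
    also have "\<dots> = 4 ^ n * (khin k)\<^sup>2 * n ^ k * cut_moment n k t" by (simp add: cut_moment_def)
    also have "\<dots> \<le> 4 ^ n * (khin k)\<^sup>2 * n ^ k * (5 * hs_const * t ^ (2 * k - 1))"
      by (intro mult_left_mono cut_moment_bound n k t) simp
    finally have "4 ^ n * (n ^ (2 * k) * ?I) \<le> 4 ^ n * ((khin k)\<^sup>2 * n ^ k * (5 * hs_const * t ^ (2 * k - 1)))"
      by (simp only: mult.assoc)
    then have "n ^ (2 * k) * ?I \<le> (khin k)\<^sup>2 * n ^ k * (5 * hs_const * t ^ (2 * k - 1))"
      by (rule mult_left_le_imp_le) simp
    \<comment> \<open>The normalisation contributes \<open>n ^ (2 * k)\<close> and the norm only
      \<open>n ^ k\<close>; the difference is the gain \<open>1 / n ^ k\<close>.\<close>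
    moreover have "real n ^ (2 * k) = n ^ k * n ^ k" by (simp add: mult_2 power_add)
    ultimately have "n ^ k * (n ^ k * ?I) \<le> n ^ k * ((khin k)\<^sup>2 * (5 * hs_const * t ^ (2 * k - 1)))"
      by (simp only: mult_ac of_nat_power of_nat_mult)
    then have "n ^ k * ?I \<le> (khin k)\<^sup>2 * (5 * hs_const * t ^ (2 * k - 1))"
      by (rule mult_left_le_imp_le) (use n in simp)
    then show ?thesis using n by (simp add: pos_le_divide_eq mult.commute)
  qed
  ultimately show ?thesis unfolding gF by simp
qed

section \<open>Powers of the inverse\<close>

fun gpow :: "nat \<Rightarrow> (nat \<times> nat \<Rightarrow> real) \<Rightarrow> nat \<Rightarrow> nat \<Rightarrow> nat \<Rightarrow> real" where
  "gpow n x 0 i j = (if i = j then 1 else 0)"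
| "gpow n x (Suc k) i j = (\<Sum>l<n. gpow n x k i l * ginv n x l j)"

lemma gpow_pow_mat: "i < n \<Longrightarrow> j < n \<Longrightarrow> (inv_mat (gmat n x) ^\<^sub>m k) $$ (i, j) = gpow n x k i j"
proof (induction k arbitrary: j)
  case (Suc k)
  have c: "inv_mat (gmat n x) ^\<^sub>m k \<in> carrier_mat n n" by (intro pow_carrier_mat) simp
  have "(inv_mat (gmat n x) ^\<^sub>m Suc k) $$ (i, j) = (\<Sum>l<n. (inv_mat (gmat n x) ^\<^sub>m k) $$ (i, l) * inv_mat (gmat n x) $$ (l, j))"
    using Suc.prems c by (simp only: pow_mat.simps) (intro mat_mult_entry[where l=n], auto)
  then show ?case using Suc by (simp add: ginv_def)
next
  case 0
  have "dim_row (inv_mat (gmat n x)) = n" by (rule carrier_matD(1)[OF inv_mat_carrier[OF gmat_carrier(1)]])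
  then show ?case using 0 by simp
qed

lemma measurable_gpow [measurable]: "i < n \<Longrightarrow> j < n \<Longrightarrow> (\<lambda>x. gpow n x k i j) \<in> borel_measurable (gaussian_entries n)"
proof (induction k arbitrary: j)
  case (Suc k)
  then show ?case by (auto intro!: borel_measurable_sum borel_measurable_times measurable_ginv)
qed simp

section \<open>Path expansion of the powers and sign flips\<close>

definition index_lists :: "nat \<Rightarrow> nat \<Rightarrow> nat list set" where
  "index_lists n m = {xs. set xs \<subseteq> {..<n} \<and> length xs = m}"

lemma finite_index_lists [simp]: "finite (index_lists n m)"
  unfolding index_lists_def by (rule finite_lists_length_eq) simp

lemma index_lists_0: "index_lists n 0 = {[]}"
  by (auto simp: index_lists_def)

lemma sum_index_lists_Suc:
  fixes f :: "nat list \<Rightarrow> real"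
  shows "(\<Sum>xs\<in>index_lists n (Suc m). f xs) = (\<Sum>c<n. \<Sum>xs\<in>index_lists n m. f (c # xs))"
proof -
  have e: "index_lists n (Suc m) = (\<lambda>(c, xs). c # xs) ` ({..<n} \<times> index_lists n m)"
    by (auto simp: index_lists_def length_Suc_conv image_iff)
  have "(\<Sum>xs\<in>index_lists n (Suc m). f xs) = (\<Sum>p\<in>{..<n} \<times> index_lists n m. f (case p of (c, xs) \<Rightarrow> c # xs))"
    unfolding e by (subst sum.reindex) (auto simp: inj_on_def comp_def)
  then show ?thesis by (simp add: sum.cartesian_product case_prod_unfold)
qed

lemma sum_index_lists_prod: "(\<Sum>xs\<in>index_lists n m. prod_list (map e xs)) = (\<Sum>i<n. e i :: real) ^ m"
proof (induction m)
  case (Suc m)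
  have "(\<Sum>xs\<in>index_lists n (Suc m). prod_list (map e xs)) = (\<Sum>c<n. \<Sum>xs\<in>index_lists n m. e c * prod_list (map e xs))"
    by (simp add: sum_index_lists_Suc)
  also have "\<dots> = (\<Sum>c<n. e c * (\<Sum>i<n. e i) ^ m)" by (simp add: sum_distrib_left[symmetric] Suc)
  finally show ?case by (simp add: sum_distrib_right)
qed (simp add: index_lists_0)

text \<open>
  The inner indices of a path are listed from its end to its beginning, to match the recursion of \<open>gpow\<close>.
\<close>

fun edges :: "nat \<Rightarrow> nat list \<Rightarrow> nat \<Rightarrow> (nat \<times> nat) list" where
  "edges a [] b = [(a, b)]"
| "edges a (c # xs) b = (c, b) # edges a xs c"

lemma length_edges [simp]: "length (edges a xs b) = Suc (length xs)"
  by (induction xs arbitrary: b) auto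

lemma set_edges: "a < n \<Longrightarrow> b < n \<Longrightarrow> set xs \<subseteq> {..<n} \<Longrightarrow> set (edges a xs b) \<subseteq> {..<n} \<times> {..<n}"
  by (induction xs arbitrary: b) auto

definition path_weight :: "nat \<Rightarrow> (nat \<times> nat \<Rightarrow> real) \<Rightarrow> nat \<Rightarrow> nat list \<Rightarrow> nat \<Rightarrow> real" where
  "path_weight n x a xs b = prod_list (map (\<lambda>(i, j). ginv n x i j) (edges a xs b))"

lemma path_weight_simps: "path_weight n x a [] b = ginv n x a b" "path_weight n x a (c # xs) b = ginv n x c b * path_weight n x a xs c"
  by (simp_all add: path_weight_def)

lemma gpow_paths: "a < n \<Longrightarrow> b < n \<Longrightarrow> gpow n x (Suc m) a b = (\<Sum>xs\<in>index_lists n m. path_weight n x a xs b)"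
proof (induction m arbitrary: b)
  case 0
  then show ?case by (simp add: index_lists_0 path_weight_simps if_distrib if_distribR cong: if_cong)
next
  case (Suc m)
  have "gpow n x (Suc (Suc m)) a b = (\<Sum>l<n. gpow n x (Suc m) a l * ginv n x l b)"
    by (rule gpow.simps(2))
  also have "\<dots> = (\<Sum>l<n. \<Sum>xs\<in>index_lists n m. path_weight n x a (l # xs) b)"
    using Suc by (intro sum.cong refl) (simp add: sum_distrib_left path_weight_simps mult.commute del: gpow.simps)
  finally show ?case by (simp only: sum_index_lists_Suc)
qed

lemma ginv_diag:
  assumes e: "e \<in> signs n" and ij: "i < n" "j < n"
  shows "ginv n (lmul n (diagm n e) x) i j = e j * ginv n x i j"
proof -
  have D: "diagm n e \<in> gauss_rot n" by (rule diagm_gauss_rot) (rule signsD[OF e])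
  have "ginv n (lmul n (diagm n e) x) i j = (\<Sum>l<n. diagm n e $$ (j, l) * ginv n x i l)"
    using ij by (simp add: ginv_lmul[OF D] mult.commute)
  then show ?thesis using ij by (simp add: diagm_sum)
qed

text \<open>Flipping row \<open>j\<close> of the matrix flips column \<open>j\<close> of the
  inverse, so each edge picks up the sign of its end. Every inner index and \<open>b\<close> is the
  end of exactly one edge (counted along the path), and the start \<open>a\<close> contributes no
  sign.\<close>

lemma path_weight_diag:
  assumes e: "e \<in> signs n"
  shows "a < n \<Longrightarrow> b < n \<Longrightarrow> set xs \<subseteq> {..<n} \<Longrightarrow>
    path_weight n (lmul n (diagm n e) x) a xs b = e b * prod_list (map e xs) * path_weight n x a xs b"
proof (induction xs arbitrary: b)
  case Nil
  then show ?case by (simp add: path_weight_simps ginv_diag[OF e])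
next
  case (Cons c xs)
  then show ?case by (simp add: path_weight_simps ginv_diag[OF e])
qed

definition hsq_pow :: "nat \<Rightarrow> nat \<Rightarrow> (nat \<times> nat \<Rightarrow> real) \<Rightarrow> real" where
  "hsq_pow n k x = (\<Sum>i<n. \<Sum>j<n. (gpow n x k i j)\<^sup>2)"

lemma hsq_pow_nonneg: "0 \<le> hsq_pow n k x"
  by (simp add: hsq_pow_def sum_nonneg)

lemma measurable_hsq_pow [measurable]: "hsq_pow n k \<in> borel_measurable (gaussian_entries n)"
  unfolding hsq_pow_def by (intro borel_measurable_sum borel_measurable_power measurable_gpow) auto

text \<open>The sign of the endpoint \<open>b\<close> is common to all paths and disappears in the
  square; only the inner indices keep theirs.\<close>

lemma hsq_pow_diag:
  assumes e: "e \<in> signs n"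
  shows "hsq_pow n (Suc m) (lmul n (diagm n e) x)
    = (\<Sum>a<n. \<Sum>b<n. \<Sum>xs\<in>index_lists n m. \<Sum>ys\<in>index_lists n m. prod_list (map e (xs @ ys)) * (path_weight n x a xs b * path_weight n x a ys b))"
  unfolding hsq_pow_def
proof (rule sum.cong[OF refl], rule sum.cong[OF refl])
  fix a b assume "a \<in> {..<n}" "b \<in> {..<n}"
  then have ab: "a < n" "b < n" by auto
  have "gpow n (lmul n (diagm n e) x) (Suc m) a b = (\<Sum>xs\<in>index_lists n m. e b * (prod_list (map e xs) * path_weight n x a xs b))"
    unfolding gpow_paths[OF ab] using ab path_weight_diag[OF e] by (intro sum.cong refl) (simp add: index_lists_def mult.assoc)
  also have "\<dots> = e b * (\<Sum>xs\<in>index_lists n m. prod_list (map e xs) * path_weight n x a xs b)" by (simp add: sum_distrib_left)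
  finally have "(gpow n (lmul n (diagm n e) x) (Suc m) a b)\<^sup>2
      = (e b * e b) * (\<Sum>xs\<in>index_lists n m. prod_list (map e xs) * path_weight n x a xs b)\<^sup>2"
    by (simp add: power2_eq_square mult_ac)
  also have "e b * e b = 1" using signs_square[OF e ab(2)] .
  finally show "(gpow n (lmul n (diagm n e) x) (Suc m) a b)\<^sup>2
    = (\<Sum>xs\<in>index_lists n m. \<Sum>ys\<in>index_lists n m. prod_list (map e (xs @ ys)) * (path_weight n x a xs b * path_weight n x a ys b))"
    by (simp add: power2_eq_square sum_product mult_ac)
qed

text \<open>Both sides are compared with the power of the largest factor.\<close>

lemma prod_list_le_sum_power:
  assumes "\<And>z. z \<in> set zs \<Longrightarrow> 0 \<le> z" "zs \<noteq> []"
  shows "prod_list zs \<le> (\<Sum>z\<leftarrow>zs. (z::real) ^ length zs)"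
proof -
  define M where "M = Max (set zs)"
  have M: "M \<in> set zs" "\<And>z. z \<in> set zs \<Longrightarrow> z \<le> M" using assms(2) by (auto simp: M_def)
  have "\<forall>z\<in>set ys. 0 \<le> z \<and> z \<le> M \<Longrightarrow> 0 \<le> prod_list ys \<and> prod_list ys \<le> M ^ length ys" for ys
    using assms(1)[OF M(1)] by (induction ys) (auto intro!: mult_mono)
  then have "prod_list zs \<le> M ^ length zs" using assms(1) M(2) by blast
  also have "\<dots> \<le> (\<Sum>z\<leftarrow>zs. z ^ length zs)"
    using assms(1) M(1) by (intro member_le_sum_list) auto
  finally show ?thesis .
qed

lemma path_weight_square_le:
  "(path_weight n x a xs b)\<^sup>2 \<le> (\<Sum>p\<leftarrow>edges a xs b. (ginv n x (fst p) (snd p)) ^ (2 * Suc (length xs)))"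
proof -
  let ?zs = "map (\<lambda>p. (ginv n x (fst p) (snd p))\<^sup>2) (edges a xs b)"
  have "(path_weight n x a xs b)\<^sup>2 = prod_list ?zs"
    unfolding path_weight_def by (induction xs arbitrary: b) (auto simp: power_mult_distrib)
  also have "\<dots> \<le> (\<Sum>z\<leftarrow>?zs. z ^ length ?zs)"
    by (rule prod_list_le_sum_power) (auto simp: edges.simps elim: edges.elims intro: )
  also have "\<dots> = (\<Sum>p\<leftarrow>edges a xs b. (ginv n x (fst p) (snd p)) ^ (2 * Suc (length xs)))"
    by (simp only: length_map length_edges map_map comp_def power_mult)
  finally show ?thesis .
qed

lemma measurable_path_weight:
  assumes "a < n" "b < n" "set xs \<subseteq> {..<n}"
  shows "(\<lambda>x. path_weight n x a xs b) \<in> borel_measurable (gaussian_entries n)"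
  using assms
proof (induction xs arbitrary: b)
  case (Cons c xs)
  then show ?case unfolding path_weight_simps by (intro borel_measurable_times measurable_ginv) auto
qed (simp add: path_weight_simps)

lemma path_weight_abs_le:
  fixes t :: real
  assumes h: "hsq n x \<le> t\<^sup>2 * n"
  shows "a < n \<Longrightarrow> b < n \<Longrightarrow> set xs \<subseteq> {..<n} \<Longrightarrow> \<bar>path_weight n x a xs b\<bar> \<le> (\<bar>t\<bar> * sqrt n) ^ Suc (length xs)"
proof (induction xs arbitrary: b)
  case Nil
  then show ?case using ginv_abs_le[OF _ _ h] by (simp add: path_weight_simps)
next
  case (Cons c xs)
  then have "\<bar>path_weight n x a xs c\<bar> \<le> (\<bar>t\<bar> * sqrt n) ^ Suc (length xs)" "\<bar>ginv n x c b\<bar> \<le> \<bar>t\<bar> * sqrt n"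
    using ginv_abs_le[OF _ _ h] by auto
  then have "\<bar>ginv n x c b\<bar> * \<bar>path_weight n x a xs c\<bar> \<le> (\<bar>t\<bar> * sqrt n) * (\<bar>t\<bar> * sqrt n) ^ Suc (length xs)"
    by (intro mult_mono) auto
  then show ?case by (simp add: path_weight_simps abs_mult)
qed

text \<open>A bound that is uniform over all pairs of paths, however often edges repeat. By
  \<open>2 * u * v \<le> u ^ 2 + v ^ 2\<close> the two paths may be taken equal, and the square of a
  path weight is at most the sum of the powers of order \<open>2 * k\<close> of its \<open>k\<close>
  edges, to which \<open>entry_moment\<close> applies.\<close>

lemma path_weight_moment:
  fixes t :: real
  assumes n: "0 < n" and t: "0 < t" and ab: "a < n" "b < n" and xs: "xs \<in> index_lists n m" and ys: "ys \<in> index_lists n m"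
    and k_def: "k = Suc m"
  shows "(\<integral>x. (path_weight n x a xs b * path_weight n x a ys b) * hs_cut n t x \<partial>gaussian_entries n)
    \<le> k * ((khin k)\<^sup>2 * (5 * hs_const * t ^ (2 * k - 1)) / n ^ k) \<and>
    integrable (gaussian_entries n) (\<lambda>x. (path_weight n x a xs b * path_weight n x a ys b) * hs_cut n t x)"
proof -
  let ?M = "gaussian_entries n"
  let ?B = "(khin k)\<^sup>2 * (5 * hs_const * t ^ (2 * k - 1)) / n ^ k"
  have L: "set xs \<subseteq> {..<n}" "length xs = m" "set ys \<subseteq> {..<n}" "length ys = m"
    using xs ys by (auto simp: index_lists_def)
  have intp: "integrable ?M (\<lambda>x. (path_weight n x a us b * path_weight n x a vs b) * hs_cut n t x)"
    if "us \<in> index_lists n m" "vs \<in> index_lists n m" for us vs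
  proof (rule integrable_hs_cut)
    have us: "set us \<subseteq> {..<n}" "length us = m" "set vs \<subseteq> {..<n}" "length vs = m"
      using that by (auto simp: index_lists_def)
    show "(\<lambda>x. path_weight n x a us b * path_weight n x a vs b) \<in> borel_measurable ?M"
      by (intro borel_measurable_times measurable_path_weight ab us)
    fix x assume h: "hsq n x \<le> t\<^sup>2 * n"
    show "\<bar>path_weight n x a us b * path_weight n x a vs b\<bar> \<le> (\<bar>t\<bar> * sqrt n) ^ Suc m * (\<bar>t\<bar> * sqrt n) ^ Suc m"
      unfolding abs_mult using path_weight_abs_le[OF h ab us(1)] path_weight_abs_le[OF h ab us(3)] us
      by (intro mult_mono) auto
  qed
  have inte: "integrable ?M (\<lambda>x. (ginv n x i j) ^ (2 * k) * hs_cut n t x)" if "i < n" "j < n" for i j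
  proof (rule integrable_hs_cut)
    show "(\<lambda>x. (ginv n x i j) ^ (2 * k)) \<in> borel_measurable ?M" using that by measurable
    fix x assume h: "hsq n x \<le> t\<^sup>2 * n"
    show "\<bar>(ginv n x i j) ^ (2 * k)\<bar> \<le> (\<bar>t\<bar> * sqrt n) ^ (2 * k)"
      unfolding power_abs using ginv_abs_le[OF that h] by (intro power_mono) auto
  qed
  have sq: "(\<integral>x. (path_weight n x a us b * path_weight n x a us b) * hs_cut n t x \<partial>?M) \<le> k * ?B" if us: "us \<in> index_lists n m" for us
  proof -
    have U: "set us \<subseteq> {..<n}" "length us = m" using us by (auto simp: index_lists_def)
    let ?E = "edges a us b"
    have E: "set ?E \<subseteq> {..<n} \<times> {..<n}" by (rule set_edges[OF ab U(1)])
    have g: "integrable ?M (\<lambda>x. (\<Sum>p\<leftarrow>ps. (ginv n x (fst p) (snd p)) ^ (2 * k)) * hs_cut n t x) \<and>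
      (\<integral>x. (\<Sum>p\<leftarrow>ps. (ginv n x (fst p) (snd p)) ^ (2 * k)) * hs_cut n t x \<partial>?M) \<le> length ps * ?B"
      if "set ps \<subseteq> {..<n} \<times> {..<n}" for ps
      using that
    proof (induction ps)
      case (Cons p ps)
      then have p: "fst p < n" "snd p < n" by auto
      note IH = Cons.IH[OF subset_trans[OF _ Cons.prems]]
      have i1: "integrable ?M (\<lambda>x. (\<Sum>p\<leftarrow>ps. (ginv n x (fst p) (snd p)) ^ (2 * k)) * hs_cut n t x)"
        and i2: "(\<integral>x. (\<Sum>p\<leftarrow>ps. (ginv n x (fst p) (snd p)) ^ (2 * k)) * hs_cut n t x \<partial>?M) \<le> length ps * ?B"
        using Cons by auto
      have e: "(\<integral>x. (ginv n x (fst p) (snd p)) ^ (2 * k) * hs_cut n t x \<partial>?M) \<le> ?B"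
        by (rule entry_moment[OF n _ t p]) (simp add: k_def)
      have s: "(\<lambda>x. (\<Sum>p\<leftarrow>p # ps. (ginv n x (fst p) (snd p)) ^ (2 * k)) * hs_cut n t x)
        = (\<lambda>x. (ginv n x (fst p) (snd p)) ^ (2 * k) * hs_cut n t x + (\<Sum>p\<leftarrow>ps. (ginv n x (fst p) (snd p)) ^ (2 * k)) * hs_cut n t x)"
        by (simp add: distrib_right)
      have "length (p # ps) * ?B = ?B + length ps * ?B"
        by (simp only: length_Cons of_nat_Suc distrib_right mult_1)
      with add_mono[OF e i2] show ?case
        unfolding s using i1 inte[OF p] by (simp only: Bochner_Integration.integral_add Bochner_Integration.integrable_add simp_thms)
    qed simp
    have "(\<integral>x. (path_weight n x a us b * path_weight n x a us b) * hs_cut n t x \<partial>?M)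
        \<le> (\<integral>x. (\<Sum>p\<leftarrow>?E. (ginv n x (fst p) (snd p)) ^ (2 * k)) * hs_cut n t x \<partial>?M)"
      using g[OF E] intp[OF us us] hs_cut_01 path_weight_square_le[of n _ a us b] U
      by (intro integral_mono mult_right_mono) (auto simp: k_def power2_eq_square)
    also have "\<dots> \<le> length ?E * ?B" using g[OF E] by simp
    also have "length ?E = k" using U by (simp add: k_def)
    finally show ?thesis .
  qed
  have "(\<integral>x. (path_weight n x a xs b * path_weight n x a ys b) * hs_cut n t x \<partial>?M)
      \<le> (\<integral>x. 1 / 2 * ((path_weight n x a xs b * path_weight n x a xs b) * hs_cut n t x) + 1 / 2 * ((path_weight n x a ys b * path_weight n x a ys b) * hs_cut n t x) \<partial>?M)"
  proof (intro integral_mono Bochner_Integration.integrable_add integrable_mult_right intp xs ys)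
    fix x
    have "2 * (path_weight n x a xs b * path_weight n x a ys b) \<le> path_weight n x a xs b * path_weight n x a xs b + path_weight n x a ys b * path_weight n x a ys b"
      using sum_squares_bound[of "path_weight n x a xs b" "path_weight n x a ys b"] by (simp add: power2_eq_square)
    then have "(path_weight n x a xs b * path_weight n x a ys b) \<le> 1 / 2 * (path_weight n x a xs b * path_weight n x a xs b) + 1 / 2 * (path_weight n x a ys b * path_weight n x a ys b)"
      by simp
    from mult_right_mono[OF this hs_cut_01(1)[of n t x]]
    show "(path_weight n x a xs b * path_weight n x a ys b) * hs_cut n t x
      \<le> 1 / 2 * ((path_weight n x a xs b * path_weight n x a xs b) * hs_cut n t x) + 1 / 2 * ((path_weight n x a ys b * path_weight n x a ys b) * hs_cut n t x)"
      by (simp add: algebra_simps)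
  qed
  also have "\<dots> = 1 / 2 * (\<integral>x. (path_weight n x a xs b * path_weight n x a xs b) * hs_cut n t x \<partial>?M) + 1 / 2 * (\<integral>x. (path_weight n x a ys b * path_weight n x a ys b) * hs_cut n t x \<partial>?M)"
    using intp[OF xs xs] intp[OF ys ys]
    by (subst Bochner_Integration.integral_add) (auto intro!: integrable_mult_right simp del: times_divide_eq_left)
  also have "\<dots> \<le> 1 / 2 * (k * ?B) + 1 / 2 * (k * ?B)"
    by (intro add_mono mult_left_mono sq xs ys) auto
  also have "\<dots> = k * ?B"
  proof -
    have "1 / 2 * c + 1 / 2 * c = c" for c :: real by simp
    then show ?thesis .
  qed
  finally show ?thesis using intp[OF xs ys] unfolding of_nat_power by (rule conjI)
qed

text \<open>The number \<open>k\<close> of edges, the constant of \<open>entry_moment\<close>, and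
  \<open>khin (k - 1)\<close> for the sign average over the \<open>k - 1\<close> inner indices of
  each of two paths.\<close>

definition pow_const :: "nat \<Rightarrow> real" where "pow_const k = k * (khin k)\<^sup>2 * 5 * hs_const * khin (k - 1)"

text \<open>
  Flipping the signs of the rows of the matrix multiplies a path by the signs of its inner indices. The sign
  average of a product of two paths is non-negative, so only the mixed moments have to be bounded uniformly; the remaining sum of
  averages over all pairs of paths is itself an even moment of \<open>\<Sum>i<n. e i\<close>.
\<close>

lemma hsq_pow_moment:
  fixes t :: real and m :: nat
  assumes n: "0 < n" and t: "0 < t"
  defines "k \<equiv> Suc m"
  shows "integrable (gaussian_entries n) (\<lambda>x. hsq_pow n k x * hs_cut n t x)"
    and "(\<integral>x. hsq_pow n k x * hs_cut n t x \<partial>gaussian_entries n) \<le> pow_const k * t ^ (2 * k - 1) * n"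
proof -
  let ?M = "gaussian_entries n"
  let ?B = "k * ((khin k)\<^sup>2 * (5 * hs_const * t ^ (2 * k - 1)) / n ^ k)"
  have B0: "0 \<le> ?B" using hs_const_ge t by (auto intro!: divide_nonneg_nonneg mult_nonneg_nonneg)
  let ?w = "\<lambda>a b xs ys x. (path_weight n x a xs b * path_weight n x a ys b) * hs_cut n t x"
  have int: "integrable ?M (?w a b xs ys)" and mom: "(\<integral>x. ?w a b xs ys x \<partial>?M) \<le> ?B"
    if "a < n" "b < n" "xs \<in> index_lists n m" "ys \<in> index_lists n m" for a b xs ys
    using path_weight_moment[OF n t that, of k] by (simp_all add: k_def)
  have eq: "hsq_pow n k (lmul n (diagm n e) x) * hs_cut n t (lmul n (diagm n e) x)
      = (\<Sum>a<n. \<Sum>b<n. \<Sum>xs\<in>index_lists n m. \<Sum>ys\<in>index_lists n m. prod_list (map e (xs @ ys)) * ?w a b xs ys x)"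
    if e: "e \<in> signs n" for e x
  proof -
    have D: "diagm n e \<in> gauss_rot n" by (rule diagm_gauss_rot) (rule signsD[OF e])
    show ?thesis unfolding k_def hsq_pow_diag[OF e] hs_cut_lmul[OF D]
      by (simp add: sum_distrib_right mult.assoc)
  qed
  have Ie: "integrable ?M (\<lambda>x. \<Sum>a<n. \<Sum>b<n. \<Sum>xs\<in>index_lists n m. \<Sum>ys\<in>index_lists n m. prod_list (map e (xs @ ys)) * ?w a b xs ys x)"
    for e :: "nat \<Rightarrow> real"
    by (intro Bochner_Integration.integrable_sum integrable_mult_right int) auto
  have Ev: "(\<integral>x. hsq_pow n k x * hs_cut n t x \<partial>?M)
      = (\<Sum>a<n. \<Sum>b<n. \<Sum>xs\<in>index_lists n m. \<Sum>ys\<in>index_lists n m. prod_list (map e (xs @ ys)) * (\<integral>x. ?w a b xs ys x \<partial>?M))"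
    if e: "e \<in> signs n" for e
  proof -
    have D: "diagm n e \<in> gauss_rot n" by (rule diagm_gauss_rot) (rule signsD[OF e])
    have "(\<integral>x. hsq_pow n k x * hs_cut n t x \<partial>?M) = (\<integral>x. hsq_pow n k (lmul n (diagm n e) x) * hs_cut n t (lmul n (diagm n e) x) \<partial>?M)"
      by (rule preserves_integral[OF preserves_lmul[OF D], symmetric]) measurable
    also have "\<dots> = (\<integral>x. (\<Sum>a<n. \<Sum>b<n. \<Sum>xs\<in>index_lists n m. \<Sum>ys\<in>index_lists n m. prod_list (map e (xs @ ys)) * ?w a b xs ys x) \<partial>?M)"
      by (simp only: eq[OF e])
    also have "\<dots> = (\<Sum>a<n. \<Sum>b<n. \<Sum>xs\<in>index_lists n m. \<Sum>ys\<in>index_lists n m. prod_list (map e (xs @ ys)) * (\<integral>x. ?w a b xs ys x \<partial>?M))"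
      by (rule has_bochner_integral_integral_eq)
         (intro has_bochner_integral_sum has_bochner_integral_mult_right has_bochner_integral_integrable int, auto)
    finally show ?thesis .
  qed
  \<comment> \<open>The trivial sign vector: for it the expansion of the flipped matrix is that of
    the matrix itself, which yields integrability.\<close>
  define e1 :: "nat \<Rightarrow> real" where "e1 = (\<lambda>i\<in>{..<n}. 1)"
  have e1: "e1 \<in> signs n" by (auto simp: e1_def signs_def)
  have D1: "diagm n e1 = 1\<^sub>m n" by (intro eq_matI) (auto simp: diagm_def e1_def)
  show "integrable ?M (\<lambda>x. hsq_pow n k x * hs_cut n t x)"
  proof -
    have "hsq_pow n k x * hs_cut n t x = (\<Sum>a<n. \<Sum>b<n. \<Sum>xs\<in>index_lists n m. \<Sum>ys\<in>index_lists n m. prod_list (map e1 (xs @ ys)) * ?w a b xs ys x)"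
      if x: "x \<in> space ?M" for x
    proof -
      \<comment> \<open>The sample space enters here: off the index square \<open>lmul\<close>
        returns \<open>undefined\<close>, as do its points.\<close>
      have "lmul n (1\<^sub>m n) x = x"
      proof
        fix p
        have "(\<Sum>l<n. (1\<^sub>m n :: real mat) $$ (i, l) * x (l, j)) = x (i, j)" if "i < n" for i j
        proof -
          have "(\<Sum>l<n. (1\<^sub>m n :: real mat) $$ (i, l) * x (l, j)) = (\<Sum>l<n. if l = i then x (l, j) else 0)"
            using that by (intro sum.cong) auto
          then show ?thesis using that by simp
        qed
        then show "lmul n (1\<^sub>m n) x p = x p"
          using x by (cases p) (auto simp: lmul_def space_gaussian_entries)
      qed
      then show ?thesis using eq[OF e1, of x] by (simp add: D1)
    qed
    then have "integrable ?M (\<lambda>x. hsq_pow n k x * hs_cut n t x) \<longleftrightarrow> integrable ?M (\<lambda>x. \<Sum>a<n. \<Sum>b<n.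
        \<Sum>xs\<in>index_lists n m. \<Sum>ys\<in>index_lists n m. prod_list (map e1 (xs @ ys)) * ?w a b xs ys x)"
      by (intro Bochner_Integration.integrable_cong refl)
    then show ?thesis using Ie[of e1] by blast
  qed
  have "2 ^ n * (\<integral>x. hsq_pow n k x * hs_cut n t x \<partial>?M)
     = (\<Sum>e\<in>signs n. \<Sum>a<n. \<Sum>b<n. \<Sum>xs\<in>index_lists n m. \<Sum>ys\<in>index_lists n m. prod_list (map e (xs @ ys)) * (\<integral>x. ?w a b xs ys x \<partial>?M))"
  proof -
    have "2 ^ n * (\<integral>x. hsq_pow n k x * hs_cut n t x \<partial>?M) = (\<Sum>e\<in>signs n. \<integral>x. hsq_pow n k x * hs_cut n t x \<partial>?M)" by simp
    also have "\<dots> = (\<Sum>e\<in>signs n. \<Sum>a<n. \<Sum>b<n. \<Sum>xs\<in>index_lists n m. \<Sum>ys\<in>index_lists n m.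
        prod_list (map e (xs @ ys)) * (\<integral>x. ?w a b xs ys x \<partial>?M))"
      by (rule sum.cong[OF refl]) (rule Ev)
    finally show ?thesis .
  qed
  also have "\<dots> = (\<Sum>a<n. \<Sum>b<n. \<Sum>xs\<in>index_lists n m. \<Sum>ys\<in>index_lists n m. (\<Sum>e\<in>signs n. prod_list (map e (xs @ ys))) * (\<integral>x. ?w a b xs ys x \<partial>?M))"
    by (simp only: sum.swap[where A="signs n"] sum_distrib_right)
  also have "\<dots> \<le> (\<Sum>a<n. \<Sum>b<n. \<Sum>xs\<in>index_lists n m. \<Sum>ys\<in>index_lists n m. (\<Sum>e\<in>signs n. prod_list (map e (xs @ ys))) * ?B)"
    by (intro sum_mono mult_left_mono mom sum_signs_prod_list_nonneg) (auto simp: index_lists_def)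
  also have "\<dots> = n * n * ?B * (\<Sum>xs\<in>index_lists n m. \<Sum>ys\<in>index_lists n m. \<Sum>e\<in>signs n. prod_list (map e (xs @ ys)))"
  proof -
    have "(\<Sum>a<n. \<Sum>b<n. \<Sum>xs\<in>index_lists n m. \<Sum>ys\<in>index_lists n m. f xs ys * c)
        = n * n * c * (\<Sum>xs\<in>index_lists n m. \<Sum>ys\<in>index_lists n m. f xs ys)" for f and c :: real
      by (simp add: sum_distrib_right[symmetric])
    then show ?thesis .
  qed
  also have "(\<Sum>xs\<in>index_lists n m. \<Sum>ys\<in>index_lists n m. \<Sum>e\<in>signs n. prod_list (map e (xs @ ys)))
      = (\<Sum>e\<in>signs n. \<Sum>xs\<in>index_lists n m. \<Sum>ys\<in>index_lists n m. prod_list (map e xs) * prod_list (map e ys))"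
    by (simp only: sum.swap[where A="signs n"] map_append prod_list.append)
  also have "\<dots> = (\<Sum>e\<in>signs n. (\<Sum>i<n. 1 * e i) ^ (2 * m))"
    by (simp add: sum_product[symmetric] sum_index_lists_prod mult_2 power_add)
  also have "n * n * ?B * \<dots> \<le> n * n * ?B * (2 ^ n * khin m * (\<Sum>i<n. 1\<^sup>2) ^ m)"
    by (rule mult_left_mono[OF khinchine], rule mult_nonneg_nonneg[OF _ B0]) simp
  \<comment> \<open>The powers of \<open>n\<close> are 2 from the endpoints, \<open>-k\<close> from
    \<open>?B\<close> and \<open>m = k - 1\<close> from the sign moment.\<close>
  also have "\<dots> = 2 ^ n * (pow_const k * t ^ (2 * k - 1) * n)"
    using n by (simp add: pow_const_def k_def field_simps)
  finally show "(\<integral>x. hsq_pow n k x * hs_cut n t x \<partial>?M) \<le> pow_const k * t ^ (2 * k - 1) * n"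
    by (rule mult_left_le_imp_le) simp
qed

definition tail_const :: "nat \<Rightarrow> real" where "tail_const k = hs_const + pow_const k"

text \<open>Either the truncation at \<open>t\<close> fails, with probability at most
  \<open>hs_const / t\<close>, or Markov's inequality applies to the truncated moment;
  \<open>tail_const\<close> adds the two contributions.\<close>

lemma hsq_pow_tail:
  fixes t :: real
  assumes n: "0 < n" and t: "0 < t" and k: "0 < k"
  shows "measure (gaussian_entries n) {x\<in>space (gaussian_entries n). t ^ (2 * k) * n \<le> hsq_pow n k x} \<le> tail_const k / t"
proof -
  let ?M = "gaussian_entries n"
  obtain m where m: "k = Suc m" using k by (cases k) auto
  let ?A = "{x\<in>space ?M. t ^ (2 * k) * n \<le> hsq_pow n k x}"
  let ?B = "{x\<in>space ?M. t\<^sup>2 * n \<le> hsq n x}"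
  have sA: "?A \<in> sets ?M" and sB: "?B \<in> sets ?M" by measurable
  define T where "T = t ^ (2 * k) * n"
  have T: "0 < T" using t n by (simp add: T_def)
  have pointwise: "indicator ?A x \<le> indicator ?B x + 1 / T * (hsq_pow n k x * hs_cut n t x)" if "x \<in> space ?M" for x
  proof (cases "x \<in> ?A \<and> x \<notin> ?B")
    case True
    then have "hsq n x \<le> t\<^sup>2 * n" "T \<le> hsq_pow n k x" using that by (auto simp: T_def)
    then show ?thesis using True T by (simp add: hs_cut_def field_simps)
  next
    case False
    moreover have "0 \<le> 1 / T * (hsq_pow n k x * hs_cut n t x)"
      using T hsq_pow_nonneg hs_cut_01 by (intro mult_nonneg_nonneg) auto
    ultimately show ?thesis by (auto simp: indicator_def)
  qed
  note hm = hsq_pow_moment[OF n t, of m, folded m]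
  have "measure ?M ?A = (\<integral>x. indicator ?A x \<partial>?M)" using sA by simp
  also have "\<dots> \<le> (\<integral>x. indicator ?B x + 1 / T * (hsq_pow n k x * hs_cut n t x) \<partial>?M)"
    using sA sB by (intro integral_mono pointwise Bochner_Integration.integrable_add integrable_mult_right hm)
      (auto intro!: integrable_real_indicator simp: ge.emeasure_eq_measure)
  also have "\<dots> = measure ?M ?B + 1 / T * (\<integral>x. hsq_pow n k x * hs_cut n t x \<partial>?M)"
    using sB hm(1) by (subst Bochner_Integration.integral_add)
      (auto intro!: integrable_real_indicator integrable_mult_right simp: ge.emeasure_eq_measure)
  also have "\<dots> \<le> hs_const / t + 1 / T * (pow_const k * t ^ (2 * k - 1) * n)"
    using T by (intro add_mono hsq_tail[OF n t] mult_left_mono hm(2)) auto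
  also have "1 / T * (pow_const k * t ^ (2 * k - 1) * n) = pow_const k / t"
  proof -
    have "t ^ (2 * k) = t * t ^ (2 * k - 1)" using k by (cases k) auto
    then show ?thesis using t n by (simp add: T_def field_simps)
  qed
  finally show ?thesis by (simp add: tail_const_def add_divide_distrib)
qed

section \<open>Singular Gaussian matrices\<close>

lemma cofactor_corner: "cofactor (gmat (Suc m) x) m m = det (gmat m x)"
proof -
  have "mat_delete (gmat (Suc m) x) m m = gmat m x"
    by (intro eq_matI) (auto simp: mat_delete_def)
  then show ?thesis by (simp add: cofactor_def)
qed

text \<open>Induction over the leading minors. Given the other rows, the minor of size
  \<open>Suc m\<close> is a linear form in row \<open>m\<close> whose coefficient at place
  \<open>m\<close> is the previous minor. Where that one is not 0, the form is a non-degenerate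
  Gaussian variable and hits 0 with probability 0.\<close>

lemma det_minor_null:
  "m \<le> n \<Longrightarrow> measure (gaussian_entries n) {x\<in>space (gaussian_entries n). det (gmat m x) = 0} = 0"
proof (induction m)
  case 0
  have "det (gmat 0 x) = 1" for x using det_dim_zero[OF gmat_carrier(1)] .
  then show ?case by simp
next
  case (Suc m)
  then have m: "m < n" by simp
  let ?M = "gaussian_entries n"
  note [measurable] = measurable_det_minor[OF less_imp_le[OF m]] measurable_det_minor[OF Suc.prems]
  let ?P = "\<lambda>x. det (gmat (Suc m) x) = 0 \<and> det (gmat m x) \<noteq> 0"
  have s: "{x\<in>space ?M. ?P x} \<in> sets ?M"
    "{x\<in>space ?M. det (gmat m x) = 0} \<in> sets ?M"
    by measurable
  have "measure ?M {x\<in>space ?M. ?P x} \<le> 0"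
  proof (rule prob_row_le[OF m s(1)])
    fix x :: "nat \<times> nat \<Rightarrow> real"
    let ?J = "gauss (rowi n m)"
    let ?z = "\<lambda>y. merge (other_rows n m) (rowi n m) (x, y)"
    \<comment> \<open>Extended by 0 beyond the minor, so that the law of the full row of length
      \<open>n\<close> can be used.\<close>
    define C where "C j = (if j \<le> m then cofactor (gmat (Suc m) x) m j else 0)" for j
    define N where "N = (\<Sum>j<n. (C j)\<^sup>2)"
    have sub: "{..<Suc m} \<subseteq> {..<n}" using m by auto
    have cof: "cofactor (gmat (Suc m) (?z y)) m j = C j" if "j < Suc m" for y j
    proof -
      have "cofactor (gmat (Suc m) (?z y)) m j = cofactor (gmat (Suc m) x) m j"
        using m that by (intro cofactor_row_cong) (auto simp: merge_def)
      then show ?thesis using that by (simp add: C_def)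
    qed
    have det: "det (gmat (Suc m) (?z y)) = (\<Sum>j<n. y (m, j) * C j)" for y
    proof -
      have z: "?z y (m, j) = y (m, j)" if "j < Suc m" for j using that m by (simp add: merge_def)
      have "det (gmat (Suc m) (?z y)) = (\<Sum>j<Suc m. ?z y (m, j) * cofactor (gmat (Suc m) (?z y)) m j)"
        by (rule det_expand_row) simp
      also have "\<dots> = (\<Sum>j<Suc m. y (m, j) * C j)"
        by (rule sum.cong[OF refl]) (simp add: cof z del: sum.lessThan_Suc)
      also have "\<dots> = (\<Sum>j<n. y (m, j) * C j)"
        using sub by (intro sum.mono_neutral_left) (auto simp: C_def)
      finally show ?thesis .
    qed
    have detm: "det (gmat m (?z y)) = C m" for y
      using cof[of m y] by (simp add: cofactor_corner)
    show "measure ?J {y\<in>space ?J. ?P (?z y)} \<le> 0"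
    proof (cases "C m = 0")
      case True
      then show ?thesis by (simp add: detm)
    next
      case False
      have "0 < (C m)\<^sup>2" using False by simp
      also have "\<dots> \<le> N" unfolding N_def using m by (intro member_le_sum) auto
      finally have N: "0 < N" .
      define u where "u j = C j / sqrt N" for j
      have u: "(\<Sum>j<n. (u j)\<^sup>2) = 1"
        using N by (simp add: u_def power_divide N_def[symmetric] sum_divide_distrib[symmetric])
      have e: "(\<Sum>j<n. y (m, j) * u j) = (\<Sum>j<n. y (m, j) * C j) / sqrt N" for y :: "nat \<times> nat \<Rightarrow> real"
        by (simp add: u_def sum_divide_distrib)
      have "{y\<in>space ?J. ?P (?z y)} \<subseteq> {y\<in>space ?J. \<bar>(\<Sum>j<n. y (m, j) * u j) - 0\<bar> \<le> 0}"
        by (auto simp: det e)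
      moreover have [measurable]: "(\<lambda>y. \<Sum>j<n. y (m, j) * u j) \<in> borel_measurable ?J"
        by (intro borel_measurable_sum borel_measurable_times measurable_entry) auto
      moreover have "{y\<in>space ?J. \<bar>(\<Sum>j<n. y (m, j) * u j) - 0\<bar> \<le> 0} \<in> sets ?J" by measurable
      ultimately have "measure ?J {y\<in>space ?J. ?P (?z y)} \<le> measure ?J {y\<in>space ?J. \<bar>(\<Sum>j<n. y (m, j) * u j) - 0\<bar> \<le> 0}"
        by (intro gauss_prob.finite_measure_mono) 
      also have "\<dots> \<le> 0" using m by (intro gauss_inner_small[OF _ u]) auto
      finally show ?thesis .
    qed
  qed simp
  then have 0: "measure ?M {x\<in>space ?M. ?P x} = 0" by (simp add: measure_le_0_iff)
  have "measure ?M {x\<in>space ?M. det (gmat (Suc m) x) = 0}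
      \<le> measure ?M ({x\<in>space ?M. ?P x} \<union> {x\<in>space ?M. det (gmat m x) = 0})"
    using s by (intro ge.finite_measure_mono) auto
  also have "\<dots> \<le> measure ?M {x\<in>space ?M. ?P x} + measure ?M {x\<in>space ?M. det (gmat m x) = 0}"
    using s by (intro measure_Un_le) auto
  also have "\<dots> = 0" using 0 Suc by simp
  finally show ?case by (simp add: measure_le_0_iff)
qed

lemma det_null: "measure (gaussian_entries n) {x\<in>space (gaussian_entries n). det (gmat n x) = 0} = 0"
  by (rule det_minor_null) simp

section \<open>The smallest singular value\<close>

definition nsq :: "nat \<Rightarrow> (nat \<Rightarrow> real) \<Rightarrow> real" where
  "nsq n v = (\<Sum>j<n. (v j)\<^sup>2)"

definition nsq_image :: "nat \<Rightarrow> real mat \<Rightarrow> (nat \<Rightarrow> real) \<Rightarrow> real" where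
  "nsq_image n M v = (\<Sum>i<n. (\<Sum>j<n. M $$ (i, j) * v j)\<^sup>2)"

text \<open>The square of the smallest singular value in variational form. As an infimum it asks for
  no minimiser; that it is an eigenvalue is shown algebraically in
  \<open>eigenvalue_gram_min_rayleigh\<close>.\<close>

definition min_rayleigh :: "nat \<Rightarrow> real mat \<Rightarrow> real" where
  "min_rayleigh n M = Inf {nsq_image n M v | v. nsq n v = 1}"

lemma nsq_nonneg [simp]: "0 \<le> nsq n v" by (simp add: nsq_def sum_nonneg)
lemma nsq_image_nonneg [simp]: "0 \<le> nsq_image n M v" by (simp add: nsq_image_def sum_nonneg)

lemma nsq_scale: "nsq n (\<lambda>j. c * v j) = c\<^sup>2 * nsq n v"
  by (simp add: nsq_def power_mult_distrib sum_distrib_left)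

lemma nsq_image_scale: "nsq_image n M (\<lambda>j. c * v j) = c\<^sup>2 * nsq_image n M v"
proof -
  have "(\<Sum>j<n. M $$ (i, j) * (c * v j)) = c * (\<Sum>j<n. M $$ (i, j) * v j)" for i
    by (simp add: sum_distrib_left mult_ac)
  then show ?thesis unfolding nsq_image_def power_mult_distrib by (simp only: power_mult_distrib sum_distrib_left[symmetric])
qed

lemma min_rayleigh_le_unit: "nsq n v = 1 \<Longrightarrow> min_rayleigh n M \<le> nsq_image n M v"
  unfolding min_rayleigh_def by (rule cInf_lower) (auto intro!: bdd_belowI[of _ 0])

lemma min_rayleigh_le: "min_rayleigh n M * nsq n v \<le> nsq_image n M v"
proof (cases "nsq n v = 0")
  case False
  then have p: "0 < nsq n v" by (simp add: less_le)
  define c where "c = 1 / sqrt (nsq n v)"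
  have c2: "c\<^sup>2 = 1 / nsq n v" using p by (simp add: c_def power_divide)
  have "nsq n (\<lambda>j. c * v j) = 1" using p by (simp add: nsq_scale c2)
  from min_rayleigh_le_unit[OF this, of M] show ?thesis using p by (simp add: nsq_image_scale c2 field_simps)
qed simp

lemma nsq_unit_exists: "0 < n \<Longrightarrow> nsq n (\<lambda>j. of_bool (j = 0)) = 1"
proof -
  assume n: "0 < n"
  have "nsq n (\<lambda>j. of_bool (j = 0)) = (\<Sum>j<n. if j = 0 then 1 else 0)"
    unfolding nsq_def by (intro sum.cong) auto
  then show ?thesis using n by simp
qed

lemma min_rayleigh_greatest: "0 < n \<Longrightarrow> (\<And>v. nsq n v = 1 \<Longrightarrow> c \<le> nsq_image n M v) \<Longrightarrow> c \<le> min_rayleigh n M"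
  unfolding min_rayleigh_def using nsq_unit_exists by (intro cInf_greatest) auto

lemma min_rayleigh_nonneg: "0 < n \<Longrightarrow> 0 \<le> min_rayleigh n M"
  by (rule min_rayleigh_greatest) auto

lemma min_rayleigh_lessD: "0 < n \<Longrightarrow> min_rayleigh n M < c \<Longrightarrow> \<exists>v. nsq n v = 1 \<and> nsq_image n M v < c"
  using min_rayleigh_greatest[of n c M] by force

text \<open>A non-negative quadratic polynomial has non-positive discriminant, as its value at the
  vertex \<open>- b / c\<close> shows. For \<open>c = 0\<close> it is affine and must be constant,
  and \<open>c < 0\<close> is impossible far out.\<close>

lemma psd_cauchy_schwarz:
  fixes a b c :: real
  assumes "\<And>t. 0 \<le> a + 2 * t * b + t\<^sup>2 * c"
  shows "b\<^sup>2 \<le> a * c"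
proof (cases "c = 0")
  case True
  show ?thesis
  proof (cases "b = 0")
    case False
    \<comment> \<open>For \<open>b\<close> not 0 this is the point where the affine function takes
      the value -1.\<close>
    have "a + 2 * (- (a + 1) / (2 * b)) * b + (- (a + 1) / (2 * b))\<^sup>2 * c = -1"
      using False True by (simp add: field_simps)
    then show ?thesis using assms[of "- (a + 1) / (2 * b)"] by simp
  qed (use True in simp)
next
  case False
  have "0 \<le> c"
  proof (rule ccontr)
    assume "\<not> 0 \<le> c"
    then have c: "c < 0" by simp
    \<comment> \<open>Large enough that the quadratic term outweighs the other two by at least
      \<open>t\<close>.\<close>
    define t where "t = (\<bar>a\<bar> + 2 * \<bar>b\<bar> + 1) / (- c) + 1"
    have "0 \<le> (\<bar>a\<bar> + 2 * \<bar>b\<bar> + 1) / (- c)" using c by (intro divide_nonneg_pos) auto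
    then have t1: "1 \<le> t" by (simp only: t_def)
    have t2: "t * c \<le> - (\<bar>a\<bar> + 2 * \<bar>b\<bar> + 1)"
    proof -
      have "t * c = - (\<bar>a\<bar> + 2 * \<bar>b\<bar> + 1) + c" using c by (simp add: t_def field_simps)
      then show ?thesis using c by simp
    qed
    have "t\<^sup>2 * c = t * (t * c)" by (simp add: power2_eq_square)
    also have "\<dots> \<le> t * (- (\<bar>a\<bar> + 2 * \<bar>b\<bar> + 1))" using t1 t2 by (intro mult_left_mono) auto
    finally have "t\<^sup>2 * c \<le> - t * \<bar>a\<bar> - 2 * t * \<bar>b\<bar> - t" by (simp add: algebra_simps)
    moreover have "2 * t * b \<le> 2 * t * \<bar>b\<bar>" using t1 by simp
    moreover have "a \<le> t * \<bar>a\<bar>"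
    proof -
      have "a \<le> 1 * \<bar>a\<bar>" by simp
      also have "\<dots> \<le> t * \<bar>a\<bar>" using t1 by (intro mult_right_mono) auto
      finally show ?thesis .
    qed
    ultimately have "a + 2 * t * b + t\<^sup>2 * c \<le> - t" by linarith
    then show False using assms[of t] t1 by simp
  qed
  then have c: "0 < c" using False by simp
  have "a + 2 * (- b / c) * b + (- b / c)\<^sup>2 * c = a - b\<^sup>2 / c"
    using c by (simp add: field_simps power2_eq_square)
  then have "b\<^sup>2 / c \<le> a" using assms[of "- b / c"] by simp
  then show ?thesis using c by (simp add: field_simps)
qed

section \<open>The Gram matrix and its smallest eigenvalue\<close>

lemma gram_entry:
  assumes "M \<in> carrier_mat n n" "i < n" "j < n"
  shows "(transpose_mat M * M) $$ (i, j) = (\<Sum>l<n. M $$ (l, i) * M $$ (l, j))"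
proof -
  have "(transpose_mat M * M) $$ (i, j) = (\<Sum>l<n. transpose_mat M $$ (i, l) * M $$ (l, j))"
    using assms by (intro mat_mult_entry[where l=n]) auto
  then show ?thesis using assms by simp
qed

lemma gram_nsq_image:
  assumes M: "M \<in> carrier_mat n n"
  shows "(\<Sum>i<n. v i * (\<Sum>j<n. (transpose_mat M * M) $$ (i, j) * v j)) = nsq_image n M v"
proof -
  have "(\<Sum>i<n. v i * (\<Sum>j<n. (transpose_mat M * M) $$ (i, j) * v j))
      = (\<Sum>i<n. \<Sum>j<n. \<Sum>l<n. (M $$ (l, i) * v i) * (M $$ (l, j) * v j))"
  proof (rule sum.cong[OF refl])
    fix i assume "i \<in> {..<n}"
    then have "(\<Sum>j<n. (transpose_mat M * M) $$ (i, j) * v j) = (\<Sum>j<n. (\<Sum>l<n. M $$ (l, i) * M $$ (l, j)) * v j)"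
      by (intro sum.cong refl) (simp add: gram_entry[OF M] del: index_mult_mat(1))
    then show "v i * (\<Sum>j<n. (transpose_mat M * M) $$ (i, j) * v j)
        = (\<Sum>j<n. \<Sum>l<n. (M $$ (l, i) * v i) * (M $$ (l, j) * v j))"
      by (simp add: sum_distrib_left sum_distrib_right mult_ac del: index_mult_mat(1))
  qed
  also have "\<dots> = (\<Sum>i<n. \<Sum>l<n. \<Sum>j<n. (M $$ (l, i) * v i) * (M $$ (l, j) * v j))"
    by (rule sum.cong[OF refl], rule sum.swap)
  also have "\<dots> = (\<Sum>l<n. \<Sum>i<n. \<Sum>j<n. (M $$ (l, i) * v i) * (M $$ (l, j) * v j))"
    by (rule sum.swap)
  also have "\<dots> = nsq_image n M v" by (simp add: nsq_image_def power2_eq_square sum_product)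
  finally show ?thesis .
qed

lemma mult_mat_vec_entry:
  fixes A :: "real mat"
  assumes "A \<in> carrier_mat n m" "v \<in> carrier_vec m" "i < n"
  shows "vec_index (A *\<^sub>v v) i = (\<Sum>j<m. A $$ (i, j) * vec_index v j)"
  using assms by (auto simp: scalar_prod_def atLeast0LessThan intro!: sum.cong)

lemma eigenvalue_gram_ge:
  assumes M: "M \<in> carrier_mat n n" and e: "eigenvalue (transpose_mat M * M) l"
  shows "min_rayleigh n M \<le> l"
proof -
  let ?B = "transpose_mat M * M"
  have B: "?B \<in> carrier_mat n n" using M by auto
  obtain v where v: "v \<in> carrier_vec n" "v \<noteq> 0\<^sub>v n" "?B *\<^sub>v v = l \<cdot>\<^sub>v v"
    using e B by (auto simp: eigenvalue_def eigenvector_def)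
  define w where "w = vec_index v"
  have "\<exists>i<n. w i \<noteq> 0"
  proof (rule ccontr)
    assume "\<not> ?thesis"
    then have "v = 0\<^sub>v n" using v(1) by (intro eq_vecI) (auto simp: w_def)
    then show False using v(2) by simp
  qed
  then obtain i where i: "i < n" "w i \<noteq> 0" by auto
  have "0 < (w i)\<^sup>2" using i by simp
  also have "\<dots> \<le> nsq n w" unfolding nsq_def using i by (intro member_le_sum) auto
  finally have p: "0 < nsq n w" .
  have "(\<Sum>j<n. ?B $$ (i, j) * w j) = l * w i" if "i < n" for i
    using mult_mat_vec_entry[OF B v(1) that] v that by (simp add: w_def)
  then have "nsq_image n M w = (\<Sum>i<n. w i * (l * w i))" unfolding gram_nsq_image[OF M, symmetric]
    by (intro sum.cong refl) (simp del: index_mult_mat(1))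
  also have "\<dots> = l * nsq n w" by (simp add: nsq_def sum_distrib_left power2_eq_square mult_ac)
  finally show ?thesis using min_rayleigh_le[of n M w] p by simp
qed

text \<open>
  If the infimum \<open>m\<close> were not an eigenvalue, the positive semidefinite form of \<open>M\<^sup>T M - m\<close> would have an inverse,
  and the Cauchy--Schwarz inequality for this form would bound it from below by a positive multiple of the square norm.
\<close>

lemma eigenvalue_gram_min_rayleigh:
  assumes n: "0 < n" and M: "M \<in> carrier_mat n n"
  shows "eigenvalue (transpose_mat M * M) (min_rayleigh n M)"
proof (rule ccontr)
  let ?B = "transpose_mat M * M" let ?m = "min_rayleigh n M"
  have B: "?B \<in> carrier_mat n n" using M by auto
  define S where "S = char_matrix ?B ?m"
  have S: "S \<in> carrier_mat n n" using B by (simp add: S_def)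
  have Sij: "S $$ (i, j) = ?B $$ (i, j) - (if i = j then ?m else 0)" if "i < n" "j < n" for i j
    using that M by (simp add: S_def char_matrix_def del: index_mult_mat(1))
  assume "\<not> eigenvalue ?B ?m"
  then have d: "det S \<noteq> 0" using eigenvalue_det[OF B] by (simp add: S_def)
  define R where "R = inv_mat S"
  have R: "R \<in> carrier_mat n n" using S by (simp add: R_def)
  have SR: "S * R = 1\<^sub>m n" using inv_mat_mult(1)[OF S d] by (simp add: R_def)
  define b where "b u v = (\<Sum>i<n. u i * (\<Sum>j<n. S $$ (i, j) * v j))" for u v :: "nat \<Rightarrow> real"
  have bq: "b v v = nsq_image n M v - ?m * nsq n v" for v
  proof -
    have "(\<Sum>j<n. S $$ (i, j) * v j) = (\<Sum>j<n. ?B $$ (i, j) * v j) - ?m * v i" if "i < n" for i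
    proof -
      have "(\<Sum>j<n. S $$ (i, j) * v j) = (\<Sum>j<n. ?B $$ (i, j) * v j - (if i = j then ?m else 0) * v j)"
        using that by (intro sum.cong refl) (simp add: Sij left_diff_distrib del: index_mult_mat(1))
      also have "\<dots> = (\<Sum>j<n. ?B $$ (i, j) * v j) - (\<Sum>j<n. (if i = j then ?m else 0) * v j)"
        by (rule sum_subtractf)
      also have "(\<Sum>j<n. (if i = j then ?m else 0) * v j) = (\<Sum>j<n. if j = i then ?m * v j else 0)"
        by (intro sum.cong) auto
      also have "\<dots> = ?m * v i" using that by simp
      finally show ?thesis .
    qed
    then have "b v v = (\<Sum>i<n. v i * ((\<Sum>j<n. ?B $$ (i, j) * v j) - ?m * v i))"
      unfolding b_def by (intro sum.cong refl) (simp del: index_mult_mat(1))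
    also have "\<dots> = (\<Sum>i<n. v i * (\<Sum>j<n. ?B $$ (i, j) * v j)) - ?m * nsq n v"
      by (simp add: right_diff_distrib sum_subtractf nsq_def sum_distrib_left power2_eq_square mult_ac del: index_mult_mat(1))
    finally show ?thesis by (simp only: gram_nsq_image[OF M])
  qed
  have b0: "0 \<le> b v v" for v using min_rayleigh_le[of n M v] by (simp add: bq)
  have bsym: "b u v = b v u" for u v
  proof -
    have s: "S $$ (i, j) = S $$ (j, i)" if "i < n" "j < n" for i j
      using that by (simp add: Sij gram_entry[OF M] mult.commute del: index_mult_mat(1))
    have "b u v = (\<Sum>i<n. \<Sum>j<n. u i * (S $$ (i, j) * v j))" by (simp add: b_def sum_distrib_left)
    also have "\<dots> = (\<Sum>j<n. \<Sum>i<n. u i * (S $$ (i, j) * v j))" by (rule sum.swap)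
    also have "\<dots> = b v u" unfolding b_def sum_distrib_left
      by (intro sum.cong refl) (simp add: s mult_ac)
    finally show ?thesis .
  qed
  have badd: "b (\<lambda>i. u i + t * v i) (\<lambda>i. u i + t * v i) = b u u + 2 * t * b u v + t\<^sup>2 * b v v" for u v t
  proof -
    have "b (\<lambda>i. u i + t * v i) (\<lambda>i. u i + t * v i) = b u u + t * b u v + t * b v u + t\<^sup>2 * b v v"
      by (simp add: b_def sum_distrib_left sum.distrib distrib_left distrib_right power2_eq_square mult_ac)
    then show ?thesis using bsym[of v u] by simp
  qed
  \<comment> \<open>Bounds the inverse form on unit vectors; the summand 1 makes it
    positive.\<close>
  define K where "K = (\<Sum>i<n. \<Sum>j<n. \<bar>R $$ (i, j)\<bar>) + 1"
  have K: "0 < K" unfolding K_def by (intro add_nonneg_pos sum_nonneg) auto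
  \<comment> \<open>Let \<open>w\<close> solve \<open>S w = v\<close>. Then \<open>b v w\<close> is
    the square norm of \<open>v\<close>, which is 1, and Cauchy--Schwarz for \<open>b\<close> gives
    \<open>1 \<le> b v v * b w w\<close>, where \<open>b w w\<close> is at most
    \<open>K\<close>.\<close>
  have low: "?m + 1 / K \<le> nsq_image n M v" if v: "nsq n v = 1" for v
  proof -
    have v1: "\<bar>v i\<bar> \<le> 1" if "i < n" for i
    proof -
      have "(v i)\<^sup>2 \<le> nsq n v" unfolding nsq_def using that by (intro member_le_sum) auto
      then show ?thesis using v by (simp add: abs_le_square_iff[of "v i" 1, simplified])
    qed
    define w where "w j = (\<Sum>l<n. R $$ (j, l) * v l)" for j
    have Sw: "(\<Sum>j<n. S $$ (i, j) * w j) = v i" if i: "i < n" for i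
    proof -
      have "(\<Sum>j<n. S $$ (i, j) * w j) = (\<Sum>j<n. \<Sum>l<n. S $$ (i, j) * R $$ (j, l) * v l)"
        by (simp add: w_def sum_distrib_left mult.assoc)
      also have "\<dots> = (\<Sum>l<n. \<Sum>j<n. S $$ (i, j) * R $$ (j, l) * v l)" by (rule sum.swap)
      also have "\<dots> = (\<Sum>l<n. (S * R) $$ (i, l) * v l)"
        using i S R by (intro sum.cong refl) (simp add: mat_mult_entry[OF S R] sum_distrib_right del: index_mult_mat(1))
      also have "\<dots> = (\<Sum>l<n. if l = i then v l else 0)" unfolding SR using i by (intro sum.cong) auto
      finally show ?thesis using i by simp
    qed
    have "b v w = (\<Sum>i<n. v i * v i)" unfolding b_def by (intro sum.cong refl) (simp add: Sw)
    then have bvw: "b v w = 1" using v by (simp add: nsq_def power2_eq_square)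
    have "b w w = (\<Sum>i<n. w i * v i)" unfolding b_def by (intro sum.cong refl) (simp add: Sw)
    also have "\<dots> \<le> (\<Sum>i<n. \<Sum>j<n. \<bar>R $$ (i, j)\<bar>)"
    proof (rule sum_mono)
      fix i assume i: "i \<in> {..<n}"
      have "w i * v i = (\<Sum>l<n. R $$ (i, l) * v l * v i)" by (simp add: w_def sum_distrib_right)
      also have "\<dots> \<le> (\<Sum>l<n. \<bar>R $$ (i, l)\<bar>)"
      proof (rule sum_mono)
        fix l assume l: "l \<in> {..<n}"
        have "R $$ (i, l) * v l * v i \<le> \<bar>R $$ (i, l)\<bar> * \<bar>v l\<bar> * \<bar>v i\<bar>" by (simp add: abs_mult[symmetric])
        also have "\<dots> \<le> \<bar>R $$ (i, l)\<bar> * 1 * 1" using v1 i l by (intro mult_mono) auto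
        finally show "R $$ (i, l) * v l * v i \<le> \<bar>R $$ (i, l)\<bar>" by simp
      qed
      finally show "w i * v i \<le> (\<Sum>j<n. \<bar>R $$ (i, j)\<bar>)" .
    qed
    finally have bww: "b w w \<le> K" by (simp add: K_def)
    have "(b v w)\<^sup>2 \<le> b v v * b w w"
      by (rule psd_cauchy_schwarz) (use b0 badd in metis)
    also have "\<dots> \<le> b v v * K" by (intro mult_left_mono bww b0)
    finally have "1 / K \<le> b v v" using bvw K by (simp add: field_simps)
    then show ?thesis using v by (simp add: bq)
  qed
  have "?m + 1 / K \<le> ?m" by (rule min_rayleigh_greatest[OF n low])
  then show False using K by simp
qed

text \<open>The eigenvalues are roots of the characteristic polynomial, so the set in
  \<open>Min\<close> is finite; its least element is the infimum because that infimum is attained as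
  an eigenvalue.\<close>

lemma s_min_min_rayleigh:
  assumes n: "0 < n" and M: "M \<in> carrier_mat n n"
  shows "s_min M = sqrt (min_rayleigh n M)"
proof -
  let ?B = "transpose_mat M * M"
  have B: "?B \<in> carrier_mat n n" using M by auto
  have "finite {l. eigenvalue ?B l}"
  proof -
    have "{l. eigenvalue ?B l} = {l. poly (char_poly ?B) l = 0}"
      using eigenvalue_root_char_poly[OF B] by auto
    moreover have "char_poly ?B \<noteq> 0" using degree_monic_char_poly[OF B] by auto
    ultimately show ?thesis using poly_roots_finite by simp
  qed
  moreover have "singular_values M = sqrt ` {l. eigenvalue ?B l}" by (auto simp: singular_values_def)
  ultimately have f: "finite (singular_values M)" by simp
  show ?thesis unfolding s_min_def
  proof (rule Min_eqI[OF f])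
    show "sqrt (min_rayleigh n M) \<in> singular_values M"
      using eigenvalue_gram_min_rayleigh[OF n M] by (auto simp: singular_values_def)
    fix y assume "y \<in> singular_values M"
    then show "sqrt (min_rayleigh n M) \<le> y" using eigenvalue_gram_ge[OF M] by (auto simp: singular_values_def)
  qed
qed

lemma s_min_le_of_vec:
  fixes \<rho> :: real
  assumes n: "0 < n" and M: "M \<in> carrier_mat n n" and v: "0 < nsq n v" and r: "0 \<le> \<rho>"
    and q: "nsq_image n M v \<le> \<rho>\<^sup>2 * nsq n v"
  shows "s_min M \<le> \<rho>"
proof -
  have "min_rayleigh n M * nsq n v \<le> \<rho>\<^sup>2 * nsq n v" using min_rayleigh_le[of n M v] q by linarith
  then have "min_rayleigh n M \<le> \<rho>\<^sup>2" using v by simp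
  then have "sqrt (min_rayleigh n M) \<le> sqrt (\<rho>\<^sup>2)" by (rule real_sqrt_le_mono)
  then show ?thesis using r by (simp add: s_min_min_rayleigh[OF n M])
qed

text \<open>Row by row, the Cauchy--Schwarz inequality for \<open>v = B (M v)\<close> gives
  \<open>nsq n v \<le> H * nsq_image n M v\<close>, where \<open>H\<close> is the Hilbert--Schmidt
  square of \<open>B\<close>; hence the infimum is at least \<open>1 / H\<close>.\<close>

lemma hs_ge_of_s_min:
  fixes \<rho> :: real
  assumes n: "0 < n" and M: "M \<in> carrier_mat n n" and B: "B \<in> carrier_mat n n" and BM: "B * M = 1\<^sub>m n"
    and s: "s_min M \<le> \<rho>" and r: "0 \<le> \<rho>"
  shows "1 \<le> \<rho>\<^sup>2 * (\<Sum>i<n. \<Sum>j<n. (B $$ (i, j))\<^sup>2)"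
proof -
  define H where "H = (\<Sum>i<n. \<Sum>j<n. (B $$ (i, j))\<^sup>2)"
  have q: "nsq n v \<le> H * nsq_image n M v" for v
  proof -
    define w where "w j = (\<Sum>l<n. M $$ (j, l) * v l)" for j
    have e: "v i = (\<Sum>j<n. B $$ (i, j) * w j)" if i: "i < n" for i
    proof -
      have "(\<Sum>j<n. B $$ (i, j) * w j) = (\<Sum>j<n. \<Sum>l<n. B $$ (i, j) * M $$ (j, l) * v l)"
        by (simp add: w_def sum_distrib_left mult.assoc)
      also have "\<dots> = (\<Sum>l<n. \<Sum>j<n. B $$ (i, j) * M $$ (j, l) * v l)" by (rule sum.swap)
      also have "\<dots> = (\<Sum>l<n. (B * M) $$ (i, l) * v l)"
        using i by (intro sum.cong refl) (simp add: mat_mult_entry[OF B M] sum_distrib_right del: index_mult_mat(1))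
      also have "\<dots> = (\<Sum>l<n. if l = i then v l else 0)" unfolding BM using i by (intro sum.cong) auto
      finally show ?thesis using i by simp
    qed
    have "nsq n v \<le> (\<Sum>i<n. (\<Sum>j<n. (B $$ (i, j))\<^sup>2) * (\<Sum>j<n. (w j)\<^sup>2))"
      unfolding nsq_def
    proof (rule sum_mono)
      fix i assume "i \<in> {..<n}"
      then have "(v i)\<^sup>2 = (\<Sum>j<n. B $$ (i, j) * w j)\<^sup>2" using e by simp
      also have "\<dots> \<le> (\<Sum>j<n. (B $$ (i, j))\<^sup>2) * (\<Sum>j<n. (w j)\<^sup>2)"
        by (rule Cauchy_Schwarz_ineq_sum)
      finally show "(v i)\<^sup>2 \<le> (\<Sum>j<n. (B $$ (i, j))\<^sup>2) * (\<Sum>j<n. (w j)\<^sup>2)" .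
    qed
    then show ?thesis by (simp add: H_def nsq_image_def w_def sum_distrib_right)
  qed
  have H0: "0 \<le> H" by (simp add: H_def sum_nonneg)
  have "H \<noteq> 0" using q[of "\<lambda>j. of_bool (j = 0)"] nsq_unit_exists[OF n] by auto
  then have H: "0 < H" using H0 by simp
  have "1 / H \<le> min_rayleigh n M"
    by (rule min_rayleigh_greatest[OF n]) (use q H in \<open>metis divide_le_eq mult.commute\<close>)
  moreover have "min_rayleigh n M \<le> \<rho>\<^sup>2"
  proof -
    have "sqrt (min_rayleigh n M) \<le> \<rho>" using s by (simp add: s_min_min_rayleigh[OF n M])
    then have "(sqrt (min_rayleigh n M))\<^sup>2 \<le> \<rho>\<^sup>2" by (intro power_mono) (simp_all add: min_rayleigh_nonneg[OF n])
    then show ?thesis by (simp add: min_rayleigh_nonneg[OF n])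
  qed
  ultimately have "1 / H \<le> \<rho>\<^sup>2" by linarith
  then show ?thesis using H by (simp add: H_def[symmetric] divide_le_eq)
qed

section \<open>Powers of the matrix and of its inverse\<close>

lemma pow_mat_Suc_left:
  fixes A :: "real mat"
  assumes A: "A \<in> carrier_mat n n"
  shows "A ^\<^sub>m Suc k = A * A ^\<^sub>m k"
proof (induction k)
  case 0
  then show ?case using A by simp
next
  case (Suc k)
  have P: "A ^\<^sub>m k \<in> carrier_mat n n" using A by (rule pow_carrier_mat)
  have "A ^\<^sub>m Suc (Suc k) = A * A ^\<^sub>m k * A" using Suc by simp
  also have "\<dots> = A * (A ^\<^sub>m k * A)" by (rule assoc_mult_mat[OF A P A])
  finally show ?case by simp
qed

lemma pow_mat_inverse:
  fixes X B :: "real mat"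
  assumes X: "X \<in> carrier_mat n n" and B: "B \<in> carrier_mat n n" and e: "X * B = 1\<^sub>m n"
  shows "X ^\<^sub>m k * B ^\<^sub>m k = 1\<^sub>m n"
proof (induction k)
  case 0
  have "dim_row X = n" "dim_row B = n" using X B by auto
  then show ?case by simp
next
  case (Suc k)
  have P: "X ^\<^sub>m k \<in> carrier_mat n n" "B ^\<^sub>m k \<in> carrier_mat n n" using X B by (auto intro: pow_carrier_mat)
  have "X ^\<^sub>m Suc k * B ^\<^sub>m Suc k = X ^\<^sub>m k * X * (B * B ^\<^sub>m k)"
    by (simp only: pow_mat_Suc_left[OF B] pow_mat.simps(2)[of X k])
  also have "\<dots> = X ^\<^sub>m k * (X * (B * B ^\<^sub>m k))"
    using P X B by (intro assoc_mult_mat[OF P(1) X]) (auto intro: mult_carrier_mat)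
  also have "X * (B * B ^\<^sub>m k) = X * B * B ^\<^sub>m k"
    by (rule assoc_mult_mat[OF X B P(2), symmetric])
  also have "\<dots> = B ^\<^sub>m k" using e left_mult_one_mat[OF P(2)] by simp
  finally show ?case using Suc by simp
qed

lemma hs_norm_hsq_pow: "hs_norm (inv_mat (gmat n x) ^\<^sub>m k) = sqrt (hsq_pow n k x)"
proof -
  have "inv_mat (gmat n x) ^\<^sub>m k \<in> carrier_mat n n" by (intro pow_carrier_mat) simp
  then have d: "dim_row (inv_mat (gmat n x) ^\<^sub>m k) = n" "dim_col (inv_mat (gmat n x) ^\<^sub>m k) = n"
    by (rule carrier_matD)+
  show ?thesis unfolding hs_norm_def hsq_pow_def d by (simp add: gpow_pow_mat)
qed

lemma hsq_pow_ge_of_s_min: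
  fixes \<rho> :: real
  assumes n: "0 < n" and d: "det (gmat n x) \<noteq> 0" and s: "s_min (gmat n x ^\<^sub>m k) \<le> \<rho>" and r: "0 \<le> \<rho>"
  shows "1 \<le> \<rho>\<^sup>2 * hsq_pow n k x"
proof -
  have c: "gmat n x ^\<^sub>m k \<in> carrier_mat n n" "inv_mat (gmat n x) ^\<^sub>m k \<in> carrier_mat n n"
    by (intro pow_carrier_mat; simp)+
  have "inv_mat (gmat n x) ^\<^sub>m k * gmat n x ^\<^sub>m k = 1\<^sub>m n"
    by (rule pow_mat_inverse[OF _ _ inv_mat_mult(2)[OF _ d]]) simp_all
  from hs_ge_of_s_min[OF n c this s r] show ?thesis by (simp add: hsq_pow_def gpow_pow_mat)
qed

text \<open>The test vector is \<open>v\<close>, the image of \<open>q\<close> under the power of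
  the inverse. Pairing with the unit vector \<open>p\<close> shows that its norm is at least
  \<open>R\<close>, while the power of the matrix maps it back to the unit vector
  \<open>q\<close>.\<close>

lemma s_min_le_of_bilinear:
  fixes R :: real
  assumes n: "0 < n" and d: "det (gmat n x) \<noteq> 0" and R: "0 < R"
    and p: "nsq n p = 1" and q: "nsq n q = 1" and b: "R \<le> \<bar>\<Sum>i<n. \<Sum>j<n. p i * gpow n x k i j * q j\<bar>"
  shows "s_min (gmat n x ^\<^sub>m k) \<le> 1 / R"
proof -
  let ?X = "gmat n x ^\<^sub>m k" let ?B = "inv_mat (gmat n x) ^\<^sub>m k"
  have c: "?X \<in> carrier_mat n n" "?B \<in> carrier_mat n n"
    by (intro pow_carrier_mat; simp)+
  have XB: "?X * ?B = 1\<^sub>m n"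
    by (rule pow_mat_inverse[OF _ _ inv_mat_mult(1)[OF _ d]]) simp_all
  define v where "v i = (\<Sum>j<n. gpow n x k i j * q j)" for i
  have "(\<Sum>i<n. \<Sum>j<n. p i * gpow n x k i j * q j) = (\<Sum>i<n. p i * v i)"
    by (simp add: v_def sum_distrib_left mult.assoc)
  then have "R\<^sup>2 \<le> \<bar>\<Sum>i<n. p i * v i\<bar>\<^sup>2" using b R by (intro power_mono) auto
  also have "\<dots> = (\<Sum>i<n. p i * v i)\<^sup>2" by simp
  also have "\<dots> \<le> (\<Sum>i<n. (p i)\<^sup>2) * (\<Sum>i<n. (v i)\<^sup>2)" by (rule Cauchy_Schwarz_ineq_sum)
  also have "\<dots> = nsq n v" using p by (simp add: nsq_def)
  finally have Rv: "R\<^sup>2 \<le> nsq n v" .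
  have "(\<Sum>j<n. ?X $$ (i, j) * v j) = q i" if i: "i < n" for i
  proof -
    have "(\<Sum>j<n. ?X $$ (i, j) * v j) = (\<Sum>j<n. \<Sum>l<n. ?X $$ (i, j) * ?B $$ (j, l) * q l)"
      by (simp add: v_def sum_distrib_left mult.assoc gpow_pow_mat)
    also have "\<dots> = (\<Sum>l<n. \<Sum>j<n. ?X $$ (i, j) * ?B $$ (j, l) * q l)" by (rule sum.swap)
    also have "\<dots> = (\<Sum>l<n. (?X * ?B) $$ (i, l) * q l)"
      using i by (intro sum.cong refl) (simp add: mat_mult_entry[OF c] sum_distrib_right del: index_mult_mat(1))
    also have "\<dots> = (\<Sum>l<n. if l = i then q l else 0)" unfolding XB using i by (intro sum.cong) auto
    finally show ?thesis using i by simp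
  qed
  then have "nsq_image n ?X v = nsq n q" by (simp add: nsq_image_def nsq_def)
  then have "nsq_image n ?X v = 1" using q by simp
  moreover have "1 \<le> (1 / R)\<^sup>2 * nsq n v" using Rv R by (simp add: power_divide field_simps)
  moreover have "0 < nsq n v" using Rv R by (meson less_le_trans zero_less_power)
  ultimately show ?thesis using R by (intro s_min_le_of_vec[OF n c(1)]) auto
qed

lemma measurable_pow_entry:
  "i < n \<Longrightarrow> j < n \<Longrightarrow> (\<lambda>x. (gmat n x ^\<^sub>m k) $$ (i, j)) \<in> borel_measurable (gaussian_entries n)"
proof (induction k arbitrary: j)
  case 0
  then show ?case by (simp add: gmat_def)
next
  case (Suc k)
  have "(gmat n x ^\<^sub>m Suc k) $$ (i, j) = (\<Sum>l<n. (gmat n x ^\<^sub>m k) $$ (i, l) * x (l, j))" for x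
  proof -
    have c: "gmat n x ^\<^sub>m k \<in> carrier_mat n n" by (intro pow_carrier_mat) simp
    have "(gmat n x ^\<^sub>m Suc k) $$ (i, j) = (\<Sum>l<n. (gmat n x ^\<^sub>m k) $$ (i, l) * gmat n x $$ (l, j))"
      unfolding pow_mat.simps by (rule mat_mult_entry[OF c gmat_carrier(1)]) (use Suc.prems in auto)
    then show ?thesis using Suc.prems by simp
  qed
  moreover have "(\<lambda>x. \<Sum>l<n. (gmat n x ^\<^sub>m k) $$ (i, l) * x (l, j)) \<in> borel_measurable (gaussian_entries n)"
    using Suc by (intro borel_measurable_sum borel_measurable_times measurable_entry') auto
  ultimately show ?case by simp
qed

text \<open>
  The condition involves an infimum over all vectors; a countable dense set of vectors suffices.
\<close>

lemma sets_s_min_le: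
  fixes r :: real
  assumes n: "0 < n" and r: "0 \<le> r"
  shows "{x\<in>space (gaussian_entries n). s_min (gmat n x ^\<^sub>m k) \<le> r} \<in> sets (gaussian_entries n)"
proof -
  let ?M = "gaussian_entries n"
  obtain D :: "(nat \<Rightarrow> real) set" where D: "countable D" "\<And>X. open X \<Longrightarrow> X \<noteq> {} \<Longrightarrow> \<exists>d\<in>D. d \<in> X"
    using countable_dense_exists by blast
  have eq: "s_min (gmat n x ^\<^sub>m k) \<le> r \<longleftrightarrow>
    (\<forall>m::nat. \<exists>d\<in>D. nsq_image n (gmat n x ^\<^sub>m k) d < (r\<^sup>2 + 1 / Suc m) * nsq n d)" (is "?L \<longleftrightarrow> ?R") for x
  proof -
    let ?X = "gmat n x ^\<^sub>m k"
    have c: "?X \<in> carrier_mat n n" by (intro pow_carrier_mat) simp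
    have L: "?L \<longleftrightarrow> min_rayleigh n ?X \<le> r\<^sup>2"
      using r min_rayleigh_nonneg[OF n, of ?X] by (simp add: s_min_min_rayleigh[OF n c] real_sqrt_le_iff' real_le_lsqrt sqrt_le_D)
    show ?thesis unfolding L
    proof
      assume l: "min_rayleigh n ?X \<le> r\<^sup>2"
      show ?R
      proof
        fix m :: nat
        have "min_rayleigh n ?X < r\<^sup>2 + 1 / Suc m" using l by (simp add: add_strict_increasing2 le_less_trans)
        then obtain v where v: "nsq n v = 1" "nsq_image n ?X v < r\<^sup>2 + 1 / Suc m" using min_rayleigh_lessD[OF n] by blast
        \<comment> \<open>The homogeneous strict inequality replaces the unit sphere, which has
          empty interior, by an open cone that a dense set must meet.\<close>
        let ?S = "{v. nsq_image n ?X v < (r\<^sup>2 + 1 / Suc m) * nsq n v}"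
        have "open ?S" unfolding nsq_image_def nsq_def
          by (intro open_Collect_less continuous_intros continuous_on_product_coordinates)
        moreover have "v \<in> ?S" using v by simp
        then have "?S \<noteq> {}" by blast
        ultimately show "\<exists>d\<in>D. nsq_image n ?X d < (r\<^sup>2 + 1 / Suc m) * nsq n d" using D(2) by blast
      qed
    next
      assume R: ?R
      show "min_rayleigh n ?X \<le> r\<^sup>2"
      proof (rule ccontr)
        assume "\<not> ?thesis"
        then obtain m where m: "1 / Suc m < min_rayleigh n ?X - r\<^sup>2"
          using reals_Archimedean[of "min_rayleigh n ?X - r\<^sup>2"] by (auto simp: inverse_eq_divide)
        obtain d where d: "nsq_image n ?X d < (r\<^sup>2 + 1 / Suc m) * nsq n d" using R by blast
        have "(r\<^sup>2 + 1 / Suc m) * nsq n d \<le> min_rayleigh n ?X * nsq n d" using m by (intro mult_right_mono) auto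
        then show False using d min_rayleigh_le[of n ?X d] by linarith
      qed
    qed
  qed
  have [measurable]: "(\<lambda>x. nsq_image n (gmat n x ^\<^sub>m k) d) \<in> borel_measurable ?M" for d
    unfolding nsq_image_def by (intro borel_measurable_sum borel_measurable_power borel_measurable_times measurable_pow_entry) auto
  have "{x\<in>space ?M. \<forall>m::nat. \<exists>d\<in>D. nsq_image n (gmat n x ^\<^sub>m k) d < (r\<^sup>2 + 1 / Suc m) * nsq n d}
      = (\<Inter>m::nat. \<Union>d\<in>D. {x\<in>space ?M. nsq_image n (gmat n x ^\<^sub>m k) d < (r\<^sup>2 + 1 / Suc m) * nsq n d})"
    by auto
  also have "\<dots> \<in> sets ?M"
    using D(1) by (intro sets.countable_INT' sets.countable_UN') auto
  finally show ?thesis by (simp only: eq)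
qed

section \<open>The inverse along a line in the first row\<close>

text \<open>The \<open>n\<close>-th finite difference of a power of lower degree. Absorbing one
  factor \<open>j\<close> into the binomial coefficient lowers both \<open>n\<close> and the
  exponent, and the binomial theorem undoes the index shift.\<close>

lemma alternating_binomial_power_sum:
  "i < n \<Longrightarrow> (\<Sum>j\<le>n. (-1) ^ j * of_nat (n choose j) * (of_nat j :: real) ^ i) = 0"
proof (induction n arbitrary: i)
  case (Suc m)
  show ?case
  proof (cases i)
    case 0
    then show ?thesis using choose_alternating_sum[of "Suc m", where ?'a=real] by simp
  next
    case (Suc l)
    have "(\<Sum>j\<le>Suc m. (-1) ^ j * of_nat (Suc m choose j) * (of_nat j :: real) ^ i)
        = (\<Sum>j\<le>m. (-1) ^ Suc j * of_nat (Suc m choose Suc j) * (of_nat (Suc j) :: real) ^ i)"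
      by (subst sum.atMost_Suc_shift) (simp add: Suc)
    also have "\<dots> = (\<Sum>j\<le>m. - of_nat (Suc m) * ((-1) ^ j * of_nat (m choose j) * (of_nat j + 1 :: real) ^ l))"
    proof (rule sum.cong[OF refl])
      fix j
      have "real (Suc m choose Suc j) * real (Suc j) = real (Suc m) * real (m choose j)"
        by (metis Suc_times_binomial mult.commute of_nat_mult)
      then show "(-1) ^ Suc j * of_nat (Suc m choose Suc j) * (of_nat (Suc j) :: real) ^ i
        = - of_nat (Suc m) * ((-1) ^ j * of_nat (m choose j) * (of_nat j + 1 :: real) ^ l)"
      proof -
        assume b: "real (Suc m choose Suc j) * real (Suc j) = real (Suc m) * real (m choose j)"
        have "(-1) ^ Suc j * of_nat (Suc m choose Suc j) * (of_nat (Suc j) :: real) ^ i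
            = - ((-1) ^ j) * (real (Suc m choose Suc j) * real (Suc j)) * real (Suc j) ^ l"
          unfolding Suc by (simp del: binomial_Suc_Suc of_nat_Suc)
        also have "\<dots> = - of_nat (Suc m) * ((-1) ^ j * of_nat (m choose j) * (of_nat j + 1 :: real) ^ l)"
          unfolding b by (simp add: algebra_simps)
        finally show ?thesis .
      qed
    qed
    also have "\<dots> = - of_nat (Suc m) * (\<Sum>j\<le>m. \<Sum>r\<le>l. of_nat (l choose r) * ((-1) ^ j * of_nat (m choose j) * (of_nat j :: real) ^ r))"
      by (subst binomial_ring) (simp add: sum_distrib_left mult_ac)
    also have "(\<Sum>j\<le>m. \<Sum>r\<le>l. of_nat (l choose r) * ((-1) ^ j * of_nat (m choose j) * (of_nat j :: real) ^ r))
        = (\<Sum>r\<le>l. of_nat (l choose r) * (\<Sum>j\<le>m. (-1) ^ j * of_nat (m choose j) * (of_nat j :: real) ^ r))"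
      by (subst sum.swap) (simp add: sum_distrib_left)
    also have "\<dots> = 0" using Suc.IH Suc.prems Suc by (intro sum.neutral) auto
    finally show ?thesis by simp
  qed
qed simp

lemma poly_alternating_sum:
  fixes p :: "real poly"
  assumes "degree p \<le> k"
  shows "(\<Sum>j\<le>Suc k. (-1) ^ j * of_nat (Suc k choose j) * poly p (of_nat j * h)) = 0"
proof -
  have "(\<Sum>j\<le>Suc k. (-1) ^ j * of_nat (Suc k choose j) * poly p (of_nat j * h))
      = (\<Sum>j\<le>Suc k. \<Sum>i\<le>degree p. coeff p i * h ^ i * ((-1) ^ j * of_nat (Suc k choose j) * of_nat j ^ i))"
    by (simp add: poly_altdef sum_distrib_left power_mult_distrib mult_ac del: sum.atMost_Suc binomial_Suc_Suc)
  also have "\<dots> = (\<Sum>i\<le>degree p. coeff p i * h ^ i * (\<Sum>j\<le>Suc k. (-1) ^ j * of_nat (Suc k choose j) * of_nat j ^ i))"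
    by (subst sum.swap) (simp add: sum_distrib_left del: sum.atMost_Suc binomial_Suc_Suc)
  also have "\<dots> = 0"
    using assms by (intro sum.neutral) (auto simp: alternating_binomial_power_sum simp del: sum.atMost_Suc binomial_Suc_Suc)
  finally show ?thesis .
qed

text \<open>
  The alternating binomial sum of the values at \<open>0, h, \<dots>, (k + 1) h\<close> vanishes.
\<close>

lemma poly_large_at_multiple:
  fixes p :: "real poly"
  assumes d: "degree p \<le> k"
  shows "\<exists>j\<in>{1..Suc k}. \<bar>poly p 0\<bar> / 2 ^ Suc k \<le> \<bar>poly p (of_nat j * h)\<bar>"
proof (rule ccontr)
  define e where "e = \<bar>poly p 0\<bar> / 2 ^ Suc k"
  assume "\<not> ?thesis"
  then have lt: "\<bar>poly p (of_nat j * h)\<bar> < e" if "j \<in> {1..Suc k}" for j using that by (auto simp: e_def not_le)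
  have e: "0 < e" using lt[of 1] by (simp add: le_less_trans[OF abs_ge_zero])
  have I: "{..Suc k} = insert 0 {1..Suc k}" by auto
  have "0 = poly p 0 + (\<Sum>j\<in>{1..Suc k}. (-1) ^ j * of_nat (Suc k choose j) * poly p (of_nat j * h))"
    using poly_alternating_sum[OF d, of h] unfolding I by (subst (asm) sum.insert) auto
  then have "\<bar>poly p 0\<bar> = \<bar>\<Sum>j\<in>{1..Suc k}. (-1) ^ j * of_nat (Suc k choose j) * poly p (of_nat j * h)\<bar>" by linarith
  also have "\<dots> \<le> (\<Sum>j\<in>{1..Suc k}. \<bar>(-1) ^ j * of_nat (Suc k choose j) * poly p (of_nat j * h)\<bar>)" by (rule sum_abs)
  also have "\<dots> = (\<Sum>j\<in>{1..Suc k}. of_nat (Suc k choose j) * \<bar>poly p (of_nat j * h)\<bar>)"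
    by (simp add: abs_mult del: binomial_Suc_Suc)
  also have "\<dots> \<le> (\<Sum>j\<in>{1..Suc k}. of_nat (Suc k choose j) * e)"
    using lt by (intro sum_mono mult_left_mono) (auto intro: less_imp_le)
  also have "\<dots> = ((\<Sum>j\<in>{..Suc k}. of_nat (Suc k choose j)) - 1) * e"
  proof -
    have "(\<Sum>j\<in>{..Suc k}. real (Suc k choose j)) = 1 + (\<Sum>j\<in>{1..Suc k}. real (Suc k choose j))"
      unfolding I by (subst sum.insert) auto
    then show ?thesis by (simp only: add_diff_cancel_left' sum_distrib_right)
  qed
  also have "(\<Sum>j\<in>{..Suc k}. of_nat (Suc k choose j)) = (2 ^ Suc k :: real)"
    by (metis choose_row_sum of_nat_numeral of_nat_power of_nat_sum)
  also have "(2 ^ Suc k - 1) * e = \<bar>poly p 0\<bar> - e" by (simp add: e_def field_simps)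
  finally show False using e by simp
qed

text \<open>The sets of \<open>h\<close> with \<open>j * h\<close> in the target cover the interval
  up to \<open>\<delta>\<close>. Each is a contraction of the target by \<open>j \<ge> 1\<close>, so
  its measure is no larger, and there are \<open>K\<close> of them.\<close>

lemma emeasure_multiples:
  fixes \<delta> :: real
  assumes E: "E \<in> sets borel" and d: "0 < \<delta>" and K: "0 < K"
    and c: "\<And>h. 0 < h \<Longrightarrow> h \<le> \<delta> \<Longrightarrow> \<exists>j\<in>{1..K}. of_nat j * h \<in> E"
  shows "ennreal \<delta> \<le> of_nat K * emeasure lborel (E \<inter> {0<..of_nat K * \<delta>})"
proof -
  let ?F = "E \<inter> {0<..of_nat K * \<delta>}"
  have F: "?F \<in> sets borel" using E by simp
  have sj: "{h. of_nat j * h \<in> ?F} \<in> sets borel" for j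
  proof -
    have "(\<lambda>h. of_nat j * h) -` ?F \<inter> space borel \<in> sets borel"
      by (rule measurable_sets[OF _ F]) measurable
    then show ?thesis by (simp add: vimage_def)
  qed
  have "{0<..\<delta>} \<subseteq> (\<Union>j\<in>{1..K}. {h. of_nat j * h \<in> ?F})"
  proof
    fix h assume h: "h \<in> {0<..\<delta>}"
    then obtain j where j: "j \<in> {1..K}" "of_nat j * h \<in> E" using c[of h] by fastforce
    have "of_nat j * h \<le> of_nat K * \<delta>" using j h by (intro mult_mono) auto
    then show "h \<in> (\<Union>j\<in>{1..K}. {h. of_nat j * h \<in> ?F})" using j h by auto
  qed
  then have "emeasure lborel {0<..\<delta>} \<le> emeasure lborel (\<Union>j\<in>{1..K}. {h. of_nat j * h \<in> ?F})"
    using sj by (intro emeasure_mono) auto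
  also have "\<dots> \<le> (\<Sum>j\<in>{1..K}. emeasure lborel {h. of_nat j * h \<in> ?F})"
    using sj by (intro emeasure_subadditive_finite) auto
  also have "\<dots> \<le> (\<Sum>j\<in>{1..K}. emeasure lborel ?F)"
  proof (rule sum_mono)
    fix j assume "j \<in> {1..K}"
    then have j: "1 \<le> real j" by auto
    have "emeasure lborel ?F = (\<integral>\<^sup>+ x. indicator ?F x \<partial>lborel)" using F by simp
    also have "\<dots> = ennreal \<bar>real j\<bar> * (\<integral>\<^sup>+ h. indicator ?F (0 + real j * h) \<partial>lborel)"
      using F j by (intro nn_integral_real_affine) auto
    also have "(\<integral>\<^sup>+ h. indicator ?F (0 + real j * h) \<partial>lborel) = (\<integral>\<^sup>+ h. indicator {h. of_nat j * h \<in> ?F} h \<partial>lborel)"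
      by (intro nn_integral_cong) (auto simp: indicator_def)
    also have "\<dots> = emeasure lborel {h. of_nat j * h \<in> ?F}" using sj by simp
    finally have "emeasure lborel ?F = ennreal (real j) * emeasure lborel {h. of_nat j * h \<in> ?F}" by simp
    moreover have "1 * emeasure lborel {h. of_nat j * h \<in> ?F} \<le> ennreal (real j) * emeasure lborel {h. of_nat j * h \<in> ?F}"
      using j by (intro mult_right_mono) (auto simp: ennreal_1[symmetric] simp del: ennreal_1 intro!: ennreal_leI)
    ultimately show "emeasure lborel {h. of_nat j * h \<in> ?F} \<le> emeasure lborel ?F" by simp
  qed
  finally show ?thesis using d by simp
qed

text \<open>The least value of the density on the unit interval, divided by \<open>Suc k\<close>
  once for the choice of \<open>\<delta>\<close> and once for the covering in
  \<open>emeasure_multiples\<close>.\<close>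

definition line_const :: "nat \<Rightarrow> real" where "line_const k = std_normal_density 1 / (real (Suc k))\<^sup>2"

lemma line_const_pos: "0 < line_const k"
  unfolding line_const_def by (intro divide_pos_pos normal_density_pos) auto

lemma std_gaussian_poly_large:
  fixes p :: "real poly"
  assumes d: "degree p \<le> k" and T: "1 \<le> T"
  shows "line_const k / T \<le> measure std_gaussian {g. 0 < g \<and> g \<le> 1 / T \<and> \<bar>poly p 0\<bar> / 2 ^ Suc k \<le> \<bar>poly p g\<bar>}"
proof -
  \<comment> \<open>The largest multiple \<open>Suc k * \<delta>\<close> is then exactly
    \<open>1 / T\<close>.\<close>
  define \<delta> where "\<delta> = 1 / (T * real (Suc k))"
  have dd: "0 < \<delta>" "real (Suc k) * \<delta> = 1 / T" using T by (auto simp: \<delta>_def)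
  let ?E = "{g. \<bar>poly p 0\<bar> / 2 ^ Suc k \<le> \<bar>poly p g\<bar>}"
  let ?F = "?E \<inter> {0<..1 / T}"
  have "continuous_on UNIV (\<lambda>g. \<bar>poly p g\<bar>)" by (intro continuous_intros)
  then have [measurable]: "(\<lambda>g. \<bar>poly p g\<bar>) \<in> borel_measurable borel" by (rule borel_measurable_continuous_onI)
  have E: "?E \<in> sets borel" by measurable
  have "ennreal \<delta> \<le> of_nat (Suc k) * emeasure lborel (?E \<inter> {0<..of_nat (Suc k) * \<delta>})"
    by (rule emeasure_multiples[OF E dd(1)]) (use poly_large_at_multiple[OF d] in auto)
  then have b: "ennreal \<delta> \<le> of_nat (Suc k) * emeasure lborel ?F" using dd by simp
  let ?c = "std_normal_density 1"
  have c0: "0 < ?c" by (rule normal_density_pos) simp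
  have "ennreal ?c * emeasure lborel ?F = (\<integral>\<^sup>+ x. ennreal ?c * indicator ?F x \<partial>lborel)"
    using E by (simp add: nn_integral_cmult)
  also have "\<dots> \<le> (\<integral>\<^sup>+ x. ennreal (std_normal_density x) * indicator ?F x \<partial>lborel)"
  proof (rule nn_integral_mono)
    fix x
    have "?c \<le> std_normal_density x" if "x \<in> ?F"
    proof -
      have "x \<le> 1 / T" "0 < x" using that by auto
      moreover have "1 / T \<le> 1" using T by simp
      ultimately have "x\<^sup>2 \<le> 1" by (simp add: power_le_one)
      then have "exp (- 1\<^sup>2 / 2) \<le> exp (- x\<^sup>2 / 2)" by simp
      then show ?thesis unfolding std_normal_density_def by (intro mult_left_mono) auto
    qed
    then show "ennreal ?c * indicator ?F x \<le> ennreal (std_normal_density x) * indicator ?F x"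
      by (auto simp: indicator_def intro: ennreal_leI)
  qed
  also have "\<dots> = emeasure std_gaussian ?F"
    unfolding std_gaussian_def using E by (subst emeasure_density) auto
  finally have "of_nat (Suc k) * (ennreal ?c * emeasure lborel ?F) \<le> of_nat (Suc k) * emeasure std_gaussian ?F"
    by (rule mult_left_mono) simp
  then have "ennreal ?c * (of_nat (Suc k) * emeasure lborel ?F) \<le> of_nat (Suc k) * emeasure std_gaussian ?F"
    by (simp only: mult.left_commute)
  moreover have "ennreal ?c * ennreal \<delta> \<le> ennreal ?c * (of_nat (Suc k) * emeasure lborel ?F)"
    using b by (intro mult_left_mono) auto
  ultimately have "ennreal ?c * ennreal \<delta> \<le> of_nat (Suc k) * emeasure std_gaussian ?F" by (rule order_trans[rotated])
  then have "ennreal (?c * \<delta>) \<le> ennreal (real (Suc k) * measure std_gaussian ?F)"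
    using c0 dd by (simp add: ennreal_mult ennreal_of_nat_eq_real_of_nat std_gaussian.emeasure_eq_measure less_imp_le)
  then have "?c * \<delta> \<le> real (Suc k) * measure std_gaussian ?F"
    by (subst (asm) ennreal_le_iff) auto
  moreover have "line_const k / T = ?c * \<delta> / real (Suc k)" by (simp add: line_const_def \<delta>_def power2_eq_square)
  moreover have "?F = {g. 0 < g \<and> g \<le> 1 / T \<and> \<bar>poly p 0\<bar> / 2 ^ Suc k \<le> \<bar>poly p g\<bar>}" by auto
  ultimately show ?thesis by (simp add: pos_divide_le_eq mult.commute)
qed

section \<open>Moving the first row along a line: a rank-one update\<close>

definition col0_nsq :: "nat \<Rightarrow> (nat \<times> nat \<Rightarrow> real) \<Rightarrow> real" where
  "col0_nsq n x = (\<Sum>j<n. (ginv n x j 0)\<^sup>2)"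

text \<open>
  Let \<open>w\<close> be the normalised first column of the inverse \<open>A\<close>, a unit vector orthogonal to all rows but the first,
  and let \<open>\<gamma>\<close> be its inner product with the first row. When \<open>\<gamma>\<close> varies and everything else is fixed,
  \<open>\<gamma> A = \<gamma> A\<^sub>1 + (1 - \<gamma>) w z\<^sup>T\<close> with \<open>A\<^sub>1\<close> and \<open>z\<close> fixed. The vectors \<open>z\<close> and \<open>w\<close>
  are \<open>zvec\<close> and \<open>wvec\<close>; both are 0 for singular matrices.
\<close>

definition zvec :: "nat \<Rightarrow> (nat \<times> nat \<Rightarrow> real) \<Rightarrow> nat \<Rightarrow> real" where
  "zvec n x i = (\<Sum>j<n. ginv n x j i * ginv n x j 0) / col0_nsq n x"

definition wvec :: "nat \<Rightarrow> (nat \<times> nat \<Rightarrow> real) \<Rightarrow> nat \<Rightarrow> real" where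
  "wvec n x j = ginv n x j 0 / sqrt (col0_nsq n x)"

definition zw_inner :: "nat \<Rightarrow> (nat \<times> nat \<Rightarrow> real) \<Rightarrow> real" where
  "zw_inner n x = (\<Sum>i<n. zvec n x i * wvec n x i)"

text \<open>For invertible matrices this is the bilinear form of the \<open>k\<close>-th power of
  the inverse in the unit vectors \<open>w\<close> and \<open>z / \<parallel>z\<parallel>\<close>,
  hence a lower bound for its operator norm.\<close>

definition wz_form :: "nat \<Rightarrow> nat \<Rightarrow> (nat \<times> nat \<Rightarrow> real) \<Rightarrow> real" where
  "wz_form n k x = (\<Sum>i<n. \<Sum>j<n. wvec n x i * gpow n x k i j * (zvec n x j / sqrt (nsq n (zvec n x))))"

text \<open>The Sherman--Morrison formula with base point \<open>x1\<close>, the matrix at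
  \<open>\<gamma> = 1\<close>. Adding \<open>(g - 1) u\<close> to the first row has denominator
  \<open>1 + (g - 1) * 1 = g\<close>, because the first column of the base inverse is the unit
  vector \<open>u\<close> itself.\<close>

lemma rank_one_update:
  assumes n: "0 < n" and d1: "det (gmat n x1) \<noteq> 0" and g: "g \<noteq> 0"
    and u: "\<And>j. j < n \<Longrightarrow> u j = ginv n x1 j 0" and u1: "(\<Sum>j<n. (u j)\<^sup>2) = 1"
    and z: "\<And>i. i < n \<Longrightarrow> z i = (\<Sum>j<n. ginv n x1 j i * u j)"
    and r0: "\<And>j. j < n \<Longrightarrow> x (0, j) = x1 (0, j) + (g - 1) * u j"
    and r: "\<And>i j. 0 < i \<Longrightarrow> i < n \<Longrightarrow> j < n \<Longrightarrow> x (i, j) = x1 (i, j)"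
  shows "det (gmat n x) \<noteq> 0"
    and "\<And>i j. i < n \<Longrightarrow> j < n \<Longrightarrow> ginv n x i j = ginv n x1 i j + (1 / g - 1) * (u i * z j)"
proof -
  define B where "B = Matrix.mat n n (\<lambda>(i, j). ginv n x1 i j + (1 / g - 1) * (u i * z j))"
  have B: "B \<in> carrier_mat n n" by (simp add: B_def)
  have xu: "(\<Sum>l<n. x1 (i, l) * u l) = (if i = 0 then 1 else 0)" if "i < n" for i
    using ginv_right[OF d1 that n] u by simp
  have uA: "(\<Sum>l<n. u l * ginv n x1 l j) = z j" if "j < n" for j
    using z[OF that] by (simp add: mult.commute)
  have uu: "(\<Sum>l<n. u l * u l) = 1" using u1 by (simp add: power2_eq_square)
  have "gmat n x * B = 1\<^sub>m n"
  proof (rule eq_matI)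
    fix i j assume "i < dim_row (1\<^sub>m n :: real mat)" "j < dim_col (1\<^sub>m n :: real mat)"
    then have ij: "i < n" "j < n" by auto
    have "(gmat n x * B) $$ (i, j) = (\<Sum>l<n. gmat n x $$ (i, l) * B $$ (l, j))"
      using B ij by (intro mat_mult_entry[where l=n]) auto
    also have "\<dots> = (\<Sum>l<n. x (i, l) * ginv n x1 l j) + (1 / g - 1) * z j * (\<Sum>l<n. x (i, l) * u l)"
      using ij by (simp add: B_def distrib_left sum.distrib sum_distrib_left mult_ac)
    also have "\<dots> = (if i = j then 1 else 0)"
    proof (cases "i = 0")
      case True
      have "(\<Sum>l<n. x (i, l) * ginv n x1 l j) = (\<Sum>l<n. x1 (0, l) * ginv n x1 l j) + (g - 1) * (\<Sum>l<n. u l * ginv n x1 l j)"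
      proof -
        have "(\<Sum>l<n. x (i, l) * ginv n x1 l j) = (\<Sum>l<n. x1 (0, l) * ginv n x1 l j + (g - 1) * (u l * ginv n x1 l j))"
          using True by (intro sum.cong refl) (simp add: r0 algebra_simps)
        then show ?thesis by (simp only: sum.distrib sum_distrib_left)
      qed
      also have "\<dots> = (if i = j then 1 else 0) + (g - 1) * z j"
        using ginv_right[OF d1 n ij(2)] True by (simp add: uA[OF ij(2)])
      finally have 1: "(\<Sum>l<n. x (i, l) * ginv n x1 l j) = (if i = j then 1 else 0) + (g - 1) * z j" .
      have "(\<Sum>l<n. x (i, l) * u l) = (\<Sum>l<n. x1 (0, l) * u l) + (g - 1) * (\<Sum>l<n. u l * u l)"
      proof -
        have "(\<Sum>l<n. x (i, l) * u l) = (\<Sum>l<n. x1 (0, l) * u l + (g - 1) * (u l * u l))"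
          using True by (intro sum.cong refl) (simp add: r0 algebra_simps)
        then show ?thesis by (simp only: sum.distrib sum_distrib_left)
      qed
      also have "\<dots> = g" using xu[OF n] uu by simp
      finally have 2: "(\<Sum>l<n. x (i, l) * u l) = g" .
      have "(if i = j then 1 else 0) + (g - 1) * z j + (1 / g - 1) * z j * g = (if i = j then 1 else 0)"
        using g by (simp add: field_simps)
      then show ?thesis unfolding 1 2 .
    next
      case False
      have "(\<Sum>l<n. x (i, l) * ginv n x1 l j) = (\<Sum>l<n. x1 (i, l) * ginv n x1 l j)"
        using False ij by (intro sum.cong refl) (simp add: r)
      moreover have "(\<Sum>l<n. x (i, l) * u l) = (\<Sum>l<n. x1 (i, l) * u l)"
        using False ij by (intro sum.cong refl) (simp add: r)
      ultimately show ?thesis using False xu[OF ij(1)] ginv_right[OF d1 ij] by simp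
    qed
    finally show "(gmat n x * B) $$ (i, j) = (1\<^sub>m n :: real mat) $$ (i, j)" using ij by simp
  qed (use B in auto)
  then show "det (gmat n x) \<noteq> 0" and "\<And>i j. i < n \<Longrightarrow> j < n \<Longrightarrow> ginv n x i j = ginv n x1 i j + (1 / g - 1) * (u i * z j)"
    using det_inverse_ne_zero[OF gmat_carrier(1) B] inv_mat_unique[OF gmat_carrier(1) B]
    by (auto simp: ginv_def B_def)
qed

text \<open>
  Entries of the powers of \<open>\<gamma> A + (1 - \<gamma>) u z\<^sup>T\<close> as polynomials in \<open>\<gamma>\<close>.
\<close>

fun line_poly :: "nat \<Rightarrow> (nat \<Rightarrow> nat \<Rightarrow> real) \<Rightarrow> (nat \<Rightarrow> real) \<Rightarrow> (nat \<Rightarrow> real) \<Rightarrow> nat \<Rightarrow> nat \<Rightarrow> nat \<Rightarrow> real poly" where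
  "line_poly n A u z 0 i j = [:if i = j then 1 else 0:]"
| "line_poly n A u z (Suc k) i j = (\<Sum>l<n. line_poly n A u z k i l * [:u l * z j, A l j - u l * z j:])"

lemma degree_line_poly: "degree (line_poly n A u z k i j) \<le> k"
proof (induction k arbitrary: j)
  case (Suc k)
  show ?case unfolding line_poly.simps
  proof (rule degree_sum_le)
    fix l
    have "degree (line_poly n A u z k i l * [:u l * z j, A l j - u l * z j:]) \<le> degree (line_poly n A u z k i l) + degree [:u l * z j, A l j - u l * z j:]"
      by (rule degree_mult_le)
    also have "\<dots> \<le> k + 1" using Suc by (intro add_mono) auto
    finally show "degree (line_poly n A u z k i l * [:u l * z j, A l j - u l * z j:]) \<le> Suc k" by simp
  qed simp
qed simp

text \<open>At 0 the matrix is the rank-one matrix with entries \<open>u l * z j\<close>, and each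
  further power contributes a factor equal to the inner product of \<open>z\<close> and
  \<open>u\<close>.\<close>

lemma poly_line_poly_0:
  assumes "i < n"
  shows "j < n \<Longrightarrow> poly (line_poly n A u z (Suc k) i j) 0 = u i * (\<Sum>l<n. z l * u l) ^ k * z j"
proof (induction k arbitrary: j)
  case 0
  have "poly (line_poly n A u z (Suc 0) i j) 0 = (\<Sum>l<n. if l = i then u l * z j else 0)"
    by (simp only: line_poly.simps poly_sum poly_mult poly_pCons) (intro sum.cong, auto)
  then show ?case using assms by simp
next
  case (Suc k)
  have "poly (line_poly n A u z (Suc (Suc k)) i j) 0 = (\<Sum>l<n. poly (line_poly n A u z (Suc k) i l) 0 * (u l * z j))"
    by (simp only: line_poly.simps(2)[of n A u z "Suc k"] poly_sum poly_mult poly_pCons) simp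
  also have "\<dots> = (\<Sum>l<n. u i * (\<Sum>l<n. z l * u l) ^ k * z j * (z l * u l))"
    using Suc by (intro sum.cong refl) (simp add: mult_ac)
  also have "\<dots> = u i * (\<Sum>l<n. z l * u l) ^ k * z j * (\<Sum>l<n. z l * u l)" by (simp add: sum_distrib_left)
  finally show ?case by (simp add: mult_ac)
qed

lemma poly_line_poly:
  assumes A: "\<And>i j. i < n \<Longrightarrow> j < n \<Longrightarrow> ginv n x i j = A i j + (1 / g - 1) * (u i * z j)" and g: "g \<noteq> 0" and i: "i < n"
  shows "j < n \<Longrightarrow> poly (line_poly n A u z k i j) g = g ^ k * gpow n x k i j"
proof (induction k arbitrary: j)
  case (Suc k)
  have e: "poly [:u l * z j, A l j - u l * z j:] g = g * ginv n x l j" if "l < n" for l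
    using A[OF that Suc.prems] g by (simp add: field_simps)
  have "poly (line_poly n A u z (Suc k) i j) g = (\<Sum>l<n. g ^ k * gpow n x k i l * (g * ginv n x l j))"
    unfolding line_poly.simps poly_sum poly_mult by (rule sum.cong[OF refl]) (simp only: lessThan_iff e Suc.IH)
  then show ?case by (simp add: sum_distrib_left mult_ac)
qed simp

lemma measurable_col0_nsq [measurable]: "0 < n \<Longrightarrow> col0_nsq n \<in> borel_measurable (gaussian_entries n)"
  unfolding col0_nsq_def by (intro borel_measurable_sum borel_measurable_power measurable_ginv) auto

lemma measurable_zvec [measurable]: "i < n \<Longrightarrow> (\<lambda>x. zvec n x i) \<in> borel_measurable (gaussian_entries n)"
  unfolding zvec_def by (intro borel_measurable_divide borel_measurable_sum borel_measurable_times measurable_ginv measurable_col0_nsq) auto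

lemma measurable_wvec [measurable]: "i < n \<Longrightarrow> (\<lambda>x. wvec n x i) \<in> borel_measurable (gaussian_entries n)"
  unfolding wvec_def by measurable

lemma measurable_zw_inner [measurable]: "zw_inner n \<in> borel_measurable (gaussian_entries n)"
  unfolding zw_inner_def by (intro borel_measurable_sum borel_measurable_times measurable_zvec measurable_wvec) auto

lemma measurable_nsq_zvec [measurable]: "(\<lambda>x. nsq n (zvec n x)) \<in> borel_measurable (gaussian_entries n)"
  unfolding nsq_def by (intro borel_measurable_sum borel_measurable_power measurable_zvec) auto

lemma measurable_wz_form [measurable]: "wz_form n k \<in> borel_measurable (gaussian_entries n)"
proof -
  have "(\<lambda>x. wvec n x i * gpow n x k i j * (zvec n x j / sqrt (nsq n (zvec n x)))) \<in> borel_measurable (gaussian_entries n)"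
    if "i < n" "j < n" for i j
    using that by measurable
  then show ?thesis unfolding wz_form_def by (intro borel_measurable_sum) auto
qed

text \<open>Along the line \<open>z\<close> is constant and \<open>w\<close> changes only its sign,
  so the leading coefficient depends on the other data alone and is independent of
  \<open>\<gamma>\<close> up to sign.\<close>

lemma rank_one_quantities:
  assumes n: "0 < n" and d1: "det (gmat n x1) \<noteq> 0" and g: "g \<noteq> 0"
    and u: "\<And>j. j < n \<Longrightarrow> u j = ginv n x1 j 0" and u1: "(\<Sum>j<n. (u j)\<^sup>2) = 1"
    and z: "\<And>i. i < n \<Longrightarrow> z i = (\<Sum>j<n. ginv n x1 j i * u j)"
    and r0: "\<And>j. j < n \<Longrightarrow> x (0, j) = x1 (0, j) + (g - 1) * u j"
    and r: "\<And>i j. 0 < i \<Longrightarrow> i < n \<Longrightarrow> j < n \<Longrightarrow> x (i, j) = x1 (i, j)"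
  shows "\<And>i. i < n \<Longrightarrow> zvec n x i = z i" "\<And>i. i < n \<Longrightarrow> wvec n x i = sgn g * u i"
    "nsq n (zvec n x) = nsq n z" "1 \<le> nsq n z"
    "zw_inner n x = sgn g * (\<Sum>i<n. z i * u i)"
proof -
  have R: "ginv n x i j = ginv n x1 i j + (1 / g - 1) * (u i * z j)" if "i < n" "j < n" for i j
    by (rule rank_one_update(2)[OF n d1 g u u1 z r0 r]) (use that in auto)
  have uu: "(\<Sum>l<n. u l * u l) = 1" using u1 by (simp add: power2_eq_square)
  \<comment> \<open>The first coordinate of \<open>z\<close> pairs the unit vector \<open>u\<close>
    with itself; this makes the first column of the new inverse \<open>u / g\<close>.\<close>
  have z0: "z 0 = 1" using z[OF n] u uu by (simp add: )
  have c0: "ginv n x j 0 = u j / g" if "j < n" for j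
    using R[OF that n] u[OF that] z0 g by (simp add: field_simps)
  have col: "col0_nsq n x = 1 / g\<^sup>2"
    using u1 by (simp add: col0_nsq_def c0 power_divide sum_divide_distrib[symmetric])
  show zvec: "zvec n x i = z i" if i: "i < n" for i
  proof -
    have "(\<Sum>j<n. ginv n x j i * ginv n x j 0) = (\<Sum>j<n. (ginv n x1 j i * u j + (1 / g - 1) * z i * (u j * u j)) / g)"
    proof (rule sum.cong[OF refl])
      fix j assume "j \<in> {..<n}"
      then have j: "j < n" by simp
      show "ginv n x j i * ginv n x j 0 = (ginv n x1 j i * u j + (1 / g - 1) * z i * (u j * u j)) / g"
        unfolding c0[OF j] R[OF j i] by (simp add: algebra_simps add_divide_distrib diff_divide_distrib)
    qed
    also have "\<dots> = ((\<Sum>j<n. ginv n x1 j i * u j) + (1 / g - 1) * z i * (\<Sum>j<n. u j * u j)) / g"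
      by (simp add: sum_divide_distrib[symmetric] sum.distrib sum_distrib_left)
    also have "\<dots> = (z i + (1 / g - 1) * z i * 1) / g" by (simp only: uu z[OF i])
    also have "\<dots> = z i / g\<^sup>2" using g by (simp add: field_simps power2_eq_square)
    finally show ?thesis using g by (simp add: zvec_def col)
  qed
  have sq: "sqrt (1 / g\<^sup>2) = 1 / \<bar>g\<bar>" by (simp add: real_sqrt_divide)
  show w: "wvec n x i = sgn g * u i" if i: "i < n" for i
    using g i by (simp add: wvec_def c0 col sq) (simp add: sgn_if)
  show "nsq n (zvec n x) = nsq n z" by (simp add: nsq_def zvec)
  have "(z 0)\<^sup>2 \<le> nsq n z" unfolding nsq_def using n by (intro member_le_sum) auto
  then show "1 \<le> nsq n z" using z0 by simp
  show "zw_inner n x = sgn g * (\<Sum>i<n. z i * u i)"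
    by (simp add: zw_inner_def zvec w sum_distrib_left mult_ac)
qed

text \<open>The form times \<open>g ^ Suc k\<close> is a combination of the polynomials
  \<open>line_poly\<close> with fixed coefficients. At 0 the two rank-one factors are evaluated on
  \<open>u\<close> and \<open>z / \<parallel>z\<parallel>\<close>, which leaves one norm of
  \<open>z\<close>. The polynomial is chosen before \<open>g\<close>, so it serves the whole
  line.\<close>

lemma wz_form_rank_one:
  assumes n: "0 < n" and d1: "det (gmat n x1) \<noteq> 0"
    and u: "\<And>j. j < n \<Longrightarrow> u j = ginv n x1 j 0" and u1: "(\<Sum>j<n. (u j)\<^sup>2) = 1"
    and z: "\<And>i. i < n \<Longrightarrow> z i = (\<Sum>j<n. ginv n x1 j i * u j)"
  shows "\<exists>p. degree p \<le> Suc k \<and> poly p 0 = (\<Sum>i<n. z i * u i) ^ k * sqrt (nsq n z) \<and>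
    (\<forall>g x. g \<noteq> 0 \<longrightarrow> (\<forall>j<n. x (0, j) = x1 (0, j) + (g - 1) * u j) \<longrightarrow> (\<forall>i j. 0 < i \<longrightarrow> i < n \<longrightarrow> j < n \<longrightarrow> x (i, j) = x1 (i, j))
      \<longrightarrow> \<bar>wz_form n (Suc k) x\<bar> = \<bar>poly p g\<bar> / \<bar>g\<bar> ^ Suc k)"
proof -
  let ?s = "sqrt (nsq n z)"
  define p where "p = (\<Sum>i<n. \<Sum>j<n. Polynomial.smult (u i * (z j / ?s)) (line_poly n (ginv n x1) u z (Suc k) i j))"
  have nz: "1 \<le> nsq n z"
    by (rule rank_one_quantities(4)[OF n d1 one_neq_zero u u1 z, of x1]) auto
  have "degree p \<le> Suc k" unfolding p_def
    by (intro degree_sum_le order_trans[OF degree_smult_le degree_line_poly]) auto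
  moreover have "poly p 0 = (\<Sum>i<n. z i * u i) ^ k * ?s"
  proof -
    have "poly p 0 = (\<Sum>i<n. \<Sum>j<n. (u i)\<^sup>2 * ((\<Sum>l<n. z l * u l) ^ k * ((z j)\<^sup>2 / ?s)))"
      by (simp add: p_def poly_sum poly_line_poly_0 power2_eq_square mult_ac del: line_poly.simps)
    also have "\<dots> = (\<Sum>i<n. (u i)\<^sup>2) * ((\<Sum>l<n. z l * u l) ^ k * (nsq n z / ?s))"
      by (simp add: sum_product[symmetric] sum_distrib_left[symmetric] sum_divide_distrib[symmetric] nsq_def sum_distrib_right)
    also have "nsq n z / ?s = ?s" using nz by (simp add: real_div_sqrt)
    finally show ?thesis using u1 by simp
  qed
  moreover have "\<bar>wz_form n (Suc k) x\<bar> = \<bar>poly p g\<bar> / \<bar>g\<bar> ^ Suc k"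
    if g: "g \<noteq> 0" and r0: "\<forall>j<n. x (0, j) = x1 (0, j) + (g - 1) * u j"
      and r: "\<forall>i j. 0 < i \<longrightarrow> i < n \<longrightarrow> j < n \<longrightarrow> x (i, j) = x1 (i, j)" for g x
  proof -
    have R: "ginv n x i j = ginv n x1 i j + (1 / g - 1) * (u i * z j)" if "i < n" "j < n" for i j
      by (rule rank_one_update(2)[OF n d1 g u u1 z r0[rule_format] r[rule_format]]) (use that in auto)
    have Q1: "zvec n x i = z i" if "i < n" for i
      by (rule rank_one_quantities(1)[OF n d1 g u u1 z r0[rule_format] r[rule_format]]) (use that in auto)
    have Q2: "wvec n x i = sgn g * u i" if "i < n" for i
      by (rule rank_one_quantities(2)[OF n d1 g u u1 z r0[rule_format] r[rule_format]]) (use that in auto)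
    have Q3: "nsq n (zvec n x) = nsq n z" by (simp add: nsq_def Q1)
    have "poly p g = (\<Sum>i<n. \<Sum>j<n. u i * (z j / ?s) * (g ^ Suc k * gpow n x (Suc k) i j))"
      unfolding p_def poly_sum poly_smult
    proof (rule sum.cong[OF refl], rule sum.cong[OF refl])
      fix i j assume "i \<in> {..<n}" "j \<in> {..<n}"
      then show "u i * (z j / ?s) * poly (line_poly n (ginv n x1) u z (Suc k) i j) g = u i * (z j / ?s) * (g ^ Suc k * gpow n x (Suc k) i j)"
        using poly_line_poly[where A="ginv n x1", OF R g, of i j "Suc k"] by simp
    qed
    also have "\<dots> = g ^ Suc k * (\<Sum>i<n. \<Sum>j<n. u i * gpow n x (Suc k) i j * (z j / ?s))"
      by (simp only: sum_distrib_left mult_ac)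
    finally have P: "poly p g = g ^ Suc k * (\<Sum>i<n. \<Sum>j<n. u i * gpow n x (Suc k) i j * (z j / ?s))" .
    have "wz_form n (Suc k) x = (\<Sum>i<n. \<Sum>j<n. sgn g * (u i * gpow n x (Suc k) i j * (z j / ?s)))"
      unfolding wz_form_def Q3 by (intro sum.cong refl) (simp add: Q1 Q2 del: gpow.simps)
    also have "\<dots> = sgn g * (\<Sum>i<n. \<Sum>j<n. u i * gpow n x (Suc k) i j * (z j / ?s))"
      by (simp only: sum_distrib_left)
    finally have "\<bar>wz_form n (Suc k) x\<bar> = \<bar>\<Sum>i<n. \<Sum>j<n. u i * gpow n x (Suc k) i j * (z j / ?s)\<bar>"
      using g by (simp add: abs_mult abs_sgn_eq del: gpow.simps)
    then show ?thesis using P g by (simp add: abs_mult power_abs del: gpow.simps power_Suc)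
  qed
  ultimately show ?thesis by blast
qed

text \<open>One direction of linearity survives without measurability of \<open>f\<close>. It is
  applied to conditional probabilities whose measurability is left open.\<close>

lemma nn_integral_cmult_le: "c * (\<integral>\<^sup>+ x. f x \<partial>M) \<le> (\<integral>\<^sup>+ x. c * f x \<partial>M)"
proof -
  have "c * (\<integral>\<^sup>+ x. f x \<partial>M) = (SUP g\<in>{g. simple_function M g \<and> g \<le> f}. c * integral\<^sup>S M g)"
    unfolding nn_integral_def by (rule SUP_mult_left_ennreal)
  also have "\<dots> \<le> (\<integral>\<^sup>+ x. c * f x \<partial>M)"
  proof (rule SUP_least)
    fix g assume g: "g \<in> {g. simple_function M g \<and> g \<le> f}"
    then have "c * integral\<^sup>S M g = (\<integral>\<^sup>+ x. c * g x \<partial>M)"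
      by (subst nn_integral_cmult) (auto simp: nn_integral_eq_simple_integral borel_measurable_simple_function)
    also have "\<dots> \<le> (\<integral>\<^sup>+ x. c * f x \<partial>M)"
      using g by (intro nn_integral_mono mult_left_mono) (auto simp: le_fun_def)
    finally show "c * integral\<^sup>S M g \<le> (\<integral>\<^sup>+ x. c * f x \<partial>M)" .
  qed
  finally show ?thesis .
qed

lemma preserves_inverse:
  assumes T: "preserves M T" and S: "S \<in> measurable M M" and ST: "\<And>x. x \<in> space M \<Longrightarrow> S (T x) = x"
  shows "preserves M S"
proof (rule preservesI[OF S])
  fix f :: "'a \<Rightarrow> ennreal" assume f: "f \<in> borel_measurable M"
  have "(\<lambda>x. f (S x)) \<in> borel_measurable M" using S f by (rule measurable_compose)
  from preserves_nn_integral[OF T this]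
  have "(\<integral>\<^sup>+ x. f (S x) \<partial>M) = (\<integral>\<^sup>+ x. f (S (T x)) \<partial>M)" by simp
  also have "\<dots> = (\<integral>\<^sup>+ x. f x \<partial>M)" by (rule nn_integral_cong) (simp add: ST)
  finally show "(\<integral>\<^sup>+ x. f (S x) \<partial>M) = (\<integral>\<^sup>+ x. f x \<partial>M)" .
qed

lemma measurable_mat_act:
  fixes K :: "'i set"
  assumes inj: "inj_on \<sigma> {..<n}" and K: "\<sigma> ` {..<n} \<subseteq> K"
  shows "mat_act n \<sigma> Q \<in> measurable (gauss K) (gauss K)"
proof (rule measurable_PiM_single')
  fix k assume k: "k \<in> K"
  have "(\<lambda>x. mat_act n \<sigma> Q x k) \<in> borel_measurable (gauss K)"
  proof (cases "k \<in> \<sigma> ` {..<n}")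
    case True
    then obtain i where i: "i < n" "k = \<sigma> i" by auto
    show ?thesis unfolding i(2) mat_act_apply[OF inj i(1)] using K
      by (intro borel_measurable_sum borel_measurable_times measurable_entry) auto
  next
    case False
    then show ?thesis using measurable_entry[OF k] by (simp add: mat_act_other)
  qed
  then show "(\<lambda>x. mat_act n \<sigma> Q x k) \<in> measurable (gauss K) std_gaussian"
    by (simp add: measurable_cong_sets[OF refl sets_std_gaussian])
next
  show "mat_act n \<sigma> Q \<in> space (gauss K) \<rightarrow> (\<Pi>\<^sub>E i\<in>K. space std_gaussian)"
  proof (intro Pi_I PiE_I)
    fix x k assume x: "x \<in> space (gauss K)" and k: "k \<notin> K"
    have "k \<notin> \<sigma> ` {..<n}" using K k by blast
    then show "mat_act n \<sigma> Q x k = undefined" using x k by (simp add: mat_act_other space_gauss)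
  qed simp
qed

text \<open>Invariance of the measure passes to the inverse map, here the action of the
  transpose.\<close>

lemma gauss_rot_transpose:
  assumes "Q \<in> gauss_rot n"
  shows "transpose_mat Q \<in> gauss_rot n"
proof -
  note q = gauss_rotD[OF assms]
  have c: "transpose_mat Q \<in> carrier_mat n n" using q by simp
  have "preserves (gauss K) (mat_act n \<sigma> (transpose_mat Q))"
    if K: "finite K" "inj_on \<sigma> {..<n}" "\<sigma> ` {..<n} \<subseteq> K" for K :: "(nat \<times> nat) set" and \<sigma>
  proof (rule preserves_inverse[OF q(4)[OF K] measurable_mat_act[OF K(2,3)]])
    fix x
    show "mat_act n \<sigma> (transpose_mat Q) (mat_act n \<sigma> Q x) = x"
      using mat_act_mult[OF K(2) c q(1), of x] q(3) mat_act_one[OF K(2)] by simp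
  qed
  then show ?thesis unfolding gauss_rot_def using c q by auto
qed

lemma gauss_rot_rows_orth:
  assumes "Q \<in> gauss_rot n" "i < n" "k < n"
  shows "(\<Sum>j<n. Q $$ (i, j) * Q $$ (k, j)) = (if i = k then 1 else 0)"
proof -
  note q = gauss_rotD[OF assms(1)]
  have "(Q * transpose_mat Q) $$ (i, k) = (\<Sum>j<n. Q $$ (i, j) * transpose_mat Q $$ (j, k))"
    using q assms by (intro mat_mult_entry[where l=n]) auto
  also have "\<dots> = (\<Sum>j<n. Q $$ (i, j) * Q $$ (k, j))" using q assms by (intro sum.cong) auto
  finally show ?thesis using q(2) assms by simp
qed

text \<open>The quantity bounded from below is the modulus at 0 of the polynomial of
  \<open>wz_form_rank_one\<close>. Up to the point 0 the event is constant along a line.\<close>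

definition zw_large :: "nat \<Rightarrow> nat \<Rightarrow> real \<Rightarrow> (nat \<times> nat \<Rightarrow> real) \<Rightarrow> bool" where
  "zw_large n k L x \<longleftrightarrow> det (gmat n x) \<noteq> 0 \<and> L \<le> \<bar>zw_inner n x\<bar> ^ k * sqrt (nsq n (zvec n x))"

definition wz_form_large :: "nat \<Rightarrow> nat \<Rightarrow> real \<Rightarrow> (nat \<times> nat \<Rightarrow> real) \<Rightarrow> bool" where
  "wz_form_large n k L x \<longleftrightarrow> det (gmat n x) \<noteq> 0 \<and> L \<le> \<bar>wz_form n k x\<bar>"

lemma sets_zw_large: "{x\<in>space (gaussian_entries n). zw_large n k L x} \<in> sets (gaussian_entries n)"
  unfolding zw_large_def by measurable

lemma sets_wz_form_large: "{x\<in>space (gaussian_entries n). wz_form_large n k L x} \<in> sets (gaussian_entries n)"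
  unfolding wz_form_large_def by measurable

text \<open>The first row runs through the line in the direction of the cofactor vector
  \<open>C\<close>, with orthogonal offset \<open>y\<close>. If the event \<open>zw_large\<close>
  occurs anywhere on the line, the value of the polynomial at 0 is large, and
  \<open>std_gaussian_poly_large\<close> finds enough good \<open>\<gamma>\<close>; otherwise the
  left side is 0.\<close>

lemma wz_form_large_line:
  fixes T L N :: real
  assumes n: "0 < n" and T: "1 \<le> T"
    and C: "(\<Sum>j<n. (C j)\<^sup>2) = N" and N: "0 < N"
    and y: "(\<Sum>j<n. y j * C j) = 0"
    and cof: "\<And>g j. j < n \<Longrightarrow> cofactor (gmat n (X g)) 0 j = C j"
    and X0: "\<And>g j. j < n \<Longrightarrow> X g (0, j) = g * (C j / sqrt N) + y j"
    and X1: "\<And>g i j. 0 < i \<Longrightarrow> i < n \<Longrightarrow> j < n \<Longrightarrow> X g (i, j) = x (i, j)"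
    and sG: "{g. zw_large n k L (X g)} \<in> sets borel" and sB: "{g. wz_form_large n (Suc k) (T ^ Suc k * L / 2 ^ Suc (Suc k)) (X g)} \<in> sets borel"
  shows "ennreal (line_const (Suc k) / T) * emeasure std_gaussian {g. zw_large n k L (X g)}
    \<le> emeasure std_gaussian {g. wz_form_large n (Suc k) (T ^ Suc k * L / 2 ^ Suc (Suc k)) (X g)}"
proof -
  define u where "u j = C j / sqrt N" for j
  have u1: "(\<Sum>j<n. (u j)\<^sup>2) = 1"
    using N by (simp add: u_def power_divide C sum_divide_distrib[symmetric])
  have det: "det (gmat n (X g)) = g * sqrt N" for g
  proof -
    have "det (gmat n (X g)) = (\<Sum>j<n. g / sqrt N * (C j)\<^sup>2 + y j * C j)"
      unfolding det_expand_row[OF n] by (intro sum.cong refl) (simp add: cof X0 algebra_simps power2_eq_square)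
    also have "\<dots> = g / sqrt N * N" by (simp only: sum.distrib sum_distrib_left[symmetric] C y add_0_right)
    also have "\<dots> = g * sqrt N" using N by (simp add: real_div_sqrt field_simps)
    finally show ?thesis .
  qed
  have d1: "det (gmat n (X 1)) \<noteq> 0" using det[of 1] N by simp
  have u: "u j = ginv n (X 1) j 0" if "j < n" for j
    using that n by (simp add: ginv_cofactor cof det u_def)
  define z where "z i = (\<Sum>j<n. ginv n (X 1) j i * u j)" for i
  have r0: "X g (0, j) = X 1 (0, j) + (g - 1) * u j" if "j < n" for g j
    using that by (simp add: X0 u_def algebra_simps diff_divide_distrib)
  have r1: "X g (i, j) = X 1 (i, j)" if "0 < i" "i < n" "j < n" for g i j
    using that by (simp add: X1)
  have "\<exists>p. degree p \<le> Suc k \<and> poly p 0 = (\<Sum>i<n. z i * u i) ^ k * sqrt (nsq n z) \<and>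
    (\<forall>g x. g \<noteq> 0 \<longrightarrow> (\<forall>j<n. x (0, j) = X 1 (0, j) + (g - 1) * u j) \<longrightarrow> (\<forall>i j. 0 < i \<longrightarrow> i < n \<longrightarrow> j < n \<longrightarrow> x (i, j) = X 1 (i, j))
      \<longrightarrow> \<bar>wz_form n (Suc k) x\<bar> = \<bar>poly p g\<bar> / \<bar>g\<bar> ^ Suc k)"
    by (rule wz_form_rank_one[OF n d1 u u1 z_def])
  then obtain p where p: "degree p \<le> Suc k" "poly p 0 = (\<Sum>i<n. z i * u i) ^ k * sqrt (nsq n z)"
    and p': "\<forall>g x. g \<noteq> 0 \<longrightarrow> (\<forall>j<n. x (0, j) = X 1 (0, j) + (g - 1) * u j) \<longrightarrow> (\<forall>i j. 0 < i \<longrightarrow> i < n \<longrightarrow> j < n \<longrightarrow> x (i, j) = X 1 (i, j))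
      \<longrightarrow> \<bar>wz_form n (Suc k) x\<bar> = \<bar>poly p g\<bar> / \<bar>g\<bar> ^ Suc k" by (elim exE conjE)
  have p3: "\<bar>wz_form n (Suc k) (X g)\<bar> = \<bar>poly p g\<bar> / \<bar>g\<bar> ^ Suc k" if "g \<noteq> 0" for g
    using p'[THEN spec[of _ g], THEN spec[of _ "X g"]] that r0[of _ g] r1[of _ _ g] by blast
  have G: "zw_large n k L (X g) \<longleftrightarrow> L \<le> \<bar>poly p 0\<bar>" if g: "g \<noteq> 0" for g
  proof -
    have "nsq n (zvec n (X g)) = nsq n z"
      by (rule rank_one_quantities(3)[OF n d1 g u u1 z_def r0 r1]) auto
    moreover have "zw_inner n (X g) = sgn g * (\<Sum>i<n. z i * u i)"
      by (rule rank_one_quantities(5)[OF n d1 g u u1 z_def r0 r1]) auto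
    ultimately show ?thesis using g N by (simp add: zw_large_def det p(2) abs_mult power_abs abs_sgn_eq)
  qed
  have G0: "\<not> zw_large n k L (X 0)" by (simp add: zw_large_def det)
  show ?thesis
  proof (cases "L \<le> \<bar>poly p 0\<bar>")
    case False
    then have "{g. zw_large n k L (X g)} = {}" using G G0 by (metis Collect_empty_eq)
    then show ?thesis by simp
  next
    case True
    have "{g. 0 < g \<and> g \<le> 1 / T \<and> \<bar>poly p 0\<bar> / 2 ^ Suc (Suc k) \<le> \<bar>poly p g\<bar>}
        \<subseteq> {g. wz_form_large n (Suc k) (T ^ Suc k * L / 2 ^ Suc (Suc k)) (X g)}"
    proof clarify
      fix g assume g: "0 < g" "g \<le> 1 / T" "\<bar>poly p 0\<bar> / 2 ^ Suc (Suc k) \<le> \<bar>poly p g\<bar>"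
      \<comment> \<open>On this range the division by \<open>g ^ Suc k\<close> gains at least the
        factor \<open>T ^ Suc k\<close>.\<close>
      have "T * g \<le> 1" using g T by (simp add: field_simps)
      then have "(T * g) ^ Suc k \<le> 1" using g T by (intro power_le_one) auto
      then have Tg: "T ^ Suc k * g ^ Suc k \<le> 1" by (simp only: power_mult_distrib)
      have "L / 2 ^ Suc (Suc k) \<le> \<bar>poly p 0\<bar> / 2 ^ Suc (Suc k)" using True by (intro divide_right_mono) auto
      then have L: "L / 2 ^ Suc (Suc k) \<le> \<bar>poly p g\<bar>" using g by linarith
      have "T ^ Suc k * L / 2 ^ Suc (Suc k) \<le> T ^ Suc k * \<bar>poly p g\<bar>"
        using L T by (simp only: times_divide_eq_right[symmetric]) (intro mult_left_mono, auto)
      also have "\<dots> \<le> \<bar>poly p g\<bar> / g ^ Suc k"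
      proof -
        have "T ^ Suc k * g ^ Suc k * \<bar>poly p g\<bar> \<le> 1 * \<bar>poly p g\<bar>" using Tg by (intro mult_right_mono) auto
        then show ?thesis using g by (simp add: pos_le_divide_eq mult_ac)
      qed
      also have "\<dots> = \<bar>wz_form n (Suc k) (X g)\<bar>" using g by (simp add: p3)
      finally show "wz_form_large n (Suc k) (T ^ Suc k * L / 2 ^ Suc (Suc k)) (X g)"
        using g N by (simp add: wz_form_large_def det)
    qed
    then have "measure std_gaussian {g. 0 < g \<and> g \<le> 1 / T \<and> \<bar>poly p 0\<bar> / 2 ^ Suc (Suc k) \<le> \<bar>poly p g\<bar>}
        \<le> measure std_gaussian {g. wz_form_large n (Suc k) (T ^ Suc k * L / 2 ^ Suc (Suc k)) (X g)}"
      using sB by (intro std_gaussian.finite_measure_mono) auto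
    then have "line_const (Suc k) / T \<le> measure std_gaussian {g. wz_form_large n (Suc k) (T ^ Suc k * L / 2 ^ Suc (Suc k)) (X g)}"
      using std_gaussian_poly_large[OF p(1) T] by linarith
    then have "ennreal (line_const (Suc k) / T) * 1 \<le> emeasure std_gaussian {g. wz_form_large n (Suc k) (T ^ Suc k * L / 2 ^ Suc (Suc k)) (X g)}"
      by (simp add: std_gaussian.emeasure_eq_measure ennreal_leI)
    moreover have "ennreal (line_const (Suc k) / T) * emeasure std_gaussian {g. zw_large n k L (X g)} \<le> ennreal (line_const (Suc k) / T) * 1"
      by (intro mult_left_mono std_gaussian.emeasure_le_1) simp
    ultimately show ?thesis by (rule order_trans[rotated])
  qed
qed

lemma sets_section_PiM:
  fixes X :: "real \<Rightarrow> 'i \<Rightarrow> real"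
  assumes "{x\<in>space (gauss K). P x} \<in> sets (gauss K)" "X \<in> measurable borel (gauss K)"
  shows "{g. P (X g)} \<in> sets borel"
proof -
  have "{g. P (X g)} = X -` {x\<in>space (gauss K). P x} \<inter> space borel"
    using measurable_space[OF assms(2)] by auto
  then show ?thesis using measurable_sets[OF assms(2,1)] by simp
qed

text \<open>Fubini twice: first the other rows are fixed, which fixes the direction
  \<open>u\<close>, then all coordinates of the first row orthogonal to \<open>u\<close>. What
  remains is the line in \<open>\<gamma>\<close>, and the bound on it is integrated back.\<close>

lemma wz_form_large_ge_zw_large:
  fixes T L :: real
  assumes n: "0 < n" and T: "1 \<le> T"
  shows "line_const (Suc k) / T * measure (gaussian_entries n) {x\<in>space (gaussian_entries n). zw_large n k L x}
    \<le> measure (gaussian_entries n) {x\<in>space (gaussian_entries n). wz_form_large n (Suc k) (T ^ Suc k * L / 2 ^ Suc (Suc k)) x}"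
proof -
  let ?M = "gaussian_entries n"
  let ?B = "wz_form_large n (Suc k) (T ^ Suc k * L / 2 ^ Suc (Suc k))"
  let ?G = "zw_large n k L"
  let ?I = "other_rows n 0" let ?J = "rowi n 0" let ?J' = "{0 :: nat} \<times> {1..<n}"
  let ?c = "ennreal (line_const (Suc k) / T)"
  have UJ: "?I \<union> ?J = {0..<n} \<times> {0..<n}" using other_rows_un_row[OF n] .
  have sG: "{x\<in>space (gauss (?I \<union> ?J)). ?G x} \<in> sets (gauss (?I \<union> ?J))"
    and sB: "{x\<in>space (gauss (?I \<union> ?J)). ?B x} \<in> sets (gauss (?I \<union> ?J))"
    using sets_zw_large[of n k L] sets_wz_form_large[of n] unfolding gaussian_entries_split[OF n] by auto
  have J: "?J = insert (0, 0) ?J'" using n by auto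
  have fJ: "finite ?J'" "(0, 0) \<notin> ?J'" by auto
  have inner: "?c * emeasure (gauss ?J) {y\<in>space (gauss ?J). ?G (merge ?I ?J (x, y))}
      \<le> emeasure (gauss ?J) {y\<in>space (gauss ?J). ?B (merge ?I ?J (x, y))}"
    if x: "x \<in> space (gauss ?I)" for x
  proof -
    let ?z = "\<lambda>y. merge ?I ?J (x, y)"
    define C where "C j = cofactor (gmat n x) 0 j" for j
    define N where "N = (\<Sum>j<n. (C j)\<^sup>2)"
    have N0: "0 \<le> N" by (simp add: N_def sum_nonneg)
    have cof: "cofactor (gmat n (?z y)) 0 j = C j" if "j < n" for y j
      unfolding C_def using n that by (intro cofactor_row_cong) (auto simp: merge_def)
    have sGx: "{y\<in>space (gauss ?J). ?G (?z y)} \<in> sets (gauss ?J)" by (rule sets_merge_section[OF sG x])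
    have sBx: "{y\<in>space (gauss ?J). ?B (?z y)} \<in> sets (gauss ?J)" by (rule sets_merge_section[OF sB x])
    show ?thesis
    proof (cases "N = 0")
      case True
      have "C j = 0" if "j < n" for j using True that by (simp add: N_def sum_nonneg_eq_0_iff)
      then have "\<not> ?G (?z y)" for y
        unfolding zw_large_def det_expand_row[OF n] by (simp add: cof)
      then show ?thesis by simp
    next
      case False
      then have N: "0 < N" using N0 by simp
      define u where "u j = C j / sqrt N" for j
      have u1: "(\<Sum>j<n. (u j)\<^sup>2) = 1"
        using N by (simp add: u_def power_divide N_def[symmetric] sum_divide_distrib[symmetric])
      obtain Q where Q: "Q \<in> gauss_rot n" and q0: "\<And>j. j < n \<Longrightarrow> Q $$ (0, j) = u j"
        using gauss_rot_exists[OF n u1] by blast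
      let ?s = "\<lambda>j :: nat. (0 :: nat, j)"
      \<comment> \<open>The transpose rebuilds the row from its rotated coordinates: the coordinate
        0 is \<open>\<gamma>\<close> and multiplies \<open>u\<close>, the others form the
        offset.\<close>
      let ?S = "mat_act n ?s (transpose_mat Q)"
      have inj: "inj_on ?s {..<n}" by (auto simp: inj_on_def)
      have pS: "preserves (gauss ?J) ?S"
        by (rule gauss_rotD(4)[OF gauss_rot_transpose[OF Q] _ inj]) auto
      have Sj: "?S b (0, j) = (\<Sum>l<n. Q $$ (l, j) * b (0, l))" if "j < n" for b j
        using mat_act_apply[OF inj that, of "transpose_mat Q" b] gauss_rotD(1)[OF Q] that by (auto intro!: sum.cong)
      have red: "emeasure (gauss ?J) {y\<in>space (gauss ?J). P (?z y)}
          = (\<integral>\<^sup>+ b. emeasure std_gaussian {g. P (?z (?S (b((0, 0) := g))))} \<partial>gauss ?J')"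
        and sP: "\<And>b. b \<in> space (gauss ?J') \<Longrightarrow> {g. P (?z (?S (b((0, 0) := g))))} \<in> sets borel"
        if sp: "{y\<in>space (gauss ?J). P (?z y)} \<in> sets (gauss ?J)" for P
      proof -
        have mS: "?S \<in> measurable (gauss ?J) (gauss ?J)" using pS by (simp add: preserves_def)
        have sp2: "{y\<in>space (gauss ?J). P (?z (?S y))} \<in> sets (gauss ?J)"
        proof -
          have "{y\<in>space (gauss ?J). P (?z (?S y))} = ?S -` {y\<in>space (gauss ?J). P (?z y)} \<inter> space (gauss ?J)"
            using measurable_space[OF mS] by auto
          then show ?thesis using measurable_sets[OF mS sp] by simp
        qed
        have mu: "(\<lambda>g. b((0, 0) := g)) \<in> measurable borel (gauss ?J)" if b: "b \<in> space (gauss ?J')" for b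
          unfolding J using b fJ by measurable
        show sP: "{g. P (?z (?S (b((0, 0) := g))))} \<in> sets borel" if b: "b \<in> space (gauss ?J')" for b
          by (rule sets_section_PiM[OF sp2 mu[OF b]])
        have "emeasure (gauss ?J) {y\<in>space (gauss ?J). P (?z y)} = emeasure (gauss ?J) {y\<in>space (gauss ?J). P (?z (?S y))}"
          using preserves_measure[OF pS sp] by (simp add: gauss_prob.emeasure_eq_measure)
        also have "\<dots> = (\<integral>\<^sup>+ y. indicator {y\<in>space (gauss ?J). P (?z (?S y))} y \<partial>gauss ?J)" using sp2 by simp
        also have "\<dots> = (\<integral>\<^sup>+ b. \<integral>\<^sup>+ g. indicator {y\<in>space (gauss ?J). P (?z (?S y))} (b((0, 0) := g)) \<partial>std_gaussian \<partial>gauss ?J')"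
          using sp2 unfolding J by (intro gauss_prod.product_nn_integral_insert fJ) auto
        also have "\<dots> = (\<integral>\<^sup>+ b. emeasure std_gaussian {g. P (?z (?S (b((0, 0) := g))))} \<partial>gauss ?J')"
        proof (rule nn_integral_cong)
          fix b assume b: "b \<in> space (gauss ?J')"
          have "(\<integral>\<^sup>+ g. indicator {y\<in>space (gauss ?J). P (?z (?S y))} (b((0, 0) := g)) \<partial>std_gaussian)
            = (\<integral>\<^sup>+ g. indicator {g. P (?z (?S (b((0, 0) := g))))} g \<partial>std_gaussian)"
            by (rule nn_integral_cong) (use measurable_space[OF mu[OF b]] in \<open>auto simp: indicator_def\<close>)
          then show "(\<integral>\<^sup>+ g. indicator {y\<in>space (gauss ?J). P (?z (?S y))} (b((0, 0) := g)) \<partial>std_gaussian)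
            = emeasure std_gaussian {g. P (?z (?S (b((0, 0) := g))))}" using sP[OF b] by simp
        qed
        finally show "emeasure (gauss ?J) {y\<in>space (gauss ?J). P (?z y)}
          = (\<integral>\<^sup>+ b. emeasure std_gaussian {g. P (?z (?S (b((0, 0) := g))))} \<partial>gauss ?J')" .
      qed
      have line: "?c * emeasure std_gaussian {g. ?G (?z (?S (b((0, 0) := g))))}
          \<le> emeasure std_gaussian {g. ?B (?z (?S (b((0, 0) := g))))}" if b: "b \<in> space (gauss ?J')" for b
      proof (rule wz_form_large_line[where C=C and x=x and y="\<lambda>j. \<Sum>l\<in>{1..<n}. Q $$ (l, j) * b (0, l)" and N=N, OF n T N_def[symmetric] N])
        have I: "{..<n} = insert 0 {1..<n}" using n by auto
        \<comment> \<open>The later rows of \<open>Q\<close> are orthogonal to its first row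
          \<open>u\<close>; hence the offset is orthogonal to \<open>C\<close>.\<close>
        have o: "(\<Sum>j<n. Q $$ (l, j) * u j) = 0" if "l \<in> {1..<n}" for l
          using gauss_rot_rows_orth[OF Q, of l 0] that n q0 by simp
        have "(\<Sum>j<n. (\<Sum>l\<in>{1..<n}. Q $$ (l, j) * b (0, l)) * u j) = (\<Sum>l\<in>{1..<n}. b (0, l) * (\<Sum>j<n. Q $$ (l, j) * u j))"
          by (simp add: sum_distrib_right sum_distrib_left, subst sum.swap) (simp add: mult_ac)
        also have "\<dots> = 0" by (simp add: o)
        finally have "(\<Sum>j<n. (\<Sum>l\<in>{1..<n}. Q $$ (l, j) * b (0, l)) * C j) / sqrt N = 0"
          by (simp add: u_def sum_divide_distrib)
        then show "(\<Sum>j<n. (\<Sum>l\<in>{1..<n}. Q $$ (l, j) * b (0, l)) * C j) = 0" using N by simp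
        fix g i j assume j: "j < n"
        show "cofactor (gmat n (?z (?S (b((0, 0) := g))))) 0 j = C j" by (rule cof[OF j])
        have "?z (?S (b((0, 0) := g))) (0, j) = ?S (b((0, 0) := g)) (0, j)"
          using j by (simp add: merge_def)
        also have "\<dots> = (\<Sum>l<n. Q $$ (l, j) * (b((0, 0) := g)) (0, l))" by (rule Sj[OF j])
        also have "\<dots> = Q $$ (0, j) * g + (\<Sum>l\<in>{1..<n}. Q $$ (l, j) * (b((0, 0) := g)) (0, l))"
          unfolding I by (subst sum.insert) auto
        also have "(\<Sum>l\<in>{1..<n}. Q $$ (l, j) * (b((0, 0) := g)) (0, l)) = (\<Sum>l\<in>{1..<n}. Q $$ (l, j) * b (0, l))"
          by (intro sum.cong) auto
        also have "Q $$ (0, j) * g = g * (C j / sqrt N)" by (simp add: q0[OF j] u_def)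
        finally show "?z (?S (b((0, 0) := g))) (0, j) = g * (C j / sqrt N) + (\<Sum>l\<in>{1..<n}. Q $$ (l, j) * b (0, l))" .
        assume i: "0 < i" "i < n"
        show "?z (?S (b((0, 0) := g))) (i, j) = x (i, j)" using i j by (simp add: merge_def)
      next
        show "{g. ?G (?z (?S (b((0, 0) := g))))} \<in> sets borel" by (rule sP[OF sGx b])
        show "{g. ?B (?z (?S (b((0, 0) := g))))} \<in> sets borel" by (rule sP[OF sBx b])
      qed
      have "?c * emeasure (gauss ?J) {y\<in>space (gauss ?J). ?G (?z y)}
          \<le> (\<integral>\<^sup>+ b. ?c * emeasure std_gaussian {g. ?G (?z (?S (b((0, 0) := g))))} \<partial>gauss ?J')"
        unfolding red[OF sGx] by (rule nn_integral_cmult_le)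
      also have "\<dots> \<le> (\<integral>\<^sup>+ b. emeasure std_gaussian {g. ?B (?z (?S (b((0, 0) := g))))} \<partial>gauss ?J')"
        by (rule nn_integral_mono) (rule line)
      also have "\<dots> = emeasure (gauss ?J) {y\<in>space (gauss ?J). ?B (?z y)}" by (rule red[OF sBx, symmetric])
      finally show ?thesis .
    qed
  qed
  have "?c * emeasure ?M {x\<in>space ?M. ?G x} \<le> emeasure ?M {x\<in>space ?M. ?B x}"
  proof -
    have IJ: "finite ?I" "finite ?J" "?I \<inter> ?J = {}" by auto
    have "?c * emeasure ?M {x\<in>space ?M. ?G x}
        \<le> (\<integral>\<^sup>+ x. ?c * emeasure (gauss ?J) {y\<in>space (gauss ?J). ?G (merge ?I ?J (x, y))} \<partial>gauss ?I)"
      unfolding gaussian_entries_split[OF n] emeasure_merge[OF IJ sG] by (rule nn_integral_cmult_le)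
    also have "\<dots> \<le> (\<integral>\<^sup>+ x. emeasure (gauss ?J) {y\<in>space (gauss ?J). ?B (merge ?I ?J (x, y))} \<partial>gauss ?I)"
      by (rule nn_integral_mono) (rule inner)
    also have "\<dots> = emeasure ?M {x\<in>space ?M. ?B x}"
      unfolding gaussian_entries_split[OF n] by (rule emeasure_merge[OF IJ sB, symmetric])
    finally show ?thesis .
  qed
  moreover have c0: "0 \<le> line_const (Suc k) / T" using line_const_pos[of "Suc k"] T by simp
  ultimately have "ennreal (line_const (Suc k) / T * measure ?M {x\<in>space ?M. ?G x}) \<le> ennreal (measure ?M {x\<in>space ?M. ?B x})"
    by (simp only: ge.emeasure_eq_measure ennreal_mult[OF c0 measure_nonneg])
  then show ?thesis by (subst (asm) ennreal_le_iff) auto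
qed

section \<open>Lower bounds for the leading coefficient\<close>

text \<open>The matrix with row \<open>i\<close> replaced by 0 is singular; a kernel vector is
  normalised.\<close>

lemma kernel_unit:
  fixes r :: "nat \<Rightarrow> nat \<Rightarrow> real"
  assumes i: "i < n"
  shows "\<exists>v. (\<Sum>j<n. (v j)\<^sup>2) = 1 \<and> (\<forall>l<n. l \<noteq> i \<longrightarrow> (\<Sum>j<n. r l j * v j) = 0)"
proof -
  define x where "x = (\<lambda>(l, j). if l = i then 0 else r l j)"
  have "det (gmat n x) = 0" unfolding det_expand_row[OF i] by (simp add: x_def)
  then obtain v where v: "v \<in> carrier_vec n" "v \<noteq> 0\<^sub>v n" "gmat n x *\<^sub>v v = 0\<^sub>v n"
    using det_0_iff_vec_prod_zero[OF gmat_carrier(1), of n x] by blast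
  define w where "w = vec_index v"
  have nz: "\<exists>i<n. w i \<noteq> 0"
  proof (rule ccontr)
    assume "\<not> ?thesis"
    then have "v = 0\<^sub>v n" using v(1) by (intro eq_vecI) (auto simp: w_def)
    then show False using v(2) by simp
  qed
  then obtain m where m: "m < n" "w m \<noteq> 0" by auto
  have "0 < (w m)\<^sup>2" using m by simp
  also have "\<dots> \<le> nsq n w" unfolding nsq_def using m by (intro member_le_sum) auto
  finally have p: "0 < nsq n w" .
  have z: "(\<Sum>j<n. r l j * w j) = 0" if "l < n" "l \<noteq> i" for l
  proof -
    have "(\<Sum>j<n. gmat n x $$ (l, j) * vec_index v j) = vec_index (gmat n x *\<^sub>v v) l"
      by (rule mult_mat_vec_entry[OF gmat_carrier(1) v(1) that(1), symmetric])
    also have "\<dots> = 0" unfolding v(3) using that by simp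
    finally show ?thesis using that by (simp add: w_def x_def)
  qed
  let ?v = "\<lambda>j. 1 / sqrt (nsq n w) * w j"
  have "nsq n ?v = 1" using p by (simp only: nsq_scale) (simp add: power_divide)
  then have "(\<Sum>j<n. (?v j)\<^sup>2) = 1" by (simp only: nsq_def)
  moreover have "(\<Sum>j<n. r l j * ?v j) = 0" if "l < n" "l \<noteq> i" for l
  proof -
    have "(\<Sum>j<n. r l j * ?v j) = 1 / sqrt (nsq n w) * (\<Sum>j<n. r l j * w j)"
      by (simp only: sum_distrib_left mult_ac)
    then show ?thesis using z[OF that] by simp
  qed
  ultimately show ?thesis by (intro exI[of _ ?v] conjI allI impI)
qed

text \<open>The second application of \<open>kernel_unit\<close> frees row 0 and puts
  \<open>u\<close> in place of row \<open>i\<close>, so that \<open>u'\<close> is orthogonal to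
  \<open>u\<close> as well.\<close>

lemma orthonormal_pair:
  fixes r :: "nat \<Rightarrow> nat \<Rightarrow> real"
  assumes i: "0 < i" "i < n"
  shows "\<exists>u u'. (\<Sum>j<n. (u j)\<^sup>2) = 1 \<and> (\<Sum>j<n. (u' j)\<^sup>2) = 1 \<and> (\<Sum>j<n. u j * u' j) = 0 \<and>
    (\<forall>l<n. l \<noteq> 0 \<longrightarrow> l \<noteq> i \<longrightarrow> (\<Sum>j<n. r l j * u j) = 0 \<and> (\<Sum>j<n. r l j * u' j) = 0)"
proof -
  have n: "0 < n" using i by simp
  obtain u where u: "(\<Sum>j<n. (u j)\<^sup>2) = 1" "\<And>l. l < n \<Longrightarrow> l \<noteq> i \<Longrightarrow> (\<Sum>j<n. r l j * u j) = 0"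
    using kernel_unit[OF i(2), of r] by blast
  obtain u' where u': "(\<Sum>j<n. (u' j)\<^sup>2) = 1"
    "\<And>l. l < n \<Longrightarrow> l \<noteq> 0 \<Longrightarrow> (\<Sum>j<n. (if l = i then u j else r l j) * u' j) = 0"
    using kernel_unit[OF n, of "\<lambda>l j. if l = i then u j else r l j"] by blast
  have "(\<Sum>j<n. u j * u' j) = 0" using u'(2)[of i] i by simp
  moreover have "(\<Sum>j<n. r l j * u' j) = 0" if "l < n" "l \<noteq> 0" "l \<noteq> i" for l
    using u'(2)[OF that(1,2)] that by simp
  ultimately show ?thesis using u u'(1) by blast
qed

text \<open>
  The first and the \<open>i\<close>-th column of the inverse span the plane orthogonal to the other rows, so that only a
  two by two matrix has to be inverted.
\<close>

lemma zvec_two_plane: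
  assumes i: "0 < i" "i < n" and d: "det (gmat n x) \<noteq> 0"
    and u: "(\<Sum>j<n. (u j)\<^sup>2) = 1" and u': "(\<Sum>j<n. (u' j)\<^sup>2) = 1" and uu': "(\<Sum>j<n. u j * u' j) = 0"
    and o: "\<And>l. l < n \<Longrightarrow> l \<noteq> 0 \<Longrightarrow> l \<noteq> i \<Longrightarrow> (\<Sum>j<n. x (l, j) * u j) = 0 \<and> (\<Sum>j<n. x (l, j) * u' j) = 0"
    and al: "\<alpha> = (\<Sum>j<n. x (i, j) * u j)" and be: "\<beta> = (\<Sum>j<n. x (i, j) * u' j)"
    and a: "a = (\<Sum>j<n. x (0, j) * u j)" and b: "b = (\<Sum>j<n. x (0, j) * u' j)"
  shows "0 < \<alpha>\<^sup>2 + \<beta>\<^sup>2" and "zvec n x i = - (a * \<alpha> + b * \<beta>) / (\<alpha>\<^sup>2 + \<beta>\<^sup>2)"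
proof -
  have n: "0 < n" using i by simp
  define D where "D = a * \<beta> - b * \<alpha>"
  have lin: "(\<Sum>j<n. x (l, j) * (p * u j + q * u' j)) = p * (\<Sum>j<n. x (l, j) * u j) + q * (\<Sum>j<n. x (l, j) * u' j)" for l p q
    by (simp add: sum_distrib_left sum.distrib algebra_simps)
  have ip: "(\<Sum>j<n. (p * u j + q * u' j) * (p' * u j + q' * u' j)) = p * p' + q * q'" for p q p' q'
  proof -
    have "(\<Sum>j<n. (p * u j + q * u' j) * (p' * u j + q' * u' j))
        = (\<Sum>j<n. p * p' * (u j)\<^sup>2 + q * q' * (u' j)\<^sup>2 + (p * q' + q * p') * (u j * u' j))"
      by (intro sum.cong refl) (simp add: algebra_simps power2_eq_square)
    then show ?thesis by (simp only: sum.distrib sum_distrib_left[symmetric] u u' uu' mult_1_right mult_zero_right add_0_right)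
  qed
  \<comment> \<open>The vector \<open>v\<close> annihilates row \<open>i\<close> and
    \<open>w\<close> annihilates row 0; both give \<open>D\<close> on the other one of the two rows.
    So they are \<open>D\<close> times the first and the \<open>i\<close>-th column of the
    inverse.\<close>
  define v where "v j = \<beta> * u j + (- \<alpha>) * u' j" for j
  define w where "w j = (- b) * u j + a * u' j" for j
  have V: "(\<Sum>j<n. x (l, j) * v j) = (if l = 0 then D else 0)" if "l < n" for l
    unfolding v_def lin using o[OF that] by (cases "l = 0"; cases "l = i") (auto simp: a[symmetric] b[symmetric] al[symmetric] be[symmetric] D_def)
  have W: "(\<Sum>j<n. x (l, j) * w j) = (if l = i then D else 0)" if "l < n" for l
    unfolding w_def lin using o[OF that] i by (cases "l = 0"; cases "l = i") (auto simp: a[symmetric] b[symmetric] al[symmetric] be[symmetric] D_def)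
  have v: "v j = ginv n x j 0 * D" if "j < n" for j
    using ginv_solve[OF d V that] n by (simp add: if_distrib cong: if_cong)
  have w: "w j = ginv n x j i * D" if "j < n" for j
    using ginv_solve[OF d W that] i by (simp add: if_distrib cong: if_cong)
  have vv: "(\<Sum>j<n. v j * v j) = \<beta>\<^sup>2 + \<alpha>\<^sup>2" unfolding v_def ip by (simp add: power2_eq_square)
  have ww: "(\<Sum>j<n. w j * w j) = b\<^sup>2 + a\<^sup>2" unfolding w_def ip by (simp add: power2_eq_square)
  have wvec: "(\<Sum>j<n. w j * v j) = - (a * \<alpha> + b * \<beta>)" unfolding w_def v_def ip by (simp add: algebra_simps)
  \<comment> \<open>Otherwise \<open>v\<close> and \<open>w\<close> vanish, hence so do all four
    coefficients, and the unit vector \<open>u\<close> lies in the kernel.\<close>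
  have D: "D \<noteq> 0"
  proof
    assume D0: "D = 0"
    have "\<beta>\<^sup>2 + \<alpha>\<^sup>2 = 0" using vv v D0 by simp
    moreover have "b\<^sup>2 + a\<^sup>2 = 0" using ww w D0 by simp
    ultimately have z: "\<alpha> = 0" "\<beta> = 0" "a = 0" "b = 0" by (auto simp: sum_power2_eq_zero_iff)
    have U: "(\<Sum>j<n. x (l, j) * u j) = 0" if "l < n" for l
      using o[OF that] z al a by (cases "l = 0"; cases "l = i") auto
    have "u j = 0" if "j < n" for j using ginv_solve[OF d U that] by simp
    then show False using u by simp
  qed
  have A0: "ginv n x j 0 = v j / D" if "j < n" for j using v[OF that] D by simp
  have ginv: "ginv n x j i = w j / D" if "j < n" for j using w[OF that] D by simp
  have col: "col0_nsq n x = (\<alpha>\<^sup>2 + \<beta>\<^sup>2) / D\<^sup>2"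
    using vv by (simp add: col0_nsq_def A0 power_divide sum_divide_distrib[symmetric] power2_eq_square add.commute)
  show p: "0 < \<alpha>\<^sup>2 + \<beta>\<^sup>2"
  proof (rule ccontr)
    assume "\<not> ?thesis"
    then have "\<alpha> = 0" "\<beta> = 0" by (auto simp: not_less sum_power2_le_zero_iff)
    then have "ginv n x j 0 = 0" if "j < n" for j using A0[OF that] by (simp add: v_def)
    then show False using ginv_right[OF d n n] by simp
  qed
  have "(\<Sum>j<n. ginv n x j i * ginv n x j 0) = (\<Sum>j<n. w j * v j) / D\<^sup>2"
    by (simp add: A0 ginv sum_divide_distrib power2_eq_square)
  then show "zvec n x i = - (a * \<alpha> + b * \<beta>) / (\<alpha>\<^sup>2 + \<beta>\<^sup>2)"
    using D by (simp add: zvec_def col wvec)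
qed

lemma std_gaussian_second_moment: "(\<integral>\<^sup>+ y. ennreal (y\<^sup>2) \<partial>std_gaussian) = 1"
proof -
  have "(\<integral>\<^sup>+ y. ennreal (y\<^sup>2) \<partial>std_gaussian) = (\<integral>\<^sup>+ y. ennreal (std_normal_density y * y\<^sup>2) \<partial>lborel)"
    by (subst nn_integral_std_gaussian) (auto simp: ennreal_mult)
  also have "has_bochner_integral lborel (\<lambda>x. std_normal_density x * x ^ (2 * 1)) (fact (2 * 1) / (2 ^ 1 * fact 1))"
    by (rule std_normal_moment_even)
  then have "has_bochner_integral lborel (\<lambda>x. std_normal_density x * x\<^sup>2) 1" by (simp add: fact_2)
  then have "(\<integral>\<^sup>+ y. ennreal (std_normal_density y * y\<^sup>2) \<partial>lborel) = ennreal 1"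
    by (subst nn_integral_eq_integral) (auto simp: has_bochner_integral_iff)
  finally show ?thesis by simp
qed

lemma gauss_inner_second_moment:
  fixes i :: nat and u :: "nat \<Rightarrow> real"
  assumes n: "0 < n" and u: "(\<Sum>j<n. (u j)\<^sup>2) = 1"
  shows "(\<integral>\<^sup>+ a. ennreal ((\<Sum>j<n. a (i, j) * u j)\<^sup>2) \<partial>gauss (rowi n i)) = 1"
proof -
  have m: "(\<lambda>a. \<Sum>j<n. a (i, j) * u j) \<in> borel_measurable (gauss (rowi n i))"
    by (intro borel_measurable_sum borel_measurable_times measurable_entry) auto
  have "(\<integral>\<^sup>+ a. ennreal ((\<Sum>j<n. a (i, j) * u j)\<^sup>2) \<partial>gauss (rowi n i))
      = (\<integral>\<^sup>+ y. ennreal (y\<^sup>2) \<partial>distr (gauss (rowi n i)) borel (\<lambda>a. \<Sum>j<n. a (i, j) * u j))"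
    by (subst nn_integral_distr[OF m]) auto
  then show ?thesis by (simp add: distr_inner_gauss[OF n u] std_gaussian_second_moment)
qed

text \<open>Needed to apply Fubini once more to the conditional probability.\<close>

lemma measurable_emeasure_section:
  assumes s: "{x\<in>space (gauss (I \<union> J)). P x} \<in> sets (gauss (I \<union> J))"
  shows "(\<lambda>x. emeasure (gauss J) {y\<in>space (gauss J). P (merge I J (x, y))}) \<in> borel_measurable (gauss I)"
proof -
  let ?A = "{x\<in>space (gauss (I \<union> J)). P x}"
  have m: "merge I J \<in> measurable (gauss I \<Otimes>\<^sub>M gauss J) (gauss (I \<union> J))" by (rule measurable_merge)
  have "(\<lambda>x. \<integral>\<^sup>+ y. indicator ?A (merge I J (x, y)) \<partial>gauss J) \<in> borel_measurable (gauss I)"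
    using measurable_compose[OF m borel_measurable_indicator[OF s]]
    by (intro gauss_prob.borel_measurable_nn_integral) (simp add: case_prod_beta')
  moreover have "(\<integral>\<^sup>+ y. indicator ?A (merge I J (x, y)) \<partial>gauss J) = emeasure (gauss J) {y\<in>space (gauss J). P (merge I J (x, y))}"
    if x: "x \<in> space (gauss I)" for x
  proof -
    have mx: "(\<lambda>y. merge I J (x, y)) \<in> measurable (gauss J) (gauss (I \<union> J))" using x by measurable
    have "(\<integral>\<^sup>+ y. indicator ?A (merge I J (x, y)) \<partial>gauss J)
       = (\<integral>\<^sup>+ y. indicator {y\<in>space (gauss J). P (merge I J (x, y))} y \<partial>gauss J)"
      by (rule nn_integral_cong) (use measurable_space[OF mx] in \<open>auto simp: indicator_def\<close>)
    then show ?thesis using sets_merge_section[OF s x] by simp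
  qed
  ultimately show ?thesis by (simp cong: measurable_cong)
qed

text \<open>The rows other than 0 and \<open>i\<close> fix the plane, and row \<open>i\<close> fixes
  \<open>\<alpha>\<close>, \<open>\<beta>\<close> and \<open>\<rho>\<close>. Then
  \<open>zvec n x i\<close> is, up to sign, a standard Gaussian variable in the first row divided by
  \<open>\<rho>\<close>, so the conditional probability is at most \<open>c * \<rho>\<close>. The
  factor 3 bounds the mean of \<open>1 + \<alpha>\<^sup>2 + \<beta>\<^sup>2\<close>.\<close>

lemma zvec_small:
  fixes c :: real
  assumes i: "0 < i" "i < n" and c: "0 \<le> c"
  shows "measure (gaussian_entries n) {x\<in>space (gaussian_entries n). det (gmat n x) \<noteq> 0 \<and> \<bar>zvec n x i\<bar> \<le> c} \<le> 3 * c"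
proof -
  have n: "0 < n" using i by simp
  let ?M = "gaussian_entries n"
  let ?P = "\<lambda>x. det (gmat n x) \<noteq> 0 \<and> \<bar>zvec n x i\<bar> \<le> c"
  let ?I = "other_rows n 0" let ?J = "rowi n 0" let ?R = "({0..<n} - {0, i}) \<times> {0..<n}" let ?W = "rowi n i"
  have RW: "?R \<union> ?W = ?I" "?R \<inter> ?W = {}" using i by auto
  have IJ: "finite ?I" "finite ?J" "?I \<inter> ?J = {}" by auto
  have "{x\<in>space ?M. ?P x} \<in> sets ?M" using i by measurable
  then have s: "{x\<in>space (gauss (?I \<union> ?J)). ?P x} \<in> sets (gauss (?I \<union> ?J))"
    unfolding gaussian_entries_split[OF n] .
  let ?g = "\<lambda>x. emeasure (gauss ?J) {y\<in>space (gauss ?J). ?P (merge ?I ?J (x, y))}"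
  have g: "?g \<in> borel_measurable (gauss (?R \<union> ?W))" unfolding RW by (rule measurable_emeasure_section[OF s])
  have "emeasure ?M {x\<in>space ?M. ?P x} = (\<integral>\<^sup>+ x. ?g x \<partial>gauss (?R \<union> ?W))"
    unfolding RW gaussian_entries_split[OF n] by (rule emeasure_merge[OF IJ s])
  also have "\<dots> = (\<integral>\<^sup>+ r. \<integral>\<^sup>+ w. ?g (merge ?R ?W (r, w)) \<partial>gauss ?W \<partial>gauss ?R)"
    by (rule nn_integral_merge[OF _ _ RW(2) g]) auto
  also have "\<dots> \<le> (\<integral>\<^sup>+ r. ennreal (3 * c) \<partial>gauss ?R)"
  proof (rule nn_integral_mono)
    fix r :: "nat \<times> nat \<Rightarrow> real"
    obtain u u' where u: "(\<Sum>j<n. (u j)\<^sup>2) = 1" and u': "(\<Sum>j<n. (u' j)\<^sup>2) = 1" and uu': "(\<Sum>j<n. u j * u' j) = 0"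
      and o: "\<And>l. l < n \<Longrightarrow> l \<noteq> 0 \<Longrightarrow> l \<noteq> i \<Longrightarrow> (\<Sum>j<n. r (l, j) * u j) = 0 \<and> (\<Sum>j<n. r (l, j) * u' j) = 0"
      using orthonormal_pair[OF i, of "\<lambda>l j. r (l, j)"] by blast
    let ?al = "\<lambda>w. \<Sum>j<n. w (i, j) * u j" let ?be = "\<lambda>w. \<Sum>j<n. w (i, j) * u' j"
    have pt: "?g (merge ?R ?W (r, w)) \<le> ennreal (c * (1 + ((?al w)\<^sup>2 + (?be w)\<^sup>2)))" for w
    proof -
      let ?z = "\<lambda>y. merge ?I ?J (merge ?R ?W (r, w), y)"
      have zi: "?z y (i, j) = w (i, j)" and z0: "?z y (0, j) = y (0, j)" if "j < n" for y j
        using i that by (auto simp: merge_def)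
      have zl: "?z y (l, j) = r (l, j)" if "j < n" "l < n" "l \<noteq> 0" "l \<noteq> i" for y l j
        using that by (auto simp: merge_def)
      have oz: "(\<Sum>j<n. ?z y (l, j) * u j) = 0 \<and> (\<Sum>j<n. ?z y (l, j) * u' j) = 0" if "l < n" "l \<noteq> 0" "l \<noteq> i" for y l
        using o[OF that] that by (simp add: zl)
      define \<alpha> where "\<alpha> = ?al w"
      define \<beta> where "\<beta> = ?be w"
      define \<rho> where "\<rho> = sqrt (\<alpha>\<^sup>2 + \<beta>\<^sup>2)"
      have al: "\<alpha> = (\<Sum>j<n. ?z y (i, j) * u j)" and be: "\<beta> = (\<Sum>j<n. ?z y (i, j) * u' j)" for y
        by (simp_all add: \<alpha>_def \<beta>_def zi)
      note tp = zvec_two_plane[OF i _ u u' uu' oz al be refl refl]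
      have \<rho>0: "0 \<le> \<rho>" and \<rho>2: "\<rho>\<^sup>2 = \<alpha>\<^sup>2 + \<beta>\<^sup>2" by (simp_all add: \<rho>_def)
      have "measure (gauss ?J) {y\<in>space (gauss ?J). ?P (?z y)} \<le> c * \<rho>"
      proof (cases "\<rho> = 0")
        case True
        then have z: "\<not> 0 < \<alpha>\<^sup>2 + \<beta>\<^sup>2" using \<rho>2 by simp
        have "\<not> ?P (?z y)" for y
        proof
          assume "?P (?z y)"
          then have "0 < \<alpha>\<^sup>2 + \<beta>\<^sup>2" by (intro tp(1)[of y]) auto
          then show False using z by simp
        qed
        then have "{y\<in>space (gauss ?J). ?P (?z y)} = {}" by blast
        then show ?thesis using True by (simp only: measure_empty mult_zero_right order_refl)
      next
        case False
        then have \<rho>: "0 < \<rho>" using \<rho>0 by simp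
        define t where "t j = (\<alpha> * u j + \<beta> * u' j) / \<rho>" for j
        have t1: "(\<Sum>j<n. (t j)\<^sup>2) = 1"
        proof -
          have "(\<Sum>j<n. (t j)\<^sup>2) = (\<Sum>j<n. \<alpha>\<^sup>2 * (u j)\<^sup>2 + \<beta>\<^sup>2 * (u' j)\<^sup>2 + 2 * \<alpha> * \<beta> * (u j * u' j)) / \<rho>\<^sup>2"
            unfolding sum_divide_distrib t_def by (intro sum.cong refl) (simp add: power_divide power2_sum power_mult_distrib mult_ac)
          also have "\<dots> = 1" using \<rho> by (simp only: sum.distrib sum_distrib_left[symmetric] u u' uu') (simp add: \<rho>2[symmetric])
          finally show ?thesis .
        qed
        have "measure (gauss ?J) {y\<in>space (gauss ?J). ?P (?z y)}
            \<le> measure (gauss ?J) {y\<in>space (gauss ?J). \<bar>(\<Sum>j<n. y (0, j) * t j) - 0\<bar> \<le> c * \<rho>}"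
        proof (rule gauss_prob.finite_measure_mono)
          have [measurable]: "(\<lambda>y. \<Sum>j<n. y (0, j) * t j) \<in> borel_measurable (gauss ?J)"
            by (intro borel_measurable_sum borel_measurable_times measurable_entry) auto
          show "{y\<in>space (gauss ?J). \<bar>(\<Sum>j<n. y (0, j) * t j) - 0\<bar> \<le> c * \<rho>} \<in> sets (gauss ?J)" by measurable
          show "{y\<in>space (gauss ?J). ?P (?z y)} \<subseteq> {y\<in>space (gauss ?J). \<bar>(\<Sum>j<n. y (0, j) * t j) - 0\<bar> \<le> c * \<rho>}"
          proof (rule subsetI)
            fix y assume y: "y \<in> {y\<in>space (gauss ?J). ?P (?z y)}"
            then have d: "det (gmat n (?z y)) \<noteq> 0" and zc: "\<bar>zvec n (?z y) i\<bar> \<le> c" by auto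
            let ?a = "\<Sum>j<n. ?z y (0, j) * u j" let ?b = "\<Sum>j<n. ?z y (0, j) * u' j"
            have "zvec n (?z y) i = - (?a * \<alpha> + ?b * \<beta>) / (\<alpha>\<^sup>2 + \<beta>\<^sup>2)"
              by (rule tp(2)[of y]) (use d in auto)
            moreover have "?a * \<alpha> + ?b * \<beta> = \<rho> * (\<Sum>j<n. y (0, j) * t j)"
            proof -
              have "\<rho> * (\<Sum>j<n. y (0, j) * t j) = (\<Sum>j<n. y (0, j) * u j * \<alpha> + y (0, j) * u' j * \<beta>)"
                unfolding sum_distrib_left
              proof (rule sum.cong[OF refl])
                fix j
                have "\<rho> * t j = \<alpha> * u j + \<beta> * u' j" using \<rho> by (simp add: t_def)
                then show "\<rho> * (y (0, j) * t j) = y (0, j) * u j * \<alpha> + y (0, j) * u' j * \<beta>"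
                  unfolding mult.left_commute[of \<rho>] by (simp add: algebra_simps)
              qed
              then show ?thesis by (simp add: z0 sum_distrib_right sum.distrib)
            qed
            ultimately have zq: "zvec n (?z y) i = - (\<rho> * (\<Sum>j<n. y (0, j) * t j)) / \<rho>\<^sup>2"
              unfolding \<rho>2 by (simp only:)
            have "\<bar>zvec n (?z y) i\<bar> = \<bar>\<Sum>j<n. y (0, j) * t j\<bar> / \<rho>"
              unfolding zq using \<rho> by (simp add: abs_mult power2_eq_square)
            then show "y \<in> {y\<in>space (gauss ?J). \<bar>(\<Sum>j<n. y (0, j) * t j) - 0\<bar> \<le> c * \<rho>}"
              using zc y \<rho> by (simp add: pos_divide_le_eq)
          qed
        qed
        also have "\<dots> \<le> c * \<rho>" using c \<rho>0 by (intro gauss_inner_small[OF n t1]) auto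
        finally show ?thesis .
      qed
      \<comment> \<open>Replaces the length by its square, whose mean is a sum of two Gaussian
        second moments.\<close>
      also have "\<rho> \<le> 1 + \<rho>\<^sup>2"
      proof -
        have "0 \<le> (\<rho> - 1)\<^sup>2" by simp
        then have "2 * \<rho> \<le> 1 + \<rho>\<^sup>2" by (simp add: power2_diff)
        then show ?thesis using \<rho>0 by linarith
      qed
      finally have "measure (gauss ?J) {y\<in>space (gauss ?J). ?P (?z y)} \<le> c * (1 + (\<alpha>\<^sup>2 + \<beta>\<^sup>2))"
        using c by (simp add: \<rho>2 mult_left_mono)
      then show ?thesis by (simp add: gauss_prob.emeasure_eq_measure ennreal_leI \<alpha>_def \<beta>_def)
    qed
    have [measurable]: "?al \<in> borel_measurable (gauss ?W)" "?be \<in> borel_measurable (gauss ?W)"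
      by (intro borel_measurable_sum borel_measurable_times measurable_entry; auto)+
    have "(\<integral>\<^sup>+ w. ?g (merge ?R ?W (r, w)) \<partial>gauss ?W)
        \<le> (\<integral>\<^sup>+ w. ennreal c * (1 + (ennreal ((?al w)\<^sup>2) + ennreal ((?be w)\<^sup>2))) \<partial>gauss ?W)"
    proof (rule nn_integral_mono)
      fix w
      have "ennreal (c * (1 + ((?al w)\<^sup>2 + (?be w)\<^sup>2))) = ennreal c * (1 + (ennreal ((?al w)\<^sup>2) + ennreal ((?be w)\<^sup>2)))"
        using c by (simp add: ennreal_mult ennreal_plus)
      then show "?g (merge ?R ?W (r, w)) \<le> ennreal c * (1 + (ennreal ((?al w)\<^sup>2) + ennreal ((?be w)\<^sup>2)))"
        using pt[of w] by simp
    qed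
    also have "\<dots> = ennreal c * (1 + (1 + 1))"
      using gauss_inner_second_moment[OF n u, of i] gauss_inner_second_moment[OF n u', of i]
      by (simp add: nn_integral_cmult nn_integral_add gauss_prob.emeasure_space_1)
    also have "\<dots> = ennreal (3 * c)"
    proof -
      have "(1 + (1 + 1)) = ennreal 3" by (simp add: ennreal_numeral[symmetric] del: ennreal_numeral) (metis ennreal_1 ennreal_plus numeral_Bit1 numeral_One numeral_plus_one one_add_one zero_le_one add.commute ennreal_numeral one_plus_numeral semiring_norm(3))
      then show ?thesis using c by (simp add: ennreal_mult mult.commute)
    qed
    finally show "(\<integral>\<^sup>+ w. ?g (merge ?R ?W (r, w)) \<partial>gauss ?W) \<le> ennreal (3 * c)" .
  qed
  also have "\<dots> = ennreal (3 * c)" by (simp add: gauss_prob.emeasure_space_1)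
  finally show ?thesis using c by (simp add: ge.emeasure_eq_measure)
qed

section \<open>Column rotations and the spread of the coordinates\<close>

lemma wvec_norm:
  assumes n: "0 < n" and d: "det (gmat n x) \<noteq> 0"
  shows "(\<Sum>j<n. (wvec n x j)\<^sup>2) = 1" "0 < col0_nsq n x" "zvec n x 0 = 1"
proof -
  have "col0_nsq n x \<noteq> 0"
  proof
    assume "col0_nsq n x = 0"
    then have "ginv n x j 0 = 0" if "j < n" for j using that by (simp add: col0_nsq_def sum_nonneg_eq_0_iff)
    then show False using ginv_right[OF d n n] by simp
  qed
  moreover have "0 \<le> col0_nsq n x" by (simp add: col0_nsq_def sum_nonneg)
  ultimately show c: "0 < col0_nsq n x" by simp
  then show "(\<Sum>j<n. (wvec n x j)\<^sup>2) = 1"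
    by (simp add: wvec_def power_divide sum_divide_distrib[symmetric] col0_nsq_def[symmetric])
  have "(\<Sum>j<n. ginv n x j 0 * ginv n x j 0) = col0_nsq n x" by (simp add: col0_nsq_def power2_eq_square)
  then show "zvec n x 0 = 1" using c by (simp add: zvec_def)
qed

text \<open>Polarisation of \<open>gauss_rot_norm\<close>.\<close>

lemma gauss_rot_inner:
  assumes "Q \<in> gauss_rot n"
  shows "(\<Sum>i<n. (\<Sum>j<n. Q $$ (i, j) * f j) * (\<Sum>j<n. Q $$ (i, j) * g j)) = (\<Sum>j<n. f j * g j)"
proof -
  let ?S = "\<lambda>f :: nat \<Rightarrow> real. \<Sum>i<n. (\<Sum>j<n. Q $$ (i, j) * f j)\<^sup>2"
  have "?S (\<lambda>j. f j + g j) = ?S f + ?S g + 2 * (\<Sum>i<n. (\<Sum>j<n. Q $$ (i, j) * f j) * (\<Sum>j<n. Q $$ (i, j) * g j))"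
  proof -
    have "?S (\<lambda>j. f j + g j) = (\<Sum>i<n. ((\<Sum>j<n. Q $$ (i, j) * f j) + (\<Sum>j<n. Q $$ (i, j) * g j))\<^sup>2)"
      by (simp add: distrib_left sum.distrib)
    then show ?thesis by (simp only: power2_sum sum.distrib mult.assoc sum_distrib_left[symmetric])
  qed
  moreover have "(\<Sum>j<n. (f j + g j)\<^sup>2) = (\<Sum>j<n. (f j)\<^sup>2) + (\<Sum>j<n. (g j)\<^sup>2) + 2 * (\<Sum>j<n. f j * g j)"
    by (simp add: power2_sum sum.distrib sum_distrib_left mult.assoc)
  ultimately show ?thesis unfolding gauss_rot_norm[OF assms] by simp
qed

text \<open>The inverse is multiplied by \<open>Q\<close> from the left. Inner products of its
  columns, from which \<open>zvec\<close> is built, do not change, while \<open>wvec\<close> is a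
  normalised column and rotates. This decouples the two vectors.\<close>

lemma rmul_invariants:
  assumes n: "0 < n" and Q: "Q \<in> gauss_rot n"
  shows "col0_nsq n (rmul n Q x) = col0_nsq n x" "i < n \<Longrightarrow> zvec n (rmul n Q x) i = zvec n x i"
    "j < n \<Longrightarrow> wvec n (rmul n Q x) j = (\<Sum>l<n. Q $$ (j, l) * wvec n x l)"
    "nsq n (zvec n (rmul n Q x)) = nsq n (zvec n x)"
proof -
  have A: "ginv n (rmul n Q x) j i = (\<Sum>l<n. Q $$ (j, l) * ginv n x l i)" if "j < n" "i < n" for i j
    by (rule ginv_rmul[OF Q that])
  show c: "col0_nsq n (rmul n Q x) = col0_nsq n x"
    using n gauss_rot_norm[OF Q, of "\<lambda>j. ginv n x j 0"] by (simp add: col0_nsq_def A)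
  show z: "zvec n (rmul n Q x) i = zvec n x i" if "i < n" for i
    unfolding zvec_def c using n that gauss_rot_inner[OF Q, of "\<lambda>j. ginv n x j i" "\<lambda>j. ginv n x j 0"] by (simp add: A)
  show "wvec n (rmul n Q x) j = (\<Sum>l<n. Q $$ (j, l) * wvec n x l)" if "j < n" for j
    unfolding wvec_def c using n that by (simp add: A sum_divide_distrib)
  show "nsq n (zvec n (rmul n Q x)) = nsq n (zvec n x)" by (simp add: nsq_def z)
qed

text \<open>Singular matrices are excluded because there \<open>zvec\<close> is 0 by convention and
  would count as small.\<close>

definition small_coord :: "nat \<Rightarrow> real \<Rightarrow> nat \<Rightarrow> (nat \<times> nat \<Rightarrow> real) \<Rightarrow> real" where
  "small_coord n c i x = of_bool (det (gmat n x) \<noteq> 0 \<and> \<bar>zvec n x i\<bar> \<le> c)"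

lemma small_coord_01: "0 \<le> small_coord n c i x" "small_coord n c i x \<le> 1" by (auto simp: small_coord_def)

lemma measurable_small_coord [measurable]:
  assumes "i < n"
  shows "small_coord n c i \<in> borel_measurable (gaussian_entries n)"
proof -
  have [measurable]: "{x\<in>space (gaussian_entries n). det (gmat n x) \<noteq> 0 \<and> \<bar>zvec n x i\<bar> \<le> c} \<in> sets (gaussian_entries n)"
    using assms by measurable
  have "small_coord n c i \<in> borel_measurable (gaussian_entries n) \<longleftrightarrow>
    (indicator {x\<in>space (gaussian_entries n). det (gmat n x) \<noteq> 0 \<and> \<bar>zvec n x i\<bar> \<le> c} :: _ \<Rightarrow> real) \<in> borel_measurable (gaussian_entries n)"
    by (rule measurable_cong) (auto simp: small_coord_def indicator_def)
  then show ?thesis by simp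
qed

lemma expectation_small_coord:
  assumes i: "i < n" and c: "0 \<le> c" "c < 1"
  shows "(\<integral>x. small_coord n c i x \<partial>gaussian_entries n) \<le> 3 * c"
proof -
  let ?M = "gaussian_entries n"
  let ?A = "{x\<in>space ?M. det (gmat n x) \<noteq> 0 \<and> \<bar>zvec n x i\<bar> \<le> c}"
  have "(\<integral>x. small_coord n c i x \<partial>?M) = (\<integral>x. indicator ?A x \<partial>?M)"
    by (rule Bochner_Integration.integral_cong) (auto simp: small_coord_def indicator_def)
  also have "\<dots> = measure ?M ?A" using i by (simp, measurable)
  also have "\<dots> \<le> 3 * c"
  proof (cases "i = 0")
    case True
    \<comment> \<open>The first coordinate of \<open>zvec\<close> is 1, which \<open>c < 1\<close>
      keeps out of the event.\<close>
    then have e: "?A = {}" using wvec_norm(3)[of n] i c by fastforce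
    show ?thesis unfolding e using c by simp
  next
    case False
    then show ?thesis using zvec_small[OF _ i c(1)] by simp
  qed
  finally show ?thesis .
qed

lemma wvec_square_le_1:
  assumes "j < n"
  shows "(wvec n x j)\<^sup>2 \<le> 1"
proof (cases "det (gmat n x) = 0")
  case True
  then show ?thesis using assms by (simp add: wvec_def ginv_singular)
next
  case False
  have "(wvec n x j)\<^sup>2 \<le> (\<Sum>j<n. (wvec n x j)\<^sup>2)" using assms by (intro member_le_sum) auto
  then show ?thesis using wvec_norm(1)[OF _ False] assms by simp
qed

lemma integrable_bounded01:
  fixes f :: "_ \<Rightarrow> real"
  assumes "f \<in> borel_measurable (gaussian_entries n)" "\<And>x. 0 \<le> f x" "\<And>x. f x \<le> B"
  shows "integrable (gaussian_entries n) f"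
  using assms by (intro ge.integrable_const_bound[where B=B]) auto

lemma integrable_wvec_small_coord:
  assumes "j < n" "i < n"
  shows "integrable (gaussian_entries n) (\<lambda>x. (wvec n x j)\<^sup>2 * small_coord n c i x)"
proof (rule integrable_bounded01[where B=1])
  show "(\<lambda>x. (wvec n x j)\<^sup>2 * small_coord n c i x) \<in> borel_measurable (gaussian_entries n)"
    using assms by measurable
  fix x
  show "0 \<le> (wvec n x j)\<^sup>2 * small_coord n c i x" using small_coord_01 by (intro mult_nonneg_nonneg) auto
  show "(wvec n x j)\<^sup>2 * small_coord n c i x \<le> 1" using wvec_square_le_1[OF assms(1)] small_coord_01 by (intro mult_le_one) auto
qed

text \<open>
  Column rotations by a right angle leave \<open>zvec\<close> invariant and permute the squares of the coordinates of \<open>wvec\<close>.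
\<close>

lemma expectation_wvec_small_coord:
  assumes j: "j < n" and i: "i < n" and c: "0 \<le> c" "c < 1"
  shows "(\<integral>x. (wvec n x j)\<^sup>2 * small_coord n c i x \<partial>gaussian_entries n) \<le> 3 * c / n"
proof -
  let ?M = "gaussian_entries n"
  have n: "0 < n" using i by simp
  let ?E = "\<lambda>j. \<integral>x. (wvec n x j)\<^sup>2 * small_coord n c i x \<partial>?M"
  have eq: "?E l = ?E 0" if l: "l < n" for l
  proof (cases "l = 0")
    case False
    let ?Q = "givens n 0 l 0 1"
    have Q: "?Q \<in> gauss_rot n" using l n False by (intro givens_gauss_rot) auto
    have "wvec n (rmul n ?Q x) 0 = - wvec n x l" for x
      unfolding rmul_invariants(3)[OF n Q n] using l n False by (subst givens_sum) auto
    moreover have "small_coord n c i (rmul n ?Q x) = small_coord n c i x" for x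
      unfolding small_coord_def using rmul_invariants(2)[OF n Q i, of x] det_rmul[OF Q, of x] by simp
    moreover have "(\<integral>x. (wvec n (rmul n ?Q x) 0)\<^sup>2 * small_coord n c i (rmul n ?Q x) \<partial>?M) = ?E 0"
      by (rule preserves_integral[OF preserves_rmul[OF Q], of "\<lambda>x. (wvec n x 0)\<^sup>2 * small_coord n c i x"])
         (rule borel_measurable_integrable[OF integrable_wvec_small_coord[OF n i]])
    ultimately show ?thesis by simp
  qed simp
  have "(\<Sum>l<n. ?E l) = (\<Sum>l<n. ?E 0)" by (rule sum.cong[OF refl], rule eq) simp
  then have "real n * ?E 0 = (\<Sum>l<n. ?E l)" by simp
  also have "\<dots> = (\<integral>x. (\<Sum>l<n. (wvec n x l)\<^sup>2 * small_coord n c i x) \<partial>?M)"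
    by (rule Bochner_Integration.integral_sum[symmetric]) (use integrable_wvec_small_coord[OF _ i] in auto)
  also have "\<dots> = (\<integral>x. small_coord n c i x \<partial>?M)"
  proof (rule Bochner_Integration.integral_cong[OF refl])
    fix x
    show "(\<Sum>l<n. (wvec n x l)\<^sup>2 * small_coord n c i x) = small_coord n c i x"
    proof (cases "det (gmat n x) = 0")
      case False
      then show ?thesis using wvec_norm(1)[OF n False] by (simp add: sum_distrib_right[symmetric])
    qed (simp add: small_coord_def)
  qed
  also have "\<dots> \<le> 3 * c" by (rule expectation_small_coord[OF i c])
  finally have "?E 0 \<le> 3 * c / n" using n by (simp add: field_simps)
  then show ?thesis unfolding eq[OF j] .
qed

lemma markov_half:
  fixes f :: "_ \<Rightarrow> real"
  assumes f: "integrable (gaussian_entries n) f" "\<And>x. 0 \<le> f x" and e: "(\<integral>x. f x \<partial>gaussian_entries n) \<le> a * b" and a: "0 < a"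
  shows "measure (gaussian_entries n) {x\<in>space (gaussian_entries n). a \<le> f x} \<le> b"
proof -
  have "measure (gaussian_entries n) {x\<in>space (gaussian_entries n). a \<le> f x} \<le> (\<integral>x. f x \<partial>gaussian_entries n) / a"
    by (rule integral_Markov_inequality_measure[where A="{}"]) (use f a in auto)
  also have "\<dots> \<le> b" using e a by (simp add: pos_divide_le_eq mult.commute)
  finally show ?thesis .
qed

text \<open>Chosen so that \<open>3 * level = 1 / 8\<close>: both applications of Markov's
  inequality in \<open>prob_coords_spread\<close> then fail with probability at most
  \<open>1 / 4\<close>.\<close>

definition level :: real where "level = 1 / 24"

definition coords_spread :: "nat \<Rightarrow> (nat \<times> nat \<Rightarrow> real) \<Rightarrow> bool" where
  "coords_spread n x \<longleftrightarrow> det (gmat n x) \<noteq> 0 \<and> level\<^sup>2 / 2 \<le> (\<Sum>i<n. (zvec n x i * wvec n x i)\<^sup>2) \<and> level\<^sup>2 * n / 2 \<le> nsq n (zvec n x)"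

lemma sets_coords_spread: "{x\<in>space (gaussian_entries n). coords_spread n x} \<in> sets (gaussian_entries n)"
proof -
  have [measurable]: "(\<lambda>x. \<Sum>i<n. (zvec n x i * wvec n x i)\<^sup>2) \<in> borel_measurable (gaussian_entries n)"
    by (intro borel_measurable_sum borel_measurable_power borel_measurable_times measurable_zvec measurable_wvec) auto
  show ?thesis unfolding coords_spread_def by measurable
qed

text \<open>Outside two events of probability at most \<open>1 / 4\<close>, the small coordinates of
  \<open>zvec\<close> carry less than half of the mass of \<open>wvec\<close> and are less than half
  of all coordinates. The remaining ones give both lower bounds.\<close>

lemma prob_coords_spread:
  assumes n: "0 < n"
  shows "1 / 2 \<le> measure (gaussian_entries n) {x\<in>space (gaussian_entries n). coords_spread n x}"
proof -
  let ?M = "gaussian_entries n"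
  have c: "0 \<le> level" "level < 1" by (auto simp: level_def)
  let ?f = "\<lambda>x. \<Sum>i<n. (wvec n x i)\<^sup>2 * small_coord n level i x" and ?g = "\<lambda>x. \<Sum>i<n. small_coord n level i x"
  have If: "integrable ?M ?f" by (intro Bochner_Integration.integrable_sum integrable_wvec_small_coord) auto
  have Ib: "integrable ?M (small_coord n level i)" if "i < n" for i
    by (rule integrable_bounded01[where B=1]) (use that small_coord_01 in auto)
  have Ig: "integrable ?M ?g" by (intro Bochner_Integration.integrable_sum Ib) auto
  have "(\<integral>x. ?f x \<partial>?M) = (\<Sum>i<n. \<integral>x. (wvec n x i)\<^sup>2 * small_coord n level i x \<partial>?M)"
    by (rule Bochner_Integration.integral_sum) (use integrable_wvec_small_coord in auto)
  also have "\<dots> \<le> (\<Sum>i<n. 3 * level / n)" by (intro sum_mono expectation_wvec_small_coord c) auto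
  also have "\<dots> = 1 / 2 * (1 / 4)" using n by (simp add: level_def)
  finally have ef: "measure ?M {x\<in>space ?M. 1 / 2 \<le> ?f x} \<le> 1 / 4"
    by (intro markov_half If) (auto intro!: sum_nonneg mult_nonneg_nonneg small_coord_01)
  have "(\<integral>x. ?g x \<partial>?M) = (\<Sum>i<n. \<integral>x. small_coord n level i x \<partial>?M)"
    by (rule Bochner_Integration.integral_sum) (use Ib in auto)
  also have "\<dots> \<le> (\<Sum>i<n. 3 * level)" by (intro sum_mono expectation_small_coord c) auto
  also have "\<dots> = n / 2 * (1 / 4)" by (simp add: level_def)
  finally have eg: "measure ?M {x\<in>space ?M. n / 2 \<le> ?g x} \<le> 1 / 4"
    using n by (intro markov_half Ig) (auto intro!: sum_nonneg small_coord_01)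
  have ed: "measure ?M {x\<in>space ?M. det (gmat n x) = 0} = 0" by (rule det_null)
  let ?F = "{x\<in>space ?M. 1 / 2 \<le> ?f x}" and ?G = "{x\<in>space ?M. n / 2 \<le> ?g x}" and ?D = "{x\<in>space ?M. det (gmat n x) = 0}"
  have [measurable]: "?f \<in> borel_measurable ?M" "?g \<in> borel_measurable ?M" using If Ig by auto
  have sF: "?F \<in> sets ?M" and sG: "?G \<in> sets ?M" and sD: "?D \<in> sets ?M" by measurable
  have sub: "space ?M - {x\<in>space ?M. coords_spread n x} \<subseteq> ?F \<union> (?G \<union> ?D)"
  proof
    fix x assume x: "x \<in> space ?M - {x\<in>space ?M. coords_spread n x}"
    show "x \<in> ?F \<union> (?G \<union> ?D)"
    proof (rule ccontr)
      assume "x \<notin> ?F \<union> (?G \<union> ?D)"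
      then have d: "det (gmat n x) \<noteq> 0" and f: "?f x \<le> 1 / 2" and g: "?g x \<le> n / 2" using x by auto
      \<comment> \<open>The factor \<open>1 - small_coord\<close> selects the coordinates of modulus
        above \<open>level\<close> and makes the left side 0 elsewhere.\<close>
      have z: "level\<^sup>2 * (1 - small_coord n level i x) \<le> (zvec n x i)\<^sup>2" for i
      proof (cases "\<bar>zvec n x i\<bar> \<le> level")
        case True
        then show ?thesis using d by (simp add: small_coord_def)
      next
        case False
        then have "level\<^sup>2 \<le> \<bar>zvec n x i\<bar>\<^sup>2" using c by (intro power_mono) auto
        then show ?thesis using False by (simp add: small_coord_def)
      qed
      have "level\<^sup>2 / 2 \<le> level\<^sup>2 * (1 - ?f x)" using f by (simp add: level_def)
      also have "\<dots> = level\<^sup>2 * ((\<Sum>i<n. (wvec n x i)\<^sup>2) - ?f x)" using wvec_norm(1)[OF n d] by simp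
      also have "\<dots> = (\<Sum>i<n. level\<^sup>2 * (1 - small_coord n level i x) * (wvec n x i)\<^sup>2)"
        by (simp only: sum_subtractf[symmetric] sum_distrib_left) (simp add: algebra_simps)
      also have "\<dots> \<le> (\<Sum>i<n. (zvec n x i)\<^sup>2 * (wvec n x i)\<^sup>2)" by (intro sum_mono mult_right_mono z) auto
      finally have 1: "level\<^sup>2 / 2 \<le> (\<Sum>i<n. (zvec n x i * wvec n x i)\<^sup>2)" by (simp add: power_mult_distrib)
      have "level\<^sup>2 * n / 2 \<le> level\<^sup>2 * (n - ?g x)" using g by (simp add: level_def)
      also have "\<dots> = (\<Sum>i<n. level\<^sup>2 * (1 - small_coord n level i x))" by (simp add: sum_distrib_left[symmetric] sum_subtractf)
      also have "\<dots> \<le> nsq n (zvec n x)" unfolding nsq_def by (intro sum_mono z)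
      finally have "coords_spread n x" using 1 d by (simp add: coords_spread_def)
      then show False using x by auto
    qed
  qed
  have "measure ?M (space ?M - {x\<in>space ?M. coords_spread n x}) \<le> measure ?M (?F \<union> (?G \<union> ?D))"
    using sF sG sD by (intro ge.finite_measure_mono sub) auto
  also have "\<dots> \<le> measure ?M ?F + measure ?M (?G \<union> ?D)" using sF sG sD by (intro measure_Un_le) auto
  also have "\<dots> \<le> measure ?M ?F + (measure ?M ?G + measure ?M ?D)" using sG sD by (intro add_left_mono measure_Un_le) auto
  also have "\<dots> \<le> 1 / 2" using ef eg ed by simp
  finally show ?thesis using ge.prob_compl[OF sets_coords_spread[of n]] by simp
qed

definition inner_spread :: "nat \<Rightarrow> (nat \<times> nat \<Rightarrow> real) \<Rightarrow> bool" where
  "inner_spread n x \<longleftrightarrow> det (gmat n x) \<noteq> 0 \<and> (level / 2)\<^sup>2 \<le> (zw_inner n x)\<^sup>2 \<and> level\<^sup>2 * n / 2 \<le> nsq n (zvec n x)"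

lemma sets_inner_spread: "{x\<in>space (gaussian_entries n). inner_spread n x} \<in> sets (gaussian_entries n)"
  unfolding inner_spread_def by measurable

text \<open>
  Column sign flips leave \<open>zvec\<close> invariant and turn the inner product into a random sign sum.
\<close>

lemma prob_inner_spread:
  assumes n: "0 < n"
  shows "1 / (8 * khin 2) \<le> measure (gaussian_entries n) {x\<in>space (gaussian_entries n). inner_spread n x}"
proof -
  let ?M = "gaussian_entries n"
  let ?H = "{x\<in>space ?M. coords_spread n x}" and ?J = "{x\<in>space ?M. inner_spread n x}"
  let ?R = "\<lambda>e. rmul n (diagm n e)"
  have D: "diagm n e \<in> gauss_rot n" if "e \<in> signs n" for e by (rule diagm_gauss_rot) (rule signsD[OF that])
  have dot: "zw_inner n (?R e x) = (\<Sum>i<n. zvec n x i * wvec n x i * e i)" if e: "e \<in> signs n" for e x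
    unfolding zw_inner_def
  proof (rule sum.cong[OF refl])
    fix i assume "i \<in> {..<n}"
    then have i: "i < n" by simp
    have "wvec n (?R e x) i = e i * wvec n x i"
      unfolding rmul_invariants(3)[OF n D[OF e] i] by (rule diagm_sum[OF i])
    then show "zvec n (?R e x) i * wvec n (?R e x) i = zvec n x i * wvec n x i * e i"
      unfolding rmul_invariants(2)[OF n D[OF e] i] by simp
  qed
  have JR: "inner_spread n (?R e x)" if e: "e \<in> signs n" and h: "coords_spread n x"
    and b: "(\<Sum>i<n. (zvec n x i * wvec n x i)\<^sup>2) / 2 \<le> (\<Sum>i<n. zvec n x i * wvec n x i * e i)\<^sup>2" for e x
    using h b unfolding coords_spread_def inner_spread_def det_rmul[OF D[OF e]] dot[OF e] rmul_invariants(4)[OF n D[OF e]]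
    by (simp add: power_divide)
  have pointwise: "2 ^ n * indicator ?H x \<le> 4 * khin 2 * (\<Sum>e\<in>signs n. indicator ?J (?R e x) :: real)" if xs: "x \<in> space ?M" for x
  proof (cases "x \<in> ?H")
    case True
    then have h: "coords_spread n x" by simp
    \<comment> \<open>A matrix with one row, so that the norm of its image is the modulus of a sign
      sum.\<close>
    let ?A = "\<lambda>i :: nat. \<lambda>j. zvec n x j * wvec n x j"
    have "0 < level\<^sup>2 / 2" by (simp add: level_def)
    also have "\<dots> \<le> (\<Sum>i<(1::nat). \<Sum>j<n. (?A i j)\<^sup>2)" using h by (simp add: coords_spread_def)
    finally have "2 ^ n \<le> 4 * khin 2 * card {e\<in>signs n. (\<Sum>i<(1::nat). \<Sum>j<n. (?A i j)\<^sup>2) / 2 \<le> (\<Sum>i<(1::nat). (\<Sum>j<n. ?A i j * e j)\<^sup>2)}"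
      by (rule card_signs_norm_large)
    also have "\<dots> \<le> 4 * khin 2 * card {e\<in>signs n. ?R e x \<in> ?J}"
    proof (intro mult_left_mono of_nat_mono card_mono)
      show "{e\<in>signs n. (\<Sum>i<(1::nat). \<Sum>j<n. (?A i j)\<^sup>2) / 2 \<le> (\<Sum>i<(1::nat). (\<Sum>j<n. ?A i j * e j)\<^sup>2)} \<subseteq> {e\<in>signs n. ?R e x \<in> ?J}"
      proof clarify
        fix e assume e: "e \<in> signs n" and b: "(\<Sum>i<(1::nat). \<Sum>j<n. (?A i j)\<^sup>2) / 2 \<le> (\<Sum>i<(1::nat). (\<Sum>j<n. ?A i j * e j)\<^sup>2)"
        have "?R e x \<in> space ?M" using preserves_rmul[OF D[OF e]] xs unfolding preserves_def by (auto dest: measurable_space)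
        then show "?R e x \<in> space ?M \<and> inner_spread n (?R e x)" using JR[OF e h] b by simp
      qed
    qed (use khin_ge[of 2] in auto)
    also have "real (card {e\<in>signs n. ?R e x \<in> ?J}) = (\<Sum>e\<in>signs n. indicator ?J (?R e x))"
      by (simp add: indicator_def sum.If_cases Int_def)
    finally show ?thesis using True by simp
  qed (use khin_ge[of 2] in \<open>auto intro!: mult_nonneg_nonneg sum_nonneg\<close>)
  have mJ: "(\<lambda>x. indicator ?J (?R e x) :: real) \<in> borel_measurable ?M" if e: "e \<in> signs n" for e
    using preserves_rmul[OF D[OF e]] sets_inner_spread[of n] unfolding preserves_def
    by (auto intro: measurable_compose[OF _ borel_measurable_indicator])
  have iJ: "integrable ?M (\<lambda>x. indicator ?J (?R e x) :: real)" if e: "e \<in> signs n" for e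
    by (rule integrable_bounded01[where B=1]) (use mJ[OF e] in \<open>auto simp: indicator_def\<close>)
  have eJ: "(\<integral>x. indicator ?J (?R e x) \<partial>?M) = measure ?M ?J" if e: "e \<in> signs n" for e
    using preserves_integral[OF preserves_rmul[OF D[OF e]], of "indicator ?J"] sets_inner_spread[of n] by simp
  \<comment> \<open>The probability \<open>1 / 2\<close> of \<open>coords_spread\<close> is
    multiplied by the proportion \<open>1 / (4 * khin 2)\<close> of good signs; by \<open>eJ\<close>
    all flipped events have the same probability.\<close>
  have "2 ^ n * (1 / 2) \<le> 2 ^ n * measure ?M ?H" using prob_coords_spread[OF n] by (intro mult_left_mono) auto
  also have "\<dots> = (\<integral>x. 2 ^ n * indicator ?H x \<partial>?M)" using sets_coords_spread[of n] by simp
  also have "\<dots> \<le> (\<integral>x. 4 * khin 2 * (\<Sum>e\<in>signs n. indicator ?J (?R e x)) \<partial>?M)"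
    using sets_coords_spread[of n] iJ by (intro integral_mono pointwise) (auto intro!: integrable_real_indicator simp: ge.emeasure_eq_measure)
  also have "\<dots> = 4 * khin 2 * (\<Sum>e\<in>signs n. measure ?M ?J)"
    using iJ by (simp add: eJ Bochner_Integration.integral_sum)
  also have "\<dots> = 2 ^ n * (4 * khin 2 * measure ?M ?J)" by simp
  finally have "1 / 2 \<le> 4 * khin 2 * measure ?M ?J" by (rule mult_left_le_imp_le) simp
  then show ?thesis using khin_ge[of 2] by (simp add: field_simps)
qed

text \<open>From \<open>\<bar>z \<bullet> w\<bar> \<ge> level / 2\<close> to the power
  \<open>k\<close>, and \<open>\<parallel>z\<parallel> \<ge> level * sqrt (n / 2)\<close> without
  its factor \<open>sqrt n\<close>.\<close>

definition lead_const :: "nat \<Rightarrow> real" where "lead_const k = (level / 2) ^ k * (level / sqrt 2)"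

lemma lead_const_pos: "0 < lead_const k" "lead_const k \<le> 1"
proof -
  show "0 < lead_const k" by (simp add: lead_const_def level_def)
  have "level / sqrt 2 \<le> 1" 
  proof -
    have "level / sqrt 2 \<le> 1 / 1" by (rule frac_le) (auto simp: level_def)
    then show ?thesis by (simp only: div_by_1)
  qed
  then show "lead_const k \<le> 1" unfolding lead_const_def by (intro mult_le_one power_le_one) (auto simp: level_def)
qed

lemma inner_spread_zw_large:
  assumes "inner_spread n x"
  shows "zw_large n k (lead_const k * sqrt n) x"
proof -
  have c: "0 \<le> level" by (simp add: level_def)
  have "level / 2 \<le> \<bar>zw_inner n x\<bar>" using assms c abs_le_square_iff[of "level / 2" "zw_inner n x"] by (simp add: inner_spread_def)
  then have 1: "(level / 2) ^ k \<le> \<bar>zw_inner n x\<bar> ^ k" using c by (intro power_mono) auto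
  have "level / sqrt 2 * sqrt n = sqrt (level\<^sup>2 * n / 2)" using c by (simp add: real_sqrt_mult real_sqrt_divide)
  also have "\<dots> \<le> sqrt (nsq n (zvec n x))" using assms by (intro real_sqrt_le_mono) (simp add: inner_spread_def)
  finally have "(level / 2) ^ k * (level / sqrt 2 * sqrt n) \<le> \<bar>zw_inner n x\<bar> ^ k * sqrt (nsq n (zvec n x))"
    using 1 c by (intro mult_mono) auto
  then show ?thesis using assms by (simp add: zw_large_def inner_spread_def lead_const_def mult.assoc)
qed

text \<open>With \<open>T = t * scale_const k\<close>, one of the factors in
  \<open>T ^ Suc k\<close> cancels \<open>lead_const k\<close> and the power of 2 lost on the line;
  the other \<open>k\<close> factors are at least 1.\<close>

definition scale_const :: "nat \<Rightarrow> real" where "scale_const k = 2 ^ Suc (Suc k) / lead_const k"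

lemma scale_const_ge: "1 \<le> scale_const k"
proof -
  have "lead_const k \<le> 1" by (rule lead_const_pos)
  also have "(1::real) \<le> 2 ^ Suc (Suc k)" by (rule one_le_power) simp
  finally show ?thesis using lead_const_pos(1)[of k] by (simp add: scale_const_def)
qed

lemma prob_wz_form_large:
  fixes t :: real
  assumes n: "0 < n" and t: "1 \<le> t"
  shows "line_const (Suc k) / (scale_const k * 8 * khin 2) / t
    \<le> measure (gaussian_entries n) {x\<in>space (gaussian_entries n). wz_form_large n (Suc k) (t ^ Suc k * sqrt n) x}"
proof -
  let ?M = "gaussian_entries n"
  let ?L = "lead_const k * sqrt n" let ?T = "t * scale_const k"
  have T: "1 \<le> ?T" using t scale_const_ge[of k] by (metis mult_mono mult_1 order_trans zero_le_one)
  have k0: "0 < scale_const k" using scale_const_ge[of k] by simp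
  have "line_const (Suc k) / (scale_const k * 8 * khin 2) / t = line_const (Suc k) / ?T * (1 / (8 * khin 2))" by (simp add: mult_ac)
  also have "\<dots> \<le> line_const (Suc k) / ?T * measure ?M {x\<in>space ?M. inner_spread n x}"
    using line_const_pos[of "Suc k"] T by (intro mult_left_mono prob_inner_spread n) auto
  also have "\<dots> \<le> line_const (Suc k) / ?T * measure ?M {x\<in>space ?M. zw_large n k ?L x}"
  proof (intro mult_left_mono ge.finite_measure_mono sets_zw_large)
    show "{x\<in>space ?M. inner_spread n x} \<subseteq> {x\<in>space ?M. zw_large n k ?L x}" using inner_spread_zw_large by auto
    show "0 \<le> line_const (Suc k) / ?T" using line_const_pos[of "Suc k"] T by simp
  qed
  also have "\<dots> \<le> measure ?M {x\<in>space ?M. wz_form_large n (Suc k) (?T ^ Suc k * ?L / 2 ^ Suc (Suc k)) x}"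
    by (rule wz_form_large_ge_zw_large[OF n T])
  also have "\<dots> \<le> measure ?M {x\<in>space ?M. wz_form_large n (Suc k) (t ^ Suc k * sqrt n) x}"
  proof (intro ge.finite_measure_mono sets_wz_form_large)
    have "1 \<le> scale_const k ^ k" using scale_const_ge by (rule one_le_power)
    then have "t ^ Suc k * sqrt n * 1 \<le> t ^ Suc k * sqrt n * scale_const k ^ k" using t by (intro mult_left_mono) auto
    also have "\<dots> = ?T ^ Suc k * ?L / 2 ^ Suc (Suc k)"
    proof -
      have 1: "scale_const k * lead_const k / 2 ^ Suc (Suc k) = 1" using lead_const_pos(1)[of k] by (simp add: scale_const_def)
      have "?T ^ Suc k * ?L / 2 ^ Suc (Suc k) = t ^ Suc k * sqrt n * scale_const k ^ k * (scale_const k * lead_const k / 2 ^ Suc (Suc k))"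
        by (simp add: power_mult_distrib)
      then show ?thesis unfolding 1 by simp
    qed
    finally have "t ^ Suc k * sqrt n \<le> ?T ^ Suc k * ?L / 2 ^ Suc (Suc k)" by simp
    then show "{x\<in>space ?M. wz_form_large n (Suc k) (?T ^ Suc k * ?L / 2 ^ Suc (Suc k)) x} \<subseteq> {x\<in>space ?M. wz_form_large n (Suc k) (t ^ Suc k * sqrt n) x}"
      unfolding wz_form_large_def by auto
  qed
  finally show ?thesis .
qed

section \<open>The two-sided bounds\<close>

lemma wz_form_large_s_min:
  fixes R :: real
  assumes n: "0 < n" and R: "0 < R" and b: "wz_form_large n k R x"
  shows "s_min (gmat n x ^\<^sub>m k) \<le> 1 / R"
proof -
  have d: "det (gmat n x) \<noteq> 0" and f: "R \<le> \<bar>wz_form n k x\<bar>" using b by (auto simp: wz_form_large_def)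
  have "nsq n (zvec n x) \<noteq> 0"
  proof
    assume "nsq n (zvec n x) = 0"
    then show False using f R by (simp add: wz_form_def)
  qed
  then have z: "0 < nsq n (zvec n x)" by (simp add: less_le)
  show ?thesis
  proof (rule s_min_le_of_bilinear[OF n d R])
    show "nsq n (wvec n x) = 1" using wvec_norm(1)[OF n d] by (simp add: nsq_def)
    have "nsq n (\<lambda>j. 1 / sqrt (nsq n (zvec n x)) * zvec n x j) = 1" using z by (simp only: nsq_scale) (simp add: power_divide)
    then show "nsq n (\<lambda>j. zvec n x j / sqrt (nsq n (zvec n x))) = 1" by simp
    show "R \<le> \<bar>\<Sum>i<n. \<Sum>j<n. wvec n x i * gpow n x k i j * (zvec n x j / sqrt (nsq n (zvec n x)))\<bar>"
      using f by (simp add: wz_form_def)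
  qed
qed

lemma powr_minus_half: "0 < n \<Longrightarrow> real n powr (- 1 / 2) = 1 / sqrt (real n)"
  by (simp add: powr_minus powr_half_sqrt field_simps)

lemma s_min_lower:
  fixes t :: real
  assumes n: "0 < n" and t: "0 < t" "t \<le> 1"
  shows "line_const (Suc k) / (scale_const k * 8 * khin 2) * t
    \<le> measure (gaussian_entries n) {x\<in>space (gaussian_entries n). s_min (gmat n x ^\<^sub>m Suc k) \<le> t ^ Suc k * real n powr (- 1 / 2)}"
proof -
  let ?M = "gaussian_entries n"
  \<comment> \<open>The lower bound for the form is used at \<open>1 / t\<close>, so that
    \<open>1 / ?R\<close> is the level prescribed for \<open>s_min\<close>.\<close>
  let ?R = "(1 / t) ^ Suc k * sqrt n"
  have R: "0 < ?R" using t n by simp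
  have e: "1 / ?R = t ^ Suc k * real n powr (- 1 / 2)"
    using t n by (simp only: powr_minus_half[OF n]) (simp add: power_divide)
  have "line_const (Suc k) / (scale_const k * 8 * khin 2) / (1 / t) \<le> measure ?M {x\<in>space ?M. wz_form_large n (Suc k) ?R x}"
    using t by (intro prob_wz_form_large[OF n]) simp
  also have "\<dots> \<le> measure ?M {x\<in>space ?M. s_min (gmat n x ^\<^sub>m Suc k) \<le> t ^ Suc k * real n powr (- 1 / 2)}"
  proof (rule ge.finite_measure_mono)
    show "{x\<in>space ?M. wz_form_large n (Suc k) ?R x} \<subseteq> {x\<in>space ?M. s_min (gmat n x ^\<^sub>m Suc k) \<le> t ^ Suc k * real n powr (- 1 / 2)}"
      using wz_form_large_s_min[OF n R] unfolding e by blast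
    show "{x\<in>space ?M. s_min (gmat n x ^\<^sub>m Suc k) \<le> t ^ Suc k * real n powr (- 1 / 2)} \<in> sets ?M"
      using t by (intro sets_s_min_le n) simp
  qed
  finally show ?thesis by simp
qed

lemma sqrt_hsq_pow_iff:
  fixes t :: real
  assumes "0 \<le> t"
  shows "t ^ k * sqrt n \<le> sqrt (hsq_pow n k x) \<longleftrightarrow> t ^ (2 * k) * n \<le> hsq_pow n k x"
proof -
  have "t ^ k * sqrt n = sqrt (t ^ (2 * k) * n)"
    using assms by (simp add: real_sqrt_mult power_mult real_sqrt_power[symmetric] power_even_abs mult.commute[of 2])
  then show ?thesis by (simp only: real_sqrt_le_iff)
qed

text \<open>For invertible matrices the first event is contained in the second, since the operator
  norm of the inverse power is at most its Hilbert--Schmidt norm; singular matrices form a null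
  set.\<close>

lemma s_min_le_hs:
  fixes t :: real
  assumes n: "0 < n" and t: "0 < t"
  shows "measure (gaussian_entries n) {x\<in>space (gaussian_entries n). s_min (gmat n x ^\<^sub>m k) \<le> t ^ k * real n powr (- 1 / 2)}
    \<le> measure (gaussian_entries n) {x\<in>space (gaussian_entries n). (1 / t) ^ (2 * k) * n \<le> hsq_pow n k x}"
proof -
  let ?M = "gaussian_entries n"
  let ?A = "{x\<in>space ?M. s_min (gmat n x ^\<^sub>m k) \<le> t ^ k * real n powr (- 1 / 2)}"
  let ?B = "{x\<in>space ?M. (1 / t) ^ (2 * k) * n \<le> hsq_pow n k x}"
  let ?D = "{x\<in>space ?M. det (gmat n x) = 0}"
  have sB: "?B \<in> sets ?M" and sD: "?D \<in> sets ?M" by measurable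
  have "?A \<subseteq> ?B \<union> ?D"
  proof
    fix x assume x: "x \<in> ?A"
    show "x \<in> ?B \<union> ?D"
    proof (cases "det (gmat n x) = 0")
      case False
      have "1 \<le> (t ^ k * real n powr (- 1 / 2))\<^sup>2 * hsq_pow n k x"
        by (rule hsq_pow_ge_of_s_min[OF n False]) (use x t in auto)
      also have "(t ^ k * real n powr (- 1 / 2))\<^sup>2 = t ^ (2 * k) / n"
        unfolding powr_minus_half[OF n] using n by (simp add: power_mult_distrib power_divide power_mult[symmetric] mult.commute)
      finally have "(1 / t) ^ (2 * k) * n \<le> hsq_pow n k x" using t n by (simp add: power_divide field_simps)
      then show ?thesis using x by simp
    qed (use x in simp)
  qed
  then have "measure ?M ?A \<le> measure ?M (?B \<union> ?D)" using sB sD by (intro ge.finite_measure_mono) auto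
  also have "\<dots> \<le> measure ?M ?B + measure ?M ?D" using sB sD by (intro measure_Un_le) auto
  finally show ?thesis using det_null[of n] by simp
qed

theorem theorem1p1:
  fixes k :: nat
  assumes "k \<ge> 1"
  shows "\<exists>C::real. C \<ge> 1 \<and> (\<forall>n::nat. n \<ge> 1 \<longrightarrow>
    (\<forall>t::real. t \<ge> 1 \<longrightarrow>
      inverse C * (1 / t)
        \<le> \<P>(\<omega> in gaussian_entries n. hs_norm (inv_mat (Matrix.mat n n \<omega>) ^\<^sub>m k) \<ge> t ^ k * sqrt (real n)) \<and>
      \<P>(\<omega> in gaussian_entries n. hs_norm (inv_mat (Matrix.mat n n \<omega>) ^\<^sub>m k) \<ge> t ^ k * sqrt (real n))
        \<le> C * (1 / t)) \<and>
    (\<forall>t::real. 0 < t \<and> t \<le> 1 \<longrightarrow>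
      inverse C * t
        \<le> \<P>(\<omega> in gaussian_entries n. s_min (Matrix.mat n n \<omega> ^\<^sub>m k) \<le> t ^ k * real n powr (- 1 / 2)) \<and>
      \<P>(\<omega> in gaussian_entries n. s_min (Matrix.mat n n \<omega> ^\<^sub>m k) \<le> t ^ k * real n powr (- 1 / 2))
        \<le> C * t))"
proof -
  obtain m where m: "k = Suc m" using assms by (cases k) auto
  define c where "c = line_const (Suc m) / (scale_const m * 8 * khin 2)"
  have c: "0 < c" unfolding c_def using line_const_pos[of "Suc m"] scale_const_ge[of m] khin_ge[of 2] by (intro divide_pos_pos mult_pos_pos) auto
  define C where "C = Max {1, tail_const k, 1 / c}"
  have C: "1 \<le> C" "tail_const k \<le> C" "1 / c \<le> C" by (auto simp: C_def)
  have C': "inverse C \<le> c" using C c by (simp add: field_simps)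
  have low: "inverse C * t \<le> measure (gaussian_entries n) {x\<in>space (gaussian_entries n). s_min (gmat n x ^\<^sub>m k) \<le> t ^ k * real n powr (- 1 / 2)}"
    if n: "0 < n" and t: "0 < t" "t \<le> 1" for n and t :: real
  proof -
    have "inverse C * t \<le> c * t" using C' t by (intro mult_right_mono) auto
    also have "\<dots> \<le> measure (gaussian_entries n) {x\<in>space (gaussian_entries n). s_min (gmat n x ^\<^sub>m k) \<le> t ^ k * real n powr (- 1 / 2)}"
      unfolding c_def m by (rule s_min_lower[OF n t])
    finally show ?thesis .
  qed
  have up: "measure (gaussian_entries n) {x\<in>space (gaussian_entries n). t ^ (2 * k) * n \<le> hsq_pow n k x} \<le> C * (1 / t)"
    if n: "0 < n" and t: "0 < t" for n and t :: real
  proof -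
    have "measure (gaussian_entries n) {x\<in>space (gaussian_entries n). t ^ (2 * k) * n \<le> hsq_pow n k x} \<le> tail_const k / t"
      by (rule hsq_pow_tail[OF n t]) (simp add: m)
    also have "\<dots> \<le> C / t" using C t by (intro divide_right_mono) auto
    finally show ?thesis by simp
  qed
  have hs: "{x\<in>space (gaussian_entries n). hs_norm (inv_mat (Matrix.mat n n x) ^\<^sub>m k) \<ge> t ^ k * sqrt (real n)}
      = {x\<in>space (gaussian_entries n). t ^ (2 * k) * n \<le> hsq_pow n k x}" if t: "0 < t" for n and t :: real
    using sqrt_hsq_pow_iff[of t k n] t by (simp add: gmat_def[symmetric] hs_norm_hsq_pow)
  show ?thesis
  proof (intro exI[of _ C] conjI allI impI C(1))
    fix n :: nat and t :: real assume n: "1 \<le> n" and t: "1 \<le> t"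
    then have n': "0 < n" and t': "0 < t" "0 < 1 / t" "1 / t \<le> 1" by auto
    show "\<P>(\<omega> in gaussian_entries n. hs_norm (inv_mat (Matrix.mat n n \<omega>) ^\<^sub>m k) \<ge> t ^ k * sqrt (real n)) \<le> C * (1 / t)"
      unfolding hs[OF t'(1)] by (rule up[OF n' t'(1)])
    \<comment> \<open>The lower bound for \<open>s_min\<close> at \<open>1 / t\<close>, carried over
      to the norm by \<open>s_min_le_hs\<close>.\<close>
    show "inverse C * (1 / t) \<le> \<P>(\<omega> in gaussian_entries n. hs_norm (inv_mat (Matrix.mat n n \<omega>) ^\<^sub>m k) \<ge> t ^ k * sqrt (real n))"
      unfolding hs[OF t'(1)] using low[OF n' t'(2,3)] s_min_le_hs[OF n' t'(2), of k] by simp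
  next
    fix n :: nat and t :: real assume n: "1 \<le> n" and t: "0 < t \<and> t \<le> 1"
    then have n': "0 < n" and t': "0 < t" "t \<le> 1" "0 < 1 / t" by auto
    show "inverse C * t \<le> \<P>(\<omega> in gaussian_entries n. s_min (Matrix.mat n n \<omega> ^\<^sub>m k) \<le> t ^ k * real n powr (- 1 / 2))"
      using low[OF n' t'(1,2)] by (simp only: gmat_def)
    show "\<P>(\<omega> in gaussian_entries n. s_min (Matrix.mat n n \<omega> ^\<^sub>m k) \<le> t ^ k * real n powr (- 1 / 2)) \<le> C * t"
      using s_min_le_hs[OF n' t'(1), of k] up[OF n' t'(3)] by (simp add: gmat_def)
  qed
qed

end
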